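(* Let $X$ be a proper geodesic metric space with a convergence boundary $\partial X$, let $\Gamma<\mathrm{Isom}(X)$ be a non-elementary discrete subgroup with contracting elements such that the proper action $\Gamma\curvearrowright X$ is statistically convex-cocompact (SCC), and let $\mu_o$ be the Patterson–Sullivan measure on $\partial X$ constructed from $\Gamma\curvearrowright X$. Let a group $H<\mathrm{Isom}(X)$ act properly on $X$ with contracting elements, and assume that $\omega_H<\omega_\Gamma/2$. Then $\mu_o(\Lambda^{\mathrm{Hor}}(Ho))=0$, where $\Lambda^{\mathrm{Hor}}(Ho)$ is the big horospheric limit set of $Ho$. In addition, assume that $H$ is torsion-free and preserves the measure class of $\mu_o$ on $\partial X$ (in particular, if $H$ is a subgroup of $\Gamma$). Then the action of $H$ on $(\partial X,\mu_o)$ is completely dissipative.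
   Context: Fix $o\in X$. Contracting: a closed $Z\subseteq X$ is $C$-contracting if $\mathrm{diam}(\pi_Z(x)\cup\pi_Z(y))\le C$ whenever $d(x,y)\le d(x,Z)$, where $\pi_Z$ is the nearest-point projection (set). An isometry $g$ is contracting if $n\mapsto g^no$ is a quasi-isometric embedding of $\mathbb Z$ with contracting image. A group is elementary if finite or virtually $\mathbb Z$. Growth rate: $\omega_A=\limsup_n\frac1n\log\sharp\{go:g\in A,d(o,go)\le n\}$. SCC: for $0\le M_1\le M_2$ let $\mathcal O_{M_1,M_2}$ be the set of $g\in\Gamma$ such that some geodesic between $N_{M_2}(o)$ and $N_{M_2}(go)$ has interior outside $N_{M_1}(\Gamma o)$ ($N_r$ = $r$-neighborhood). The action is SCC if $\omega_{\mathcal O_{M_1,M_2}}<\omega_\Gamma<\infty$ for some $M_1,M_2>0$. Convergence boundary: a metrizable compactification $\overline X=X\cup\partial X$ with $X$ open and dense, to which the action of $\mathrm{Isom}(X)$ extends by homeomorphisms, with an $\mathrm{Isom}(X)$-invariant partition $[\cdot]$ of $\partial X$ ($[\xi]$ is the class of $\xi$; $[A]=\bigcup_{\xi\in A}[\xi]$). A sequence tends (accumulates) to $[\xi]$ if its limit (all its accumulation points) lie in $[\xi]$; subsets or points $A_n$ are escaping if $d(o,A_n)\to\infty$. Required: (A) any contracting geodesic ray $\gamma$ accumulates into a closed class $[\xi]$, and any $y_n\in X$ with $\pi_\gamma(y_n)$ escaping tends to $[\xi]$. (B) for any escaping sequence of $C$-contracting quasi-geodesics $X_n$ ($C$ fixed),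 and any $o$, some subsequence of the cones $\Omega_o(X_n)=\{y\in X:\text{some geodesic }[o,y]\text{ meets }X_n\}$ accumulates to a class $[\xi]$, i.e. any convergent sequence $y_n\in\Omega_o(X_n)$ tends to a point of $[\xi]$. (C) the set $\mathcal C$ of non-pinched points is nonempty, where $\xi$ is non-pinched if for all sequences $x_n,y_n\in X$ converging to $[\xi]$ the segments $[x_n,y_n]$ are escaping; and for $\xi\in\mathcal C$, $[\cdot]$ is closed on $U=\Gamma[\xi]$: if $x_n,y_n\in U$, $[x_n]=[y_n]$, $x_n\to\xi'$, $y_n\to\eta'$, then $[\xi']=[\eta']$. Busemann quasi-cocycles and horoballs: it is assumed that there is $\mathcal C^{\mathrm{hor}}\subseteq\mathcal C$ and functions $B_\xi:X\times X\to\mathbb R$ ($\xi\in\mathcal C^{\mathrm{hor}}$) with $\limsup_{z\to[\xi]}|B_\xi(x,y)-(d(x,z)-d(y,z))|\le\epsilon$ for all $x,y\in X$, where $\epsilon$ may depend on $[\xi]$. Put $B_{[\xi]}(x,y)=\limsup_{z\to[\xi]}(d(x,z)-d(y,z))$ and $\mathcal{HB}([\xi],L)=\{y\in X:B_{[\xi]}(y,o)\le L\}$. The limit set $\Lambda(Ho)$ is the set of accumulation points of $Ho$ in $\partial X$. A point $\xi\in[\Lambda(Ho)]\cap\mathcal C^{\mathrm{hor}}$ is a big (resp. small) horospheric limit point if some (resp. any) horoball $\mathcal{HB}([\xi],L)$ contains infinitely many $h_no\in Ho$ (tending to $[\xi]$). $\Lambda^{\mathrm{Hor}}(Ho)$ is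 the set of big horospheric limit points. Patterson–Sullivan measures: for $s>\omega_\Gamma$ let $\mu_x^s=\mathcal P_\Gamma(s)^{-1}\sum_{g\in\Gamma}e^{-sd(x,go)}\delta_{go}$, $\mathcal P_\Gamma(s)=\sum_{g\in\Gamma}e^{-sd(o,go)}$ (SCC actions satisfy $\mathcal P_\Gamma(\omega_\Gamma)=\infty$); $\{\mu_x\}$ is a weak limit along $s_i\searrow\omega_\Gamma$, with $\mu_o$ a probability. It is assumed to be a nontrivial $\omega_\Gamma$-dimensional $\Gamma$-equivariant quasi-conformal density on $\partial X$: $g_\star\mu_x=\mu_{gx}$ for $g\in\Gamma$; for some $\lambda\ge1$, $\lambda^{-1}e^{-\omega_\Gamma B_\xi(x,y)}\le\frac{d\mu_x}{d\mu_y}(\xi)\le\lambda e^{-\omega_\Gamma B_\xi(x,y)}$ for $\mu_y$-a.e. $\xi$; and $\mu_o$ is supported on $\mathcal C$. Completely dissipative: there is a measurable $A$ with $hA\cap A=\emptyset$ for all $1\ne h\in H$ and $\bigcup_{h\in H}hA=\partial X$ up to a $\mu_o$-null set. *)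

theory Defs
  imports "HOL-Analysis.Analysis" "HOL-Probability.Probability_Measure" "HOL-Algebra.Elementary_Groups"
begin

section \<open>Geodesics, quasi-geodesics and contracting subsets\<close>

definition geodesic_on :: "real set \<Rightarrow> (real \<Rightarrow> 'x::metric_space) \<Rightarrow> bool" where
  "geodesic_on I \<gamma> \<longleftrightarrow> (\<forall>s\<in>I. \<forall>t\<in>I. dist (\<gamma> s) (\<gamma> t) = \<bar>s - t\<bar>)"

definition geodesic_segment :: "'x::metric_space \<Rightarrow> 'x \<Rightarrow> 'x set \<Rightarrow> bool" where
  "geodesic_segment x y S \<longleftrightarrow>
     (\<exists>\<gamma> L. 0 \<le> L \<and> geodesic_on {0..L} \<gamma> \<and> \<gamma> 0 = x \<and> \<gamma> L = y \<and> S = \<gamma> ` {0..L})"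

definition quasi_isometric_embedding ::
    "real \<Rightarrow> real \<Rightarrow> real set \<Rightarrow> (real \<Rightarrow> 'x::metric_space) \<Rightarrow> bool" where
  "quasi_isometric_embedding k c I f \<longleftrightarrow> 1 \<le> k \<and> 0 \<le> c \<and>
     (\<forall>s\<in>I. \<forall>t\<in>I. \<bar>s - t\<bar> / k - c \<le> dist (f s) (f t) \<and> dist (f s) (f t) \<le> k * \<bar>s - t\<bar> + c)"

definition quasi_geodesic :: "real \<Rightarrow> real \<Rightarrow> 'x::metric_space set \<Rightarrow> bool" where
  "quasi_geodesic k c Z \<longleftrightarrow>
     (\<exists>I f. is_interval I \<and> I \<noteq> {} \<and> quasi_isometric_embedding k c I f \<and> Z = f ` I)"

definition nearest_points :: "'x::metric_space set \<Rightarrow> 'x \<Rightarrow> 'x set" where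
  "nearest_points Z x = {z \<in> Z. dist x z = infdist x Z}"

definition contracting :: "real \<Rightarrow> 'x::metric_space set \<Rightarrow> bool" where
  "contracting C Z \<longleftrightarrow> closed Z \<and>
     (\<forall>x y. dist x y \<le> infdist x Z \<longrightarrow> diameter (nearest_points Z x \<union> nearest_points Z y) \<le> C)"

definition escaping :: "(nat \<Rightarrow> 'x::metric_space set) \<Rightarrow> bool" where
  "escaping A \<longleftrightarrow> (\<forall>q. filterlim (\<lambda>n. infdist q (A n)) at_top sequentially)"

definition cone :: "'x::metric_space \<Rightarrow> 'x set \<Rightarrow> 'x set" where
  "cone q Z = {y. \<exists>S. geodesic_segment q y S \<and> S \<inter> Z \<noteq> {}}"


section \<open>Groups of isometries\<close>

definition isometry_group :: "('x::metric_space \<Rightarrow> 'x) monoid" where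
  "isometry_group =
     \<lparr>carrier = {f. (\<forall>x y. dist (f x) (f y) = dist x y) \<and> surj f}, monoid.mult = (\<circ>), one = id\<rparr>"

lemma group_isometry_group: "group (isometry_group :: ('x::metric_space \<Rightarrow> 'x) monoid)"
proof (rule groupI)
  fix f :: "'x \<Rightarrow> 'x" assume f: "f \<in> carrier isometry_group"
  then have iso: "\<And>x y. dist (f x) (f y) = dist x y" and "surj f"
    by (auto simp: isometry_group_def)
  have "inj f"
    by (rule injI) (metis iso dist_eq_0_iff)
  have inv: "f (inv_into UNIV f x) = x" for x
    using \<open>surj f\<close> by (rule surj_f_inv_f)
  have "dist (inv_into UNIV f x) (inv_into UNIV f y) = dist x y" for x y
    by (metis inv iso)
  moreover have "surj (inv_into UNIV f)"
    using \<open>inj f\<close> by (rule inj_imp_surj_inv)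
  moreover have "inv_into UNIV f \<circ> f = id"
    using \<open>inj f\<close> by simp
  ultimately show "\<exists>g\<in>carrier isometry_group. g \<otimes>\<^bsub>isometry_group\<^esub> f = \<one>\<^bsub>isometry_group\<^esub>"
    by (intro bexI[of _ "inv_into UNIV f"]) (simp_all add: isometry_group_def)
next
  fix f g :: "'x \<Rightarrow> 'x"
  assume "f \<in> carrier isometry_group" "g \<in> carrier isometry_group"
  moreover from this have "surj (f \<circ> g)"
    by (intro comp_surj) (simp_all add: isometry_group_def)
  ultimately show "f \<otimes>\<^bsub>isometry_group\<^esub> g \<in> carrier isometry_group"
    by (simp add: isometry_group_def)
qed (auto simp: isometry_group_def fun_eq_iff)

definition acts_properly :: "('x::metric_space \<Rightarrow> 'x) set \<Rightarrow> bool" where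
  "acts_properly G \<longleftrightarrow> (\<forall>K. compact K \<longrightarrow> finite {g \<in> G. g ` K \<inter> K \<noteq> {}})"

definition virtually_integers :: "('g, 'm) monoid_scheme \<Rightarrow> bool" where
  "virtually_integers G \<longleftrightarrow>
     (\<exists>K. subgroup K G \<and> finite (rcosets\<^bsub>G\<^esub> K) \<and> G\<lparr>carrier := K\<rparr> \<cong> integer_group)"

definition elementary_group :: "('g, 'm) monoid_scheme \<Rightarrow> bool" where
  "elementary_group G \<longleftrightarrow> finite (carrier G) \<or> virtually_integers G"

definition torsion_free :: "('g, 'm) monoid_scheme \<Rightarrow> bool" where
  "torsion_free G \<longleftrightarrow>
     (\<forall>g\<in>carrier G. \<forall>n::nat. g \<noteq> \<one>\<^bsub>G\<^esub> \<and> n > 0 \<longrightarrow> g [^]\<^bsub>G\<^esub> n \<noteq> \<one>\<^bsub>G\<^esub>)"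

(* The floor only serves to index the orbit map by the integers viewed as a subset of the line. *)
definition contracting_isometry :: "'x::metric_space \<Rightarrow> ('x \<Rightarrow> 'x) \<Rightarrow> bool" where
  "contracting_isometry p g \<longleftrightarrow> g \<in> carrier isometry_group \<and>
     (\<exists>k c. quasi_isometric_embedding k c \<int> (\<lambda>t. (g [^]\<^bsub>isometry_group\<^esub> \<lfloor>t\<rfloor>) p)) \<and>
     (\<exists>C. contracting C (range (\<lambda>n::int. (g [^]\<^bsub>isometry_group\<^esub> n) p)))"

abbreviation orbit_of :: "'x \<Rightarrow> ('x \<Rightarrow> 'x) set \<Rightarrow> 'x set" where
  "orbit_of p A \<equiv> (\<lambda>g. g p) ` A"

definition log_card :: "'a set \<Rightarrow> ereal" where
  "log_card S = (if infinite S then \<infinity> else if S = {} then - \<infinity> else ereal (ln (real (card S))))"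

definition growth_rate :: "'x::metric_space \<Rightarrow> ('x \<Rightarrow> 'x) set \<Rightarrow> ereal" where
  "growth_rate p A =
     limsup (\<lambda>n. log_card (orbit_of p {g \<in> A. dist p (g p) \<le> real n}) / ereal (real n))"

definition nbhd :: "real \<Rightarrow> 'x::metric_space set \<Rightarrow> 'x set" where
  "nbhd r A = {x. infdist x A \<le> r}"

definition barrier_free ::
    "'x::metric_space \<Rightarrow> ('x \<Rightarrow> 'x) set \<Rightarrow> real \<Rightarrow> real \<Rightarrow> ('x \<Rightarrow> 'x) set" where
  "barrier_free p \<Gamma> M1 M2 = {g \<in> \<Gamma>. \<exists>\<gamma> L. 0 \<le> L \<and> geodesic_on {0..L} \<gamma> \<and>
     \<gamma> 0 \<in> nbhd M2 {p} \<and> \<gamma> L \<in> nbhd M2 {g p} \<and> \<gamma> ` {0<..<L} \<inter> nbhd M1 (orbit_of p \<Gamma>) = {}}"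

definition statistically_convex_cocompact ::
    "'x::metric_space \<Rightarrow> ('x \<Rightarrow> 'x) set \<Rightarrow> bool" where
  "statistically_convex_cocompact p \<Gamma> \<longleftrightarrow>
     (\<exists>M1 M2. 0 < M1 \<and> M1 \<le> M2 \<and>
        growth_rate p (barrier_free p \<Gamma> M1 M2) < growth_rate p \<Gamma>) \<and>
     growth_rate p \<Gamma> < \<infinity>"


section \<open>Convergence boundaries\<close>

text \<open>
  The compactification is the whole type \<open>'b\<close>, whose distance plays no role beyond inducing its
  topology; \<open>\<iota>\<close> is the inclusion of \<open>X\<close>, \<open>act f\<close> is the extension of the isometry \<open>f\<close>, and
  the partition of the boundary is given by the equivalence relation \<open>R\<close>, so that
  the class of \<open>\<xi>\<close> is \<open>R `` {\<xi>}\<close> and the union of the classes meeting \<open>A\<close> is \<open>R `` A\<close>.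
\<close>

abbreviation bdry :: "('x \<Rightarrow> 'b) \<Rightarrow> 'b set" where
  "bdry \<iota> \<equiv> - range \<iota>"

text \<open>
  All accumulation points lie in the class of \<open>\<xi>\<close>. For a sequence converging in the
  compactification this says that its limit lies in the class.
\<close>

definition tends_to_class ::
    "('x::metric_space \<Rightarrow> 'b::metric_space) \<Rightarrow> ('b \<times> 'b) set \<Rightarrow> (nat \<Rightarrow> 'x) \<Rightarrow> 'b \<Rightarrow> bool" where
  "tends_to_class \<iota> R y \<xi> \<longleftrightarrow>
     (\<forall>r l. strict_mono (r :: nat \<Rightarrow> nat) \<and> (\<lambda>n. \<iota> (y (r n))) \<longlonglongrightarrow> l \<longrightarrow> l \<in> R `` {\<xi>})"

definition nonpinched ::
    "('x::metric_space \<Rightarrow> 'b::metric_space) \<Rightarrow> ('b \<times> 'b) set \<Rightarrow> 'b set" where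
  "nonpinched \<iota> R = {\<xi> \<in> bdry \<iota>. \<forall>x y S.
     tends_to_class \<iota> R x \<xi> \<and> tends_to_class \<iota> R y \<xi> \<and>
     (\<forall>n. geodesic_segment (x n) (y n) (S n)) \<longrightarrow> escaping S}"

locale convergence_boundary =
  fixes \<Gamma> :: "('x::metric_space \<Rightarrow> 'x) set"
    and \<iota> :: "'x \<Rightarrow> 'b::metric_space"
    and act :: "('x \<Rightarrow> 'x) \<Rightarrow> 'b \<Rightarrow> 'b"
    and R :: "('b \<times> 'b) set"
  assumes compact_compactification: "compact (UNIV :: 'b set)"
    and embedding: "\<exists>\<kappa>. homeomorphism UNIV (range \<iota>) \<iota> \<kappa>"
    and open_range: "open (range \<iota>)"
    and dense_range: "closure (range \<iota>) = UNIV"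
    and act_homeomorphism:
      "\<And>f. f \<in> carrier isometry_group \<Longrightarrow> \<exists>h. homeomorphism UNIV UNIV (act f) h"
    and act_extends: "\<And>f x. f \<in> carrier isometry_group \<Longrightarrow> act f (\<iota> x) = \<iota> (f x)"
    and partition: "equiv (bdry \<iota>) R"
    and partition_invariant:
      "\<And>f \<xi> \<eta>. f \<in> carrier isometry_group \<Longrightarrow> (\<xi>, \<eta>) \<in> R \<Longrightarrow> (act f \<xi>, act f \<eta>) \<in> R"
    and contracting_rays:
      "\<And>\<gamma> C. geodesic_on {0..} \<gamma> \<Longrightarrow> contracting C (\<gamma> ` {0..}) \<Longrightarrow>
        \<exists>\<xi>\<in>bdry \<iota>. closed (R `` {\<xi>}) \<and>
          (\<forall>t. filterlim t at_top sequentially \<longrightarrow> tends_to_class \<iota> R (\<lambda>n. \<gamma> (t n)) \<xi>) \<and>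
          (\<forall>y. escaping (\<lambda>n. nearest_points (\<gamma> ` {0..}) (y n)) \<longrightarrow> tends_to_class \<iota> R y \<xi>)"
    and cones:
      "\<And>C k c Z q. (\<And>n::nat. contracting C (Z n) \<and> quasi_geodesic k c (Z n)) \<Longrightarrow> escaping Z \<Longrightarrow>
        \<exists>r. strict_mono (r :: nat \<Rightarrow> nat) \<and>
          (\<exists>\<xi>\<in>bdry \<iota>. \<forall>y l. (\<forall>n. y n \<in> cone q (Z (r n))) \<and> (\<lambda>n. \<iota> (y n)) \<longlonglongrightarrow> l \<longrightarrow>
             l \<in> R `` {\<xi>})"
    and nonpinched_nonempty: "nonpinched \<iota> R \<noteq> {}"
    and nonpinched_closed:
      "\<And>\<xi> x y \<xi>' \<eta>'. \<xi> \<in> nonpinched \<iota> R \<Longrightarrow>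
        (\<And>n::nat. x n \<in> (\<Union>g\<in>\<Gamma>. act g ` (R `` {\<xi>}))) \<Longrightarrow>
        (\<And>n. y n \<in> (\<Union>g\<in>\<Gamma>. act g ` (R `` {\<xi>}))) \<Longrightarrow>
        (\<And>n. R `` {x n} = R `` {y n}) \<Longrightarrow> x \<longlonglongrightarrow> \<xi>' \<Longrightarrow> y \<longlonglongrightarrow> \<eta>' \<Longrightarrow>
        R `` {\<xi>'} = R `` {\<eta>'}"


section \<open>Horoballs and horospheric limit points\<close>

definition class_limsup ::
    "('x::metric_space \<Rightarrow> 'b::metric_space) \<Rightarrow> ('b \<times> 'b) set \<Rightarrow> 'b \<Rightarrow> ('x \<Rightarrow> real) \<Rightarrow> ereal" where
  "class_limsup \<iota> R \<xi> f = (SUP z\<in>{z. tends_to_class \<iota> R z \<xi>}. limsup (\<lambda>n. ereal (f (z n))))"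

definition busemann_family ::
    "('x::metric_space \<Rightarrow> 'b::metric_space) \<Rightarrow> ('b \<times> 'b) set \<Rightarrow> 'b set \<Rightarrow>
      ('b \<Rightarrow> 'x \<Rightarrow> 'x \<Rightarrow> real) \<Rightarrow> bool" where
  "busemann_family \<iota> R Chor B \<longleftrightarrow> Chor \<subseteq> nonpinched \<iota> R \<and>
     (\<forall>\<xi>\<in>Chor. \<exists>\<epsilon>::real. \<forall>\<eta>\<in>R `` {\<xi>} \<inter> Chor. \<forall>x y.
        class_limsup \<iota> R \<eta> (\<lambda>z. \<bar>B \<eta> x y - (dist x z - dist y z)\<bar>) \<le> ereal \<epsilon>)"

definition class_busemann ::
    "('x::metric_space \<Rightarrow> 'b::metric_space) \<Rightarrow> ('b \<times> 'b) set \<Rightarrow> 'b \<Rightarrow> 'x \<Rightarrow> 'x \<Rightarrow> ereal" where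
  "class_busemann \<iota> R \<xi> x y = class_limsup \<iota> R \<xi> (\<lambda>z. dist x z - dist y z)"

definition horoball ::
    "'x::metric_space \<Rightarrow> ('x \<Rightarrow> 'b::metric_space) \<Rightarrow> ('b \<times> 'b) set \<Rightarrow> 'b \<Rightarrow> real \<Rightarrow> 'x set" where
  "horoball p \<iota> R \<xi> L = {y. class_busemann \<iota> R \<xi> y p \<le> ereal L}"

definition limit_set ::
    "'x::metric_space \<Rightarrow> ('x \<Rightarrow> 'b::metric_space) \<Rightarrow> ('x \<Rightarrow> 'x) set \<Rightarrow> 'b set" where
  "limit_set p \<iota> H = {\<xi> \<in> bdry \<iota>. \<xi> islimpt (\<iota> ` orbit_of p H)}"

definition big_horospheric_limit_set ::
    "'x::metric_space \<Rightarrow> ('x \<Rightarrow> 'b::metric_space) \<Rightarrow> ('b \<times> 'b) set \<Rightarrow> 'b set \<Rightarrow>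
      ('x \<Rightarrow> 'x) set \<Rightarrow> 'b set" where
  "big_horospheric_limit_set p \<iota> R Chor H =
     {\<xi> \<in> R `` limit_set p \<iota> H \<inter> Chor.
        \<exists>L h. (\<forall>n::nat. h n \<in> H \<and> h n p \<in> horoball p \<iota> R \<xi> L) \<and> inj (\<lambda>n. h n p) \<and>
          tends_to_class \<iota> R (\<lambda>n. h n p) \<xi>}"


section \<open>Patterson--Sullivan measures\<close>

definition poincare_series :: "'x::metric_space \<Rightarrow> ('x \<Rightarrow> 'x) set \<Rightarrow> real \<Rightarrow> ennreal" where
  "poincare_series p \<Gamma> s = (\<integral>\<^sup>+g. ennreal (exp (- s * dist p (g p))) \<partial>count_space \<Gamma>)"

text \<open>
  The weighted sum of Dirac masses on the orbit, written as the image of a weighted counting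
  measure on the group under the orbit map.
\<close>

definition orbit_measure ::
    "'x::metric_space \<Rightarrow> ('x \<Rightarrow> 'b::metric_space) \<Rightarrow> ('x \<Rightarrow> 'x) set \<Rightarrow> real \<Rightarrow> 'x \<Rightarrow> 'b measure" where
  "orbit_measure p \<iota> \<Gamma> s x =
     distr (density (count_space \<Gamma>)
              (\<lambda>g. ennreal (exp (- s * dist x (g p))) / poincare_series p \<Gamma> s))
           borel (\<lambda>g. \<iota> (g p))"

definition weak_limit :: "(nat \<Rightarrow> 'b::metric_space measure) \<Rightarrow> 'b measure \<Rightarrow> bool" where
  "weak_limit \<nu> \<mu> \<longleftrightarrow> (\<forall>f :: 'b \<Rightarrow> real. continuous_on UNIV f \<and> bounded (range f) \<longrightarrow>
     (\<lambda>i. integral\<^sup>L (\<nu> i) f) \<longlonglongrightarrow> integral\<^sup>L \<mu> f)"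

definition patterson_sullivan_measures ::
    "'x::metric_space \<Rightarrow> ('x \<Rightarrow> 'b::metric_space) \<Rightarrow> ('x \<Rightarrow> 'x) set \<Rightarrow> ('x \<Rightarrow> 'b measure) \<Rightarrow> bool" where
  "patterson_sullivan_measures p \<iota> \<Gamma> \<mu> \<longleftrightarrow>
     (\<forall>x. sets (\<mu> x) = sets borel \<and> finite_measure (\<mu> x)) \<and> prob_space (\<mu> p) \<and>
     (\<exists>s :: nat \<Rightarrow> real. decseq s \<and> (\<forall>i. growth_rate p \<Gamma> < ereal (s i)) \<and>
        (\<lambda>i. ereal (s i)) \<longlonglongrightarrow> growth_rate p \<Gamma> \<and>
        (\<forall>x. weak_limit (\<lambda>i. orbit_measure p \<iota> \<Gamma> (s i) x) (\<mu> x)))"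

text \<open>
  A density on the boundary is a family of measures on the compactification that give no mass
  to \<open>X\<close>. Since \<open>B \<xi>\<close> is only meaningful for \<open>\<xi> \<in> Chor\<close>, the almost everywhere
  comparison includes that almost every point lies in \<open>Chor\<close>.
\<close>

definition quasi_conformal_density ::
    "'x::metric_space \<Rightarrow> ('x \<Rightarrow> 'b::metric_space) \<Rightarrow> (('x \<Rightarrow> 'x) \<Rightarrow> 'b \<Rightarrow> 'b) \<Rightarrow> ('b \<times> 'b) set \<Rightarrow>
      'b set \<Rightarrow> ('b \<Rightarrow> 'x \<Rightarrow> 'x \<Rightarrow> real) \<Rightarrow> ('x \<Rightarrow> 'x) set \<Rightarrow> real \<Rightarrow> ('x \<Rightarrow> 'b measure) \<Rightarrow> bool" where
  "quasi_conformal_density p \<iota> act R Chor B \<Gamma> \<omega> \<mu> \<longleftrightarrow>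
     (\<forall>x. range \<iota> \<in> null_sets (\<mu> x)) \<and>
     (\<forall>g\<in>\<Gamma>. \<forall>x. distr (\<mu> x) borel (act g) = \<mu> (g x)) \<and>
     (\<forall>x y. absolutely_continuous (\<mu> y) (\<mu> x)) \<and>
     (\<exists>k\<ge>1. \<forall>x y. AE \<xi> in \<mu> y. \<xi> \<in> Chor \<and>
        ennreal (exp (- \<omega> * B \<xi> x y) / k) \<le> RN_deriv (\<mu> y) (\<mu> x) \<xi> \<and>
        RN_deriv (\<mu> y) (\<mu> x) \<xi> \<le> ennreal (k * exp (- \<omega> * B \<xi> x y))) \<and>
     (AE \<xi> in \<mu> p. \<xi> \<in> nonpinched \<iota> R)"

definition preserves_measure_class ::
    "(('x \<Rightarrow> 'x) \<Rightarrow> 'b \<Rightarrow> 'b::metric_space) \<Rightarrow> ('x \<Rightarrow> 'x) set \<Rightarrow> 'b measure \<Rightarrow> bool" where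
  "preserves_measure_class act H m \<longleftrightarrow>
     (\<forall>h\<in>H. absolutely_continuous m (distr m borel (act h)) \<and>
             absolutely_continuous (distr m borel (act h)) m)"

definition completely_dissipative ::
    "('x \<Rightarrow> 'b::metric_space) \<Rightarrow> (('x \<Rightarrow> 'x) \<Rightarrow> 'b \<Rightarrow> 'b) \<Rightarrow> ('x \<Rightarrow> 'x) set \<Rightarrow> 'b measure \<Rightarrow> bool" where
  "completely_dissipative \<iota> act H m \<longleftrightarrow>
     (\<exists>A\<in>sets borel. A \<subseteq> bdry \<iota> \<and> (\<forall>h\<in>H. h \<noteq> id \<longrightarrow> act h ` A \<inter> A = {}) \<and>
        bdry \<iota> - (\<Union>h\<in>H. act h ` A) \<in> null_sets m)"

end

theory Submission
  imports Defs
begin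

text \<open>
  Let \<open>h \<in> H\<close> with \<open>dist p (h p) = 2 n\<close>. The mass of the boundary points at which \<open>h p\<close> is at most
  \<open>L\<close> farther than \<open>p\<close> is bounded, through the weak limit, by the weight in the Poincare series of the
  \<open>g \<in> \<Gamma>\<close> with \<open>dist (h p) (g p) < dist p (g p) + L\<close>. Suppose a geodesic from \<open>p\<close> to \<open>g p\<close> meets, at
  distance nearly \<open>n\<close> from \<open>p\<close>, a barrier, that is a long piece of a translate \<open>f\<close> of the axis of a
  contracting element. Every other point \<open>y\<close> is then joined to \<open>p\<close> or to \<open>g p\<close> only through \<open>f p\<close>, and
  for \<open>y = h p\<close> the second case contradicts \<open>dist p (f p) < n\<close>. Hence \<open>f p\<close> lies on the geodesic
  \<open>[p, h p]\<close>, which leaves \<open>O(n)\<close> choices for \<open>f\<close>, each of weight about \<open>exp (- \<omega> n)\<close>; as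
  \<open>\<omega>\<close> exceeds twice the growth rate of \<open>H\<close>, these weights are summable over \<open>h\<close>, and
  Borel--Cantelli applies.

  The geodesics that meet no such barrier have exponentially small weight. Their elements, the unbarred
  ones, generate together with a power of the contracting element a free semigroup up to bounded
  multiplicity, so their Poincare series converges at \<open>\<omega>\<close>, since the series of \<open>\<Gamma>\<close> converges beyond
  \<open>\<omega>\<close>. Because \<open>\<Gamma>\<close> is statistically convex-cocompact, unbarred geodesics can be cut at orbit points
  into pieces of bounded length and excursions, and this makes the series converge even below \<open>\<omega>\<close>.
  Forbidding barriers in both directions along the axis makes it unnecessary to use several independent
  contracting elements.

  It follows that at almost every \<open>\<xi>\<close> the orbit \<open>H p\<close> has, up to a bounded error, only finitely many
  points closest to \<open>\<xi>\<close>. This assigns to \<open>\<xi>\<close> equivariantly a finite subset of \<open>H\<close>; a torsion-free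
  group acts freely on its finite nonempty subsets, and choosing one subset in each orbit yields the
  fundamental domain.
\<close>

section \<open>Sums over countable sets\<close>

text \<open>Convergence at \<omega> improves to convergence below \<omega> because a smallness
  condition is open. At \<omega> the long pieces cut off have arbitrarily small total weight. Each
  is a bounded part followed by one excursion, and excursions converge already at
  \<open>s0 < \<omega>\<close>, so the weight stays small slightly under \<omega> and repeated
  cutting is dominated by a geometric series. The barrier is sought in a window of length
  proportional to \<open>\<epsilon> * n\<close> ending at \<open>(1 - \<epsilon>) * n\<close>:
  strictly before the middle of \<open>[p, h p]\<close>, so that \<open>L\<close> and all constants
  are absorbed, yet late enough for the weight of \<open>f\<close> to beat the growth of
  \<open>H\<close>. A geodesic without a barrier there contains a long unbarred piece or a long
  excursion; its exponential gain is linear in the window and beats the initial pieces, whose total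
  weight at \<omega> grows subexponentially. All bounds hold for \<open>s\<close> in (\<omega>,
  \<omega> + 1] relative to \<open>poincare_series p \<Gamma> s\<close>, with coefficients
  independent of \<open>s\<close>; in this form they survive normalization and the weak
  limit.\<close>

lemma count_sum_indicator:
  "(\<integral>\<^sup>+x. F x \<partial>count_space A) = (\<integral>\<^sup>+x. F x * indicator A x \<partial>count_space UNIV)"
  by (simp add: nn_integral_restrict_space[symmetric] restrict_count_space)

lemma count_sum_mono_set:
  fixes F :: "'a \<Rightarrow> ennreal"
  assumes "A \<subseteq> B"
  shows "(\<integral>\<^sup>+x. F x \<partial>count_space A) \<le> (\<integral>\<^sup>+x. F x \<partial>count_space B)"
  unfolding count_sum_indicator[of A] count_sum_indicator[of B]
  using assms by (intro nn_integral_mono) (auto split: split_indicator)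

text \<open>One preimage is selected for each point of \<open>A\<close>. Factorizations of group
  elements are counted through this bound, so they never have to be unique.\<close>

lemma count_sum_le_cover:
  fixes F :: "'a \<Rightarrow> ennreal"
  assumes "A \<subseteq> \<phi> ` I"
  shows "(\<integral>\<^sup>+x. F x \<partial>count_space A) \<le> (\<integral>\<^sup>+i. F (\<phi> i) \<partial>count_space I)"
proof -
  define J where "J = inv_into I \<phi> ` A"
  have 1: "\<phi> (inv_into I \<phi> x) = x" "inv_into I \<phi> x \<in> I" if "x \<in> A" for x
    using assms that by (auto intro: f_inv_into_f inv_into_into)
  have "bij_betw \<phi> J A"
    unfolding J_def bij_betw_def inj_on_def image_image using 1 by force
  then have "(\<integral>\<^sup>+x. F x \<partial>count_space A) = (\<integral>\<^sup>+i. F (\<phi> i) \<partial>count_space J)"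
    by (simp add: nn_integral_bij_count_space)
  also have "\<dots> \<le> (\<integral>\<^sup>+i. F (\<phi> i) \<partial>count_space I)"
    using 1 by (intro count_sum_mono_set) (auto simp: J_def)
  finally show ?thesis .
qed

lemma count_sum_mono:
  fixes F :: "'a \<Rightarrow> ennreal"
  assumes "\<And>x. x \<in> A \<Longrightarrow> F x \<le> F' x"
  shows "(\<integral>\<^sup>+x. F x \<partial>count_space A) \<le> (\<integral>\<^sup>+x. F' x \<partial>count_space A)"
  using assms by (intro nn_integral_mono) auto

lemma count_sum_Times:
  fixes F :: "'a \<Rightarrow> ennreal"
  assumes "countable A" "countable B"
  shows "(\<integral>\<^sup>+z. F (fst z) * K (snd z) \<partial>count_space (A \<times> B)) =
    (\<integral>\<^sup>+x. F x \<partial>count_space A) * (\<integral>\<^sup>+y. K y \<partial>count_space B)"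
proof -
  interpret sigma_finite_measure "count_space B"
    using assms by (simp add: sigma_finite_measure_count_space_countable)
  have "(\<integral>\<^sup>+z. F (fst z) * K (snd z) \<partial>count_space (A \<times> B)) =
     (\<integral>\<^sup>+z. F (fst z) * K (snd z) \<partial>(count_space A \<Otimes>\<^sub>M count_space B))"
    using assms by (simp add: pair_measure_countable)
  also have "\<dots> = (\<integral>\<^sup>+x. \<integral>\<^sup>+y. F x * K y \<partial>count_space B \<partial>count_space A)"
    using assms by (subst nn_integral_fst[symmetric]) (auto simp: pair_measure_countable)
  also have "\<dots> = (\<integral>\<^sup>+x. F x * (\<integral>\<^sup>+y. K y \<partial>count_space B) \<partial>count_space A)"
    by (simp add: nn_integral_cmult)
  finally show ?thesis by (simp add: nn_integral_multc)
qed

lemma count_sum_Un_le: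
  fixes F :: "'a \<Rightarrow> ennreal"
  shows "(\<integral>\<^sup>+x. F x \<partial>count_space (A \<union> B)) \<le>
    (\<integral>\<^sup>+x. F x \<partial>count_space A) + (\<integral>\<^sup>+x. F x \<partial>count_space B)"
proof -
  have "(\<integral>\<^sup>+x. F x \<partial>count_space (A \<union> B)) \<le>
    (\<integral>\<^sup>+x. F x * indicator A x + F x * indicator B x \<partial>count_space UNIV)"
    unfolding count_sum_indicator[of "A \<union> B"]
    by (intro nn_integral_mono) (auto split: split_indicator)
  then show ?thesis
    by (simp add: nn_integral_add count_sum_indicator[of A]
      count_sum_indicator[of B])
qed

text \<open>Monotone convergence for decreasing tails, which requires the full sum to be
  finite.\<close>

lemma count_sum_tail:
  fixes F :: "'a \<Rightarrow> ennreal" and len :: "'a \<Rightarrow> real"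
  assumes "(\<integral>\<^sup>+x. F x \<partial>count_space A) < \<infinity>" "\<epsilon> > 0"
  shows "\<exists>n::nat. (\<integral>\<^sup>+x. F x \<partial>count_space {x \<in> A. real n < len x}) < \<epsilon>"
proof -
  define f where "f n x = F x * indicator {x. real n < len x} x" for n :: nat and x
  have eq: "(\<integral>\<^sup>+x. F x \<partial>count_space {x \<in> A. real n < len x}) = (\<integral>\<^sup>+x. f n x \<partial>count_space A)" for n :: nat
    unfolding f_def count_sum_indicator[of A]
      count_sum_indicator[of "{x \<in> A. real n < len x}"]
    by (intro nn_integral_cong) (auto split: split_indicator)
  have "(INF n. f n x) = 0" for x
  proof -
    obtain n where "len x \<le> real n" using real_arch_simple by blast
    then have "f n x = 0" by (simp add: f_def)
    then show ?thesis by (metis INF_lower UNIV_I le_zero_eq)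
  qed
  moreover have "(\<integral>\<^sup>+x. (INF n. f n x) \<partial>count_space A) = (INF n. \<integral>\<^sup>+x. f n x \<partial>count_space A)"
  proof (rule nn_integral_monotone_convergence_INF_decseq)
    show "decseq f"
      by (auto simp: f_def monotone_def le_fun_def split: split_indicator)
    have "(\<integral>\<^sup>+x. f 0 x \<partial>count_space A) \<le> (\<integral>\<^sup>+x. F x \<partial>count_space A)"
      by (intro nn_integral_mono) (auto simp: f_def split: split_indicator)
    then show "(\<integral>\<^sup>+x. f 0 x \<partial>count_space A) < \<infinity>" using assms by (auto simp: top.not_eq_extremum)
  qed auto
  ultimately have "(INF n. \<integral>\<^sup>+x. f n x \<partial>count_space A) < \<epsilon>"
    using \<open>\<epsilon> > 0\<close> by simp
  then show ?thesis
    unfolding INF_less_iff eq by blast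
qed

lemma count_sum_SUP:
  fixes F :: "'a \<Rightarrow> ennreal"
  assumes "incseq V"
  shows "(\<integral>\<^sup>+x. F x \<partial>count_space (\<Union>n. V n)) = (SUP n. \<integral>\<^sup>+x. F x \<partial>count_space (V n))"
proof -
  have "(\<integral>\<^sup>+x. F x \<partial>count_space (\<Union>n. V n)) =
    (\<integral>\<^sup>+x. (SUP n. F x * indicator (V n) x) \<partial>count_space UNIV)"
  proof (subst count_sum_indicator, intro nn_integral_cong)
    fix x
    show "F x * indicator (\<Union>n. V n) x = (SUP n. F x * indicator (V n) x)"
    proof (cases "\<exists>n. x \<in> V n")
      case True
      then obtain n where n: "x \<in> V n" by blast
      then have "F x * indicator (V n) x = F x" by simp
      then have "(SUP n. F x * indicator (V n) x) = F x"
        by (intro antisym SUP_least) (auto split: split_indicator intro: SUP_upper2[of n])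
      then show ?thesis using n by (auto split: split_indicator)
    qed auto
  qed
  also have "\<dots> = (SUP n. \<integral>\<^sup>+x. F x * indicator (V n) x \<partial>count_space UNIV)"
    using assms by (intro nn_integral_monotone_convergence_SUP)
      (auto simp: incseq_def le_fun_def split: split_indicator)
  finally show ?thesis by (simp add: count_sum_indicator[of "V _"])
qed

lemma count_sum_UN_le:
  fixes F :: "'a \<Rightarrow> ennreal"
  assumes "countable I"
  shows "(\<integral>\<^sup>+x. F x \<partial>count_space (\<Union>i\<in>I. A i)) \<le>
    (\<integral>\<^sup>+i. (\<integral>\<^sup>+x. F x \<partial>count_space (A i)) \<partial>count_space I)"
proof -
  have "(\<integral>\<^sup>+x. F x \<partial>count_space (\<Union>i\<in>I. A i)) \<le>
    (\<integral>\<^sup>+x. (\<integral>\<^sup>+i. F x * indicator (A i) x \<partial>count_space I) \<partial>count_space UNIV)"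
    unfolding count_sum_indicator[of "\<Union>i\<in>I. A i"]
  proof (intro nn_integral_mono)
    fix x
    show "F x * indicator (\<Union>i\<in>I. A i) x \<le> (\<integral>\<^sup>+i. F x * indicator (A i) x \<partial>count_space I)"
    proof (cases "\<exists>i\<in>I. x \<in> A i")
      case True
      then obtain i where "i \<in> I" "x \<in> A i" by blast
      then show ?thesis
        using nn_integral_ge_point[of i I "\<lambda>i. F x * indicator (A i) x"] by (auto split: split_indicator)
    qed auto
  qed
  also have "\<dots> = (\<integral>\<^sup>+i. (\<integral>\<^sup>+x. F x * indicator (A i) x \<partial>count_space UNIV) \<partial>count_space I)"
    using assms by (intro nn_integral_count_space_nn_integral) auto
  finally show ?thesis by (simp add: count_sum_indicator[of "A _"])
qed

section \<open>Proper isometric actions\<close>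

abbreviation inverse_map :: "('a \<Rightarrow> 'a) \<Rightarrow> 'a \<Rightarrow> 'a" where
  "inverse_map f \<equiv> inv_into UNIV f"

text \<open>Properness is kept in the form used for counting: finitely many group elements, not
  merely orbit points, move \<open>p\<close> by a bounded amount.\<close>

locale proper_isometric_action =
  fixes G :: "('x::metric_space \<Rightarrow> 'x) set" and p :: 'x
  assumes id_mem: "id \<in> G"
    and comp_mem: "\<And>f g. f \<in> G \<Longrightarrow> g \<in> G \<Longrightarrow> f \<circ> g \<in> G"
    and inv_mem: "\<And>f. f \<in> G \<Longrightarrow> inverse_map f \<in> G"
    and bij: "\<And>f. f \<in> G \<Longrightarrow> bij f"
    and dist_act: "\<And>f x y. f \<in> G \<Longrightarrow> dist (f x) (f y) = dist x y"
    and finite_ball: "\<And>r. finite {g \<in> G. dist p (g p) \<le> r}"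

lemma isometry_group_inv:
  assumes "f \<in> carrier isometry_group"
  shows "inv\<^bsub>isometry_group\<^esub> f = inverse_map f" "bij f"
proof -
  interpret group "isometry_group :: ('a \<Rightarrow> 'a) monoid" by (rule group_isometry_group)
  have iso: "dist (f x) (f y) = dist x y" "surj f" for x y
    using assms by (auto simp: isometry_group_def)
  then have "inj f" by (metis dist_eq_0_iff injI)
  with iso show "bij f" by (simp add: bij_def)
  have "f \<otimes>\<^bsub>isometry_group\<^esub> inv\<^bsub>isometry_group\<^esub> f = \<one>\<^bsub>isometry_group\<^esub>"
    using assms by simp
  then have "f \<circ> inv\<^bsub>isometry_group\<^esub> f = id"
    by (simp add: isometry_group_def)
  then have "f ((inv\<^bsub>isometry_group\<^esub> f) x) = x" for x by (metis comp_apply id_apply)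
  then show "inv\<^bsub>isometry_group\<^esub> f = inverse_map f"
    using \<open>inj f\<close> by (metis ext inv_f_f)
qed

lemma subgroup_proper_isometric_action:
  fixes G :: "('x::metric_space \<Rightarrow> 'x) set"
  assumes G: "subgroup G isometry_group" and "acts_properly G"
    and proper: "\<And>(x::'x) r. compact (cball x r)"
  shows "proper_isometric_action G p"
proof
  have sub: "f \<in> carrier isometry_group" if "f \<in> G" for f
    using G that by (meson subgroup.mem_carrier)
  show "id \<in> G"
    using subgroup.one_closed[OF G] by (simp add: isometry_group_def)
  show "f \<circ> g \<in> G" if "f \<in> G" "g \<in> G" for f g
    using subgroup.m_closed[OF G that] by (simp add: isometry_group_def)
  show "inverse_map f \<in> G" if "f \<in> G" for f
    using subgroup.m_inv_closed[OF G that] isometry_group_inv(1)[OF sub[OF that]] by simp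
  show "bij f" if "f \<in> G" for f
    using isometry_group_inv(2)[OF sub[OF that]] .
  show "dist (f x) (f y) = dist x y" if "f \<in> G" for f x y
    using sub[OF that] by (simp add: isometry_group_def)
  show "finite {g \<in> G. dist p (g p) \<le> r}" for r
  proof (rule finite_subset)
    show "{g \<in> G. dist p (g p) \<le> r} \<subseteq> {g \<in> G. g ` cball p (max r 0) \<inter> cball p (max r 0) \<noteq> {}}"
    proof clarify
      fix g assume "g \<in> G" "dist p (g p) \<le> r" and "g ` cball p (max r 0) \<inter> cball p (max r 0) = {}"
      moreover have "g p \<in> g ` cball p (max r 0) \<inter> cball p (max r 0)"
        using \<open>dist p (g p) \<le> r\<close> by auto
      ultimately show False by blast
    qed
    show "finite \<dots>"
      using assms(2) proper unfolding acts_properly_def by blast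
  qed
qed

context proper_isometric_action
begin

abbreviation len :: "('x \<Rightarrow> 'x) \<Rightarrow> real" where "len g \<equiv> dist p (g p)"

lemma inv_apply: "f \<in> G \<Longrightarrow> inverse_map f (f x) = x" "f \<in> G \<Longrightarrow> f (inverse_map f x) = x"
  using bij by (auto simp: bij_is_inj bij_is_surj surj_f_inv_f)

lemma inv_comp: "f \<in> G \<Longrightarrow> inverse_map f \<circ> f = id" "f \<in> G \<Longrightarrow> f \<circ> inverse_map f = id"
  by (auto simp: inv_apply)

lemma inv_inv [simp]: "f \<in> G \<Longrightarrow> inverse_map (inverse_map f) = f"
  using bij by (simp add: inv_inv_eq)

lemma inv_comp_distrib: "f \<in> G \<Longrightarrow> g \<in> G \<Longrightarrow> inverse_map (f \<circ> g) = inverse_map g \<circ> inverse_map f"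
  using bij o_inv_distrib by blast

lemma dist_inv [simp]: "f \<in> G \<Longrightarrow> dist (inverse_map f x) (inverse_map f y) = dist x y"
  by (rule dist_act[OF inv_mem])

lemma dist_inv_left: "f \<in> G \<Longrightarrow> dist (inverse_map f x) y = dist x (f y)"
  by (metis dist_act inv_apply(2))

lemma len_inv: "f \<in> G \<Longrightarrow> len (inverse_map f) = len f"
  by (metis dist_commute dist_inv_left)

lemma len_comp: "f \<in> G \<Longrightarrow> len (f \<circ> g) \<le> len f + len g"
  by (metis comp_apply dist_act dist_triangle)

lemma countable_G: "countable G"
proof -
  have "countable (\<Union>n::nat. {g \<in> G. len g \<le> real n})"
    by (rule countable_UN[OF countableI_type]) (rule countable_finite[OF finite_ball])
  moreover have "(\<Union>n::nat. {g \<in> G. len g \<le> real n}) = G"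
    using real_arch_simple by auto
  ultimately show ?thesis by simp
qed

lemma finite_near: "finite {g \<in> G. dist x (g p) \<le> r}"
  by (rule finite_subset[OF _ finite_ball[of "dist p x + r"]])
    (auto intro: order_trans[OF dist_triangle[of p _ x]])

text \<open>Translating by the inverse of one element of the set moves the ball to \<open>p\<close>,
  so the bound does not depend on \<open>x\<close>.\<close>

lemma card_near:
  assumes "0 \<le> r"
  shows "card {g \<in> G. dist x (g p) \<le> r} \<le> card {g \<in> G. len g \<le> 2 * r}"
proof (cases "{g \<in> G. dist x (g p) \<le> r} = {}")
  case False
  then obtain f where f: "f \<in> G" "dist x (f p) \<le> r" by auto
  have "inj_on (\<lambda>g. inverse_map f \<circ> g) G"
  proof (rule inj_onI)
    fix g g' assume "inverse_map f \<circ> g = inverse_map f \<circ> g'"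
    then have "f \<circ> inverse_map f \<circ> g = f \<circ> inverse_map f \<circ> g'" by (simp add: comp_assoc)
    then show "g = g'" by (simp add: inv_comp(2)[OF f(1)])
  qed
  moreover have "(\<lambda>g. inverse_map f \<circ> g) ` {g \<in> G. dist x (g p) \<le> r} \<subseteq> {g \<in> G. len g \<le> 2 * r}"
  proof clarify
    fix g assume g: "g \<in> G" "dist x (g p) \<le> r"
    have "dist p (inverse_map f (g p)) = dist (f p) (g p)"
      using dist_inv_left[OF f(1), of "g p" p] by (simp add: dist_commute)
    then show "inverse_map f \<circ> g \<in> G \<and> len (inverse_map f \<circ> g) \<le> 2 * r"
      using f g dist_triangle3[of "f p" "g p" x] by (auto intro: comp_mem inv_mem)
  qed
  ultimately show ?thesis
    by (intro card_inj_on_le[of "\<lambda>g. inverse_map f \<circ> g"]) (auto intro: inj_on_subset finite_ball)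
next
  case True
  then show ?thesis by (metis card.empty le0)
qed

lemma poincare_series_finite_set:
  assumes "A \<subseteq> G" "\<And>g. g \<in> A \<Longrightarrow> len g \<le> r"
  shows "poincare_series p A s < \<infinity>"
proof -
  have "finite A"
    by (rule finite_subset[OF _ finite_ball[of r]]) (use assms in auto)
  then show ?thesis
    unfolding poincare_series_def by (simp add: nn_integral_count_space_finite)
qed

lemma finite_orbit_iff:
  assumes "A \<subseteq> G"
  shows "finite (orbit_of p {g \<in> A. len g \<le> r})"
  by (rule finite_imageI, rule finite_subset[OF _ finite_ball[of r]]) (use assms in auto)

text \<open>The growth rate counts orbit points, the Poincare series group elements; the fibres of
  the orbit map are no larger than the stabilizer of \<open>p\<close>.\<close>

lemma card_le_orbit:
  assumes "A \<subseteq> G"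
  shows "card {g \<in> A. len g \<le> r} \<le>
    card {g \<in> G. len g \<le> 0} * card (orbit_of p {g \<in> A. len g \<le> r})"
proof -
  let ?O = "orbit_of p {g \<in> A. len g \<le> r}"
  have "{g \<in> A. len g \<le> r} \<subseteq> (\<Union>q\<in>?O. {g \<in> G. dist q (g p) \<le> 0})"
    using assms by auto
  then have "card {g \<in> A. len g \<le> r} \<le> card (\<Union>q\<in>?O. {g \<in> G. dist q (g p) \<le> 0})"
    by (intro card_mono finite_UN_I finite_orbit_iff assms finite_near)
  also have "\<dots> \<le> (\<Sum>q\<in>?O. card {g \<in> G. dist q (g p) \<le> 0})"
    by (intro card_UN_le finite_orbit_iff assms)
  also have "\<dots> \<le> (\<Sum>q\<in>?O. card {g \<in> G. len g \<le> 0})"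
    using card_near[of 0] by (intro sum_mono) simp
  finally show ?thesis by (simp add: mult.commute)
qed

lemma poincare_series_finite:
  assumes A: "A \<subseteq> G" and growth: "growth_rate p A < ereal s" and "0 \<le> s"
  shows "poincare_series p A s < \<infinity>"
proof -
  obtain s' where s': "growth_rate p A < ereal s'" "s' < s"
    using ereal_dense2[OF growth] by auto
  define c where "c = real (card {g \<in> G. len g \<le> 0})"
  have "\<forall>\<^sub>F n in sequentially. log_card (orbit_of p {g \<in> A. len g \<le> real n}) / ereal (real n) < ereal s'"
    using s'(1) unfolding growth_rate_def by (rule Limsup_lessD)
  then have ev: "\<forall>\<^sub>F n in sequentially. real (card {g \<in> A. len g \<le> real n}) \<le> c * exp (s' * real n)"
    using eventually_gt_at_top[of 0]
  proof eventually_elim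
    case (elim n)
    let ?O = "orbit_of p {g \<in> A. len g \<le> real n}"
    have "real (card ?O) \<le> exp (s' * real n)"
    proof (cases "?O = {}")
      case False
      then have "log_card ?O = ereal (ln (real (card ?O)))"
        using finite_orbit_iff[OF A, of "real n"] by (simp add: log_card_def)
      then have "ln (real (card ?O)) < s' * real n"
        using elim by (simp add: divide_less_eq)
      moreover have "0 < real (card ?O)"
        using False finite_orbit_iff[OF A, of "real n"] by (simp add: card_gt_0_iff)
      ultimately show ?thesis
        using exp_less_mono[of "ln (real (card ?O))" "s' * real n"] by simp
    next
      case True
      then show ?thesis by (simp only: card.empty) simp
    qed
    moreover have "real (card {g \<in> A. len g \<le> real n}) \<le> c * real (card ?O)"
      using of_nat_mono[OF card_le_orbit[OF A, of "real n"], where 'a = real]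
      by (simp add: c_def)
    moreover have "0 \<le> c" by (simp add: c_def)
    ultimately show ?case
      using mult_left_mono[of "real (card ?O)" "exp (s' * real n)" c] by linarith
  qed
  define S where "S n = {g \<in> A. nat \<lfloor>len g\<rfloor> = n}" for n
  have S_le: "len g \<le> real n + 1" "real n \<le> len g" if "g \<in> S n" for g n
  proof -
    have "int n = \<lfloor>len g\<rfloor>" using that by (auto simp: S_def)
    then show "len g \<le> real n + 1" "real n \<le> len g" by linarith+
  qed
  have finS: "finite (S n)" for n
    by (rule finite_subset[OF _ finite_ball[of "real n + 1"]]) (use A S_le in \<open>auto simp: S_def\<close>)
  define b where "b n = real (card (S n)) * exp (- s * real n)" for n
  have "summable b"
  proof (rule summable_comparison_test_ev)
    \<comment> \<open>Elements of the shell \<open>S n\<close> have length up to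
      \<open>n + 1\<close>, so the count is needed at \<open>Suc n\<close>.\<close>
    have ev': "\<forall>\<^sub>F n in sequentially. real (card {g \<in> A. len g \<le> real (Suc n)}) \<le> c * exp (s' * real (Suc n))"
      using ev by (subst (asm) eventually_sequentially_Suc[symmetric])
    show "\<forall>\<^sub>F n in sequentially. norm (b n) \<le> c * exp s' * exp (s' - s) ^ n"
      using ev'
    proof eventually_elim
      case (elim n)
      have "S n \<subseteq> {g \<in> A. len g \<le> real (Suc n)}"
      proof
        fix g assume g: "g \<in> S n"
        then have "g \<in> A" by (simp add: S_def)
        with S_le(1)[OF g] show "g \<in> {g \<in> A. len g \<le> real (Suc n)}" by simp
      qed
      moreover have "finite {g \<in> A. len g \<le> real (Suc n)}"
        by (rule finite_subset[OF _ finite_ball[of "real (Suc n)"]]) (use A in auto)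
      ultimately have "card (S n) \<le> card {g \<in> A. len g \<le> real (Suc n)}"
        by (rule card_mono[rotated])
      then have "real (card (S n)) \<le> c * exp (s' * real (Suc n))"
        using elim by linarith
      then have "b n \<le> c * exp (s' * real (Suc n)) * exp (- s * real n)"
        unfolding b_def by (intro mult_right_mono) auto
      also have "\<dots> = c * exp s' * exp (s' - s) ^ n"
        by (simp add: exp_of_nat_mult[symmetric] exp_add[symmetric] algebra_simps)
      finally show ?case by (simp add: b_def)
    qed
    show "summable (\<lambda>n. c * exp s' * exp (s' - s) ^ n)"
      using s'(2) by (intro summable_mult summable_geometric) simp
  qed
  have "poincare_series p A s = (\<integral>\<^sup>+g. ennreal (exp (- s * len g)) \<partial>count_space (\<Union>n\<in>UNIV. S n))"
    unfolding poincare_series_def S_def by (rule arg_cong[where f = "\<lambda>X. \<integral>\<^sup>+g. _ g \<partial>count_space X"]) auto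
  also have "\<dots> \<le> (\<integral>\<^sup>+n. (\<integral>\<^sup>+g. ennreal (exp (- s * len g)) \<partial>count_space (S n)) \<partial>count_space UNIV)"
    by (rule count_sum_UN_le) auto
  also have "\<dots> \<le> (\<integral>\<^sup>+n. ennreal (b n) \<partial>count_space UNIV)"
  proof (rule count_sum_mono)
    fix n
    have "(\<integral>\<^sup>+g. ennreal (exp (- s * len g)) \<partial>count_space (S n)) \<le>
      (\<integral>\<^sup>+g. ennreal (exp (- s * real n)) \<partial>count_space (S n))"
      using S_le(2) \<open>0 \<le> s\<close> by (intro count_sum_mono ennreal_leI) (auto intro: mult_left_mono)
    also have "\<dots> = ennreal (b n)"
      using finS by (simp add: b_def nn_integral_count_space_finite ennreal_mult' mult.commute ennreal_of_nat_eq_real_of_nat)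
    finally show "(\<integral>\<^sup>+g. ennreal (exp (- s * len g)) \<partial>count_space (S n)) \<le> ennreal (b n)" .
  qed
  also have "\<dots> = (\<Sum>n. ennreal (b n))"
    by (simp add: nn_integral_count_space_nat)
  also have "\<dots> < \<infinity>"
    by (subst suminf_ennreal2[OF _ \<open>summable b\<close>]) (auto simp: b_def)
  finally show ?thesis .
qed

end

section \<open>Geodesics near a contracting quasi-line\<close>

definition geodesic_path :: "real \<Rightarrow> (real \<Rightarrow> 'x::metric_space) \<Rightarrow> 'x \<Rightarrow> 'x \<Rightarrow> bool" where
  "geodesic_path l \<sigma> x y \<longleftrightarrow> 0 \<le> l \<and> geodesic_on {0..l} \<sigma> \<and> \<sigma> 0 = x \<and> \<sigma> l = y"

lemma geodesic_path_dist:
  "geodesic_path l \<sigma> x y \<Longrightarrow> 0 \<le> s \<Longrightarrow> s \<le> l \<Longrightarrow> 0 \<le> t \<Longrightarrow> t \<le> l \<Longrightarrow>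
    dist (\<sigma> s) (\<sigma> t) = \<bar>s - t\<bar>"
  by (simp add: geodesic_path_def geodesic_on_def)

lemma geodesic_path_length: "geodesic_path l \<sigma> x y \<Longrightarrow> l = dist x y"
  using geodesic_path_dist[of l \<sigma> x y 0 l] by (auto simp: geodesic_path_def)

lemma geodesic_path_ends:
  "geodesic_path l \<sigma> x y \<Longrightarrow> \<sigma> 0 = x" "geodesic_path l \<sigma> x y \<Longrightarrow> \<sigma> l = y"
  "geodesic_path l \<sigma> x y \<Longrightarrow> 0 \<le> l"
  by (auto simp: geodesic_path_def)

lemma geodesic_path_sub:
  "geodesic_path l \<sigma> x y \<Longrightarrow> 0 \<le> s \<Longrightarrow> s \<le> t \<Longrightarrow> t \<le> l \<Longrightarrow>
    geodesic_path (t - s) (\<lambda>u. \<sigma> (s + u)) (\<sigma> s) (\<sigma> t)"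
  by (auto simp: geodesic_path_def geodesic_on_def)

lemma geodesic_path_rev:
  "geodesic_path l \<sigma> x y \<Longrightarrow> geodesic_path l (\<lambda>u. \<sigma> (l - u)) y x"
  by (auto simp: geodesic_path_def geodesic_on_def)

lemma geodesic_path_isometry:
  "geodesic_path l \<sigma> x y \<Longrightarrow> (\<And>u v. dist (f u) (f v) = dist u v) \<Longrightarrow>
    geodesic_path l (\<lambda>u. f (\<sigma> u)) (f x) (f y)"
  by (auto simp: geodesic_path_def geodesic_on_def)

lemma geodesic_path_continuous: "geodesic_path l \<sigma> x y \<Longrightarrow> continuous_on {0..l} \<sigma>"
  by (rule continuous_onI) (auto simp: geodesic_path_def geodesic_on_def dist_real_def intro: less_imp_le)

lemma geodesic_path_near:
  assumes "geodesic_path l \<sigma> x y" "0 \<le> t" "t \<le> l" "dist (\<sigma> t) q \<le> r"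
  shows "dist x q + dist q y \<le> dist x y + 2 * r"
proof -
  have "dist x (\<sigma> t) = t" "dist (\<sigma> t) y = l - t" "dist x y = l"
    using geodesic_path_dist[OF assms(1), of 0 t] geodesic_path_dist[OF assms(1), of t l]
      geodesic_path_length[OF assms(1)] geodesic_path_ends[OF assms(1)] assms(2,3) by auto
  then show ?thesis
    using assms(4) dist_triangle[of x q "\<sigma> t"] dist_triangle[of q y "\<sigma> t"] by (simp add: dist_commute)
qed

text \<open>\<open>idx\<close> is an arbitrary choice of nearest index. \<open>contr\<close> is the
  contraction property for the chosen projections, and \<open>nearest_unique\<close> bounds the
  effect of the choice.\<close>

locale contracting_axis =
  fixes a :: "int \<Rightarrow> 'x::metric_space" and idx :: "'x \<Rightarrow> int" and C \<kappa> :: real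
  assumes nearest: "dist x (a (idx x)) \<le> dist x (a i)"
    and contr: "dist x y \<le> dist x (a (idx x)) \<Longrightarrow> dist (a (idx x)) (a (idx y)) \<le> C"
    and nearest_unique: "dist x (a i) = dist x (a (idx x)) \<Longrightarrow> dist (a i) (a (idx x)) \<le> C"
    and C: "1 \<le> C"
    and lower: "real_of_int \<bar>i - j\<bar> \<le> \<kappa> * dist (a i) (a j) + \<kappa>"
    and upper: "dist (a i) (a j) \<le> \<kappa> * real_of_int \<bar>i - j\<bar> + \<kappa>"
    and \<kappa>: "1 \<le> \<kappa>"
begin

abbreviation proj :: "'x \<Rightarrow> 'x" where "proj x \<equiv> a (idx x)"

lemma proj_a [simp]: "proj (a i) = a i"
  using nearest[of "a i" i] by simp

text \<open>Outside the contraction radius of \<open>x\<close>, the distance of both points to the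
  axis is controlled by \<open>dist x y\<close>, and the triangle inequality suffices.\<close>

lemma proj_lipschitz: "dist (proj x) (proj y) \<le> C + 4 * dist x y"
proof (cases "dist x y \<le> dist x (proj x)")
  case True
  then show ?thesis using contr zero_le_dist[of x y] by (smt (verit))
next
  case False
  have "dist y (proj y) \<le> dist x y + dist x (proj x)"
    using nearest[of y "idx x"] dist_triangle[of y "proj x" x] by (simp add: dist_commute)
  moreover have "dist (proj x) (proj y) \<le> dist x (proj x) + dist x y + dist y (proj y)"
    using dist_triangle[of "proj x" "proj y" x] dist_triangle[of x "proj y" y] by (simp add: dist_commute)
  ultimately show ?thesis using False C by linarith
qed

text \<open>At distance at least \<open>2 * C\<close> from the axis a step of length
  \<open>2 * C\<close> stays within the contraction radius, so the projection moves at most half as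
  fast as the geodesic.\<close>

lemma far_proj_steps:
  assumes \<sigma>: "geodesic_path l \<sigma> x y" and far: "\<And>t. 0 \<le> t \<Longrightarrow> t < l \<Longrightarrow> 2 * C \<le> dist (\<sigma> t) (proj (\<sigma> t))"
    and "0 \<le> s" "s \<le> t" "t \<le> l" "t - s \<le> real n * (2 * C)"
  shows "dist (proj (\<sigma> s)) (proj (\<sigma> t)) \<le> real n * C"
  using assms(3-)
proof (induction n arbitrary: s)
  case (Suc n)
  show ?case
  proof (cases "t - s \<le> 2 * C")
    case True
    show ?thesis
    proof (cases "s < t")
      case True
      have "dist (\<sigma> s) (\<sigma> t) \<le> 2 * C"
        using geodesic_path_dist[OF \<sigma>, of s t] Suc \<open>t - s \<le> 2 * C\<close> by simp
      then have "dist (proj (\<sigma> s)) (proj (\<sigma> t)) \<le> C"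
        using far[of s] True Suc by (intro contr) simp
      moreover have "0 \<le> real n * C" using C by simp
      ultimately show ?thesis by (simp add: algebra_simps)
    next
      case False
      then have "s = t" using Suc by simp
      then show ?thesis using C by simp
    qed
  next
    case False
    let ?s = "s + 2 * C"
    have "dist (\<sigma> s) (\<sigma> ?s) \<le> 2 * C"
      using geodesic_path_dist[OF \<sigma>, of s ?s] Suc False C by simp
    then have "dist (proj (\<sigma> s)) (proj (\<sigma> ?s)) \<le> C"
      using far[of s] False C Suc by (intro contr) simp
    moreover have "dist (proj (\<sigma> ?s)) (proj (\<sigma> t)) \<le> real n * C"
      using Suc False C by (intro Suc.IH) (auto simp: algebra_simps)
    ultimately show ?thesis
      using dist_triangle[of "proj (\<sigma> s)" "proj (\<sigma> t)" "proj (\<sigma> ?s)"] by (simp add: algebra_simps)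
  qed
qed simp

text \<open>The end pieces within the contraction radii of \<open>x\<close> and \<open>y\<close>
  move the projection by \<open>C\<close> each, the middle piece of length \<open>m\<close> by at
  most \<open>m / 2 + C\<close>. Since \<open>m\<close> is itself at most the distance of the
  projections, that distance is at most twice \<open>3 * C\<close>.\<close>

lemma far_proj:
  assumes \<sigma>: "geodesic_path l \<sigma> x y" and far: "\<And>t. 0 \<le> t \<Longrightarrow> t < l \<Longrightarrow> 2 * C \<le> dist (\<sigma> t) (proj (\<sigma> t))"
  shows "dist (proj x) (proj y) \<le> 6 * C"
proof -
  let ?r = "dist x (proj x)" and ?r' = "dist y (proj y)"
  have l: "l = dist x y" and e: "\<sigma> 0 = x" "\<sigma> l = y" "0 \<le> l"
    using geodesic_path_length[OF \<sigma>] geodesic_path_ends[OF \<sigma>] by auto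
  have near_x: "dist (proj x) (proj (\<sigma> t)) \<le> C" if "0 \<le> t" "t \<le> l" "t \<le> ?r" for t
    using that geodesic_path_dist[OF \<sigma>, of 0 t] e by (intro contr) simp
  have near_y: "dist (proj (\<sigma> t)) (proj y) \<le> C" if "0 \<le> t" "t \<le> l" "l - t \<le> ?r'" for t
    using contr[of y "\<sigma> t"] that geodesic_path_dist[OF \<sigma>, of l t] e by (simp add: dist_commute)
  show ?thesis
  proof (cases "l \<le> ?r + ?r'")
    case True
    let ?t = "min ?r l"
    have "dist (proj x) (proj (\<sigma> ?t)) \<le> C" using e(3) by (intro near_x) simp_all
    moreover have "dist (proj (\<sigma> ?t)) (proj y) \<le> C"
      using True e(3) by (intro near_y) (simp_all add: min_def)
    ultimately show ?thesis
      using dist_triangle[of "proj x" "proj y" "proj (\<sigma> ?t)"] C by linarith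
  next
    case False
    define m where "m = l - ?r - ?r'"
    define n where "n = nat \<lceil>m / (2 * C)\<rceil>"
    have m: "0 < m" using False by (simp add: m_def)
    have n: "m / (2 * C) \<le> real n" "real n \<le> m / (2 * C) + 1"
      using m C unfolding n_def by (auto simp: of_nat_nat le_of_int_ceiling)
    have nC: "m \<le> real n * (2 * C)" "real n * C \<le> m / 2 + C"
    proof -
      show "m \<le> real n * (2 * C)" using n(1) C by (simp add: field_simps)
      have "real n * C \<le> (m / (2 * C) + 1) * C" using n(2) C by (intro mult_right_mono) auto
      moreover have "(m / (2 * C) + 1) * C = m / 2 + C" using C by (simp add: field_simps)
      ultimately show "real n * C \<le> m / 2 + C" by simp
    qed
    have "dist (proj (\<sigma> ?r)) (proj (\<sigma> (l - ?r'))) \<le> real n * C"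
      using nC(1) m by (intro far_proj_steps[OF \<sigma> far]) (auto simp: m_def)
    moreover have "dist (proj x) (proj (\<sigma> ?r)) \<le> C"
      using False zero_le_dist[of x "proj x"] zero_le_dist[of y "proj y"] by (intro near_x) linarith+
    moreover have "dist (proj (\<sigma> (l - ?r'))) (proj y) \<le> C"
      using False zero_le_dist[of x "proj x"] zero_le_dist[of y "proj y"] by (intro near_y) linarith+
    ultimately have "dist (proj x) (proj y) \<le> 3 * C + m / 2"
      using nC(2) dist_triangle[of "proj x" "proj y" "proj (\<sigma> ?r)"]
        dist_triangle[of "proj (\<sigma> ?r)" "proj y" "proj (\<sigma> (l - ?r'))"] by linarith
    moreover have "m \<le> dist (proj x) (proj y)"
      using dist_triangle[of x y "proj x"] dist_triangle[of "proj x" y "proj y"]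
      unfolding m_def l by (simp add: dist_commute)
    ultimately show ?thesis by linarith
  qed
qed

lemma continuous_dist_axis: "continuous_on UNIV (\<lambda>x. dist x (proj x))"
proof (rule continuous_onI)
  fix x e assume "(0::real) < e"
  have "dist (dist x' (proj x')) (dist x (proj x)) \<le> dist x' x" for x'
    using nearest[of x "idx x'"] nearest[of x' "idx x"] dist_triangle[of x' "proj x" x]
      dist_triangle[of x "proj x'" x'] by (simp add: dist_real_def dist_commute)
  then show "\<exists>d>0. \<forall>x'\<in>UNIV. dist x' x < d \<longrightarrow> dist (dist x' (proj x')) (dist x (proj x)) \<le> e"
    using \<open>0 < e\<close> by (intro exI[of _ e]) (auto intro: order_trans less_imp_le)
qed

text \<open>At the first time the geodesic is within \<open>2 * C\<close> of the axis,
  \<open>far_proj\<close> shows that the projection has moved by at most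
  \<open>6 * C\<close>.\<close>

lemma near_proj_start:
  assumes \<sigma>: "geodesic_path l \<sigma> x y" and far: "6 * C < dist (proj x) (proj y)"
  shows "\<exists>t. 0 \<le> t \<and> t \<le> l \<and> dist (\<sigma> t) (proj x) \<le> 8 * C"
proof -
  let ?\<delta> = "\<lambda>t. dist (\<sigma> t) (proj (\<sigma> t))"
  define S where "S = {0..l} \<inter> ?\<delta> -` {..2 * C}"
  have "continuous_on {0..l} ?\<delta>"
    using continuous_on_compose2[OF continuous_dist_axis geodesic_path_continuous[OF \<sigma>]] by simp
  then have "closed S"
    unfolding S_def by (rule continuous_closed_preimage) auto
  moreover have "bounded S"
    by (rule bounded_subset[of "{0..l}"]) (auto simp: S_def)
  ultimately have "compact S" by (simp add: compact_eq_bounded_closed)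
  have "S \<noteq> {}"
  proof
    assume "S = {}"
    have "2 * C \<le> ?\<delta> t" if "0 \<le> t" "t < l" for t
    proof -
      have "t \<notin> S" using \<open>S = {}\<close> by simp
      then show ?thesis using that unfolding S_def by auto
    qed
    from far_proj[OF \<sigma> this] show False using far by linarith
  qed
  then obtain t where t: "t \<in> S" "\<And>s. s \<in> S \<Longrightarrow> t \<le> s"
    using compact_attains_inf[OF \<open>compact S\<close>] by auto
  have tl: "0 \<le> t" "t \<le> l" and near: "?\<delta> t \<le> 2 * C" using t(1) by (auto simp: S_def)
  have "geodesic_path t \<sigma> x (\<sigma> t)"
    using geodesic_path_sub[OF \<sigma>, of 0 t] tl geodesic_path_ends[OF \<sigma>] by simp
  moreover have "2 * C \<le> ?\<delta> s" if "0 \<le> s" "s < t" for s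
  proof -
    have "s \<notin> S" using t(2)[of s] that by auto
    then show ?thesis using that tl unfolding S_def by auto
  qed
  ultimately have "dist (proj x) (proj (\<sigma> t)) \<le> 6 * C"
    by (rule far_proj)
  then show ?thesis
    using tl near dist_triangle[of "\<sigma> t" "proj x" "proj (\<sigma> t)"] by (intro exI[of _ t]) (simp add: dist_commute)
qed

lemma near_proj_end:
  assumes \<sigma>: "geodesic_path l \<sigma> x y" and far: "6 * C < dist (proj x) (proj y)"
  shows "\<exists>t. 0 \<le> t \<and> t \<le> l \<and> dist (\<sigma> t) (proj y) \<le> 8 * C"
proof -
  obtain t where "0 \<le> t" "t \<le> l" "dist (\<sigma> (l - t)) (proj y) \<le> 8 * C"
    using near_proj_start[OF geodesic_path_rev[OF \<sigma>]] far by (auto simp: dist_commute)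
  then show ?thesis by (intro exI[of _ "l - t"]) auto
qed

text \<open>The geodesic passes within \<open>8 * C\<close> of \<open>proj (\<sigma> t)\<close> both
  before and after time \<open>t\<close>, so these two times, and \<open>t\<close> between them, are
  close.\<close>

lemma near_axis_middle:
  assumes \<sigma>: "geodesic_path l \<sigma> x y" and t: "0 \<le> t" "t \<le> l"
    and far: "6 * C < dist (proj x) (proj (\<sigma> t))" "6 * C < dist (proj (\<sigma> t)) (proj y)"
  shows "dist (\<sigma> t) (proj (\<sigma> t)) \<le> 24 * C"
proof -
  have "geodesic_path t \<sigma> x (\<sigma> t)"
    using geodesic_path_sub[OF \<sigma>, of 0 t] t geodesic_path_ends[OF \<sigma>] by simp
  from near_proj_end[OF this far(1)] obtain s where s: "0 \<le> s" "s \<le> t" "dist (\<sigma> s) (proj (\<sigma> t)) \<le> 8 * C"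
    by auto
  have "geodesic_path (l - t) (\<lambda>u. \<sigma> (t + u)) (\<sigma> t) y"
    using geodesic_path_sub[OF \<sigma>, of t l] t geodesic_path_ends[OF \<sigma>] by simp
  from near_proj_start[OF this far(2)] obtain u where
    u: "0 \<le> u" "u \<le> l - t" "dist (\<sigma> (t + u)) (proj (\<sigma> t)) \<le> 8 * C"
    by auto
  have "dist (\<sigma> s) (\<sigma> (t + u)) = t + u - s" "dist (\<sigma> t) (\<sigma> s) = t - s"
    using geodesic_path_dist[OF \<sigma>, of s "t + u"] geodesic_path_dist[OF \<sigma>, of t s] s u t by auto
  then show ?thesis
    using s u dist_triangle2[of "\<sigma> s" "\<sigma> (t + u)" "proj (\<sigma> t)"] dist_triangle[of "\<sigma> t" "proj (\<sigma> t)" "\<sigma> s"] by linarith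
qed

text \<open>Quasiconvexity of the axis. When \<open>\<sigma> t\<close> projects close to an
  endpoint, \<open>near_axis_middle\<close> does not apply; then \<open>t\<close> is close to that
  end of the geodesic, which lies on the axis.\<close>

lemma near_axis_between:
  assumes \<sigma>: "geodesic_path l \<sigma> (a i) (a j)" and t: "0 \<le> t" "t \<le> l"
  shows "dist (\<sigma> t) (proj (\<sigma> t)) \<le> 24 * C"
proof -
  have l: "l = dist (a i) (a j)" and ts: "dist (a i) (\<sigma> t) = t" "dist (\<sigma> t) (a j) = l - t"
    using geodesic_path_dist[OF \<sigma>, of 0 t] geodesic_path_dist[OF \<sigma>, of t l] t
      geodesic_path_length[OF \<sigma>] geodesic_path_ends[OF \<sigma>] by auto
  have le: "dist (\<sigma> t) (proj (\<sigma> t)) \<le> t" "dist (\<sigma> t) (proj (\<sigma> t)) \<le> l - t"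
    using nearest[of "\<sigma> t" i] nearest[of "\<sigma> t" j] ts by (auto simp: dist_commute)
  show ?thesis
  proof (cases "6 * C < dist (a i) (proj (\<sigma> t))")
    case far1: True
    show ?thesis
    proof (cases "6 * C < dist (proj (\<sigma> t)) (a j)")
      case True
      then show ?thesis using near_axis_middle[OF \<sigma> t] far1 by simp
    next
      case False
      have "geodesic_path t \<sigma> (a i) (\<sigma> t)"
        using geodesic_path_sub[OF \<sigma>, of 0 t] t geodesic_path_ends[OF \<sigma>] by simp
      from near_proj_end[OF this] far1 obtain s where s: "0 \<le> s" "s \<le> t" "dist (\<sigma> s) (proj (\<sigma> t)) \<le> 8 * C"
        by auto
      have "l - s = dist (\<sigma> s) (a j)"
        using geodesic_path_dist[OF \<sigma>, of s l] s t geodesic_path_ends[OF \<sigma>] by auto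
      then have "l - s \<le> 14 * C"
        using s(3) False dist_triangle[of "\<sigma> s" "a j" "proj (\<sigma> t)"] by linarith
      then show ?thesis using le s C by linarith
    qed
  next
    case near1: False
    show ?thesis
    proof (cases "6 * C < dist (proj (\<sigma> t)) (a j)")
      case True
      have "geodesic_path (l - t) (\<lambda>u. \<sigma> (t + u)) (\<sigma> t) (a j)"
        using geodesic_path_sub[OF \<sigma>, of t l] t geodesic_path_ends[OF \<sigma>] by simp
      from near_proj_start[OF this] True obtain u where
        u: "0 \<le> u" "u \<le> l - t" "dist (\<sigma> (t + u)) (proj (\<sigma> t)) \<le> 8 * C"
        by auto
      have "t + u = dist (a i) (\<sigma> (t + u))"
        using geodesic_path_dist[OF \<sigma>, of 0 "t + u"] u t geodesic_path_ends[OF \<sigma>] by auto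
      then have "t + u \<le> 14 * C"
        using u(3) near1 dist_triangle[of "a i" "\<sigma> (t + u)" "proj (\<sigma> t)"] by (simp add: dist_commute)
      then show ?thesis using le u C by linarith
    next
      case False
      then have "l \<le> 12 * C"
        using near1 l dist_triangle[of "a i" "a j" "proj (\<sigma> t)"] by linarith
      then show ?thesis using le C by linarith
    qed
  qed
qed

end

section \<open>Coarse behaviour of nearest-point indices along geodesics\<close>

context contracting_axis
begin

lemma idx_diff_le: "dist (proj x) (proj y) \<le> r \<Longrightarrow> real_of_int \<bar>idx x - idx y\<bar> \<le> \<kappa> * r + \<kappa>"
  using lower[of "idx x" "idx y"] mult_left_mono[of "dist (proj x) (proj y)" r \<kappa>] \<kappa> by linarith

lemma idx_lipschitz: "real_of_int \<bar>idx x - idx y\<bar> \<le> \<kappa> * (C + 4 * dist x y) + \<kappa>"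
  by (rule idx_diff_le[OF proj_lipschitz])

text \<open>A discrete intermediate value argument: \<open>idx\<close> is only coarsely Lipschitz,
  so a time almost equal to the supremum of those with index at most \<open>i\<close> is compared
  with a time at most one unit later.\<close>

lemma idx_intermediate:
  assumes \<sigma>: "geodesic_path l \<sigma> x y" and i: "idx x \<le> i" "i \<le> idx y"
  shows "\<exists>t. 0 \<le> t \<and> t \<le> l \<and> real_of_int \<bar>idx (\<sigma> t) - i\<bar> \<le> \<kappa> * (C + 4) + \<kappa>"
proof -
  define S where "S = {t. 0 \<le> t \<and> t \<le> l \<and> idx (\<sigma> t) \<le> i}"
  have "0 \<in> S" using i geodesic_path_ends[OF \<sigma>] by (simp add: S_def)
  moreover have bdd: "bdd_above S" by (rule bdd_aboveI[of _ l]) (simp add: S_def)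
  ultimately obtain t where t: "t \<in> S" "Sup S - 1 < t"
    using less_cSup_iff[of S "Sup S - 1"] by force
  then have tl: "0 \<le> t" "t \<le> l" "idx (\<sigma> t) \<le> i" by (auto simp: S_def)
  define t' where "t' = min l (t + 1)"
  have t': "0 \<le> t'" "t' \<le> l" using tl by (auto simp: t'_def)
  have "i \<le> idx (\<sigma> t')"
  proof (cases "t' = l")
    case True
    then show ?thesis using i geodesic_path_ends[OF \<sigma>] by simp
  next
    case False
    then have "Sup S < t'" using t by (simp add: t'_def min_def split: if_splits)
    then have "t' \<notin> S" using cSup_upper[OF _ bdd, of t'] by auto
    then show ?thesis using t' by (simp add: S_def)
  qed
  moreover have "dist (\<sigma> t) (\<sigma> t') \<le> 1"
    using geodesic_path_dist[OF \<sigma>, of t t'] tl t' by (simp add: t'_def)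
  then have "\<kappa> * (C + 4 * dist (\<sigma> t) (\<sigma> t')) \<le> \<kappa> * (C + 4)"
    using \<kappa> by (intro mult_left_mono) auto
  then have "real_of_int \<bar>idx (\<sigma> t) - idx (\<sigma> t')\<bar> \<le> \<kappa> * (C + 4) + \<kappa>"
    using idx_lipschitz[of "\<sigma> t" "\<sigma> t'"] by linarith
  ultimately show ?thesis using tl by (intro exI[of _ t]) linarith
qed

text \<open>The margin \<open>m\<close> keeps the projections of \<open>x\<close>,
  \<open>\<sigma> t\<close> and \<open>y\<close> more than \<open>6 * C\<close> apart, even after
  the error of \<open>idx_intermediate\<close>, so that \<open>near_axis_middle\<close>
  applies.\<close>

lemma idx_morse:
  assumes \<sigma>: "geodesic_path l \<sigma> x y"
    and m: "m > 6 * \<kappa> * C + \<kappa> + \<kappa> * (C + 4) + \<kappa>"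
    and i: "idx x + m \<le> real_of_int i" "real_of_int i + m \<le> idx y"
  shows "\<exists>t. 0 \<le> t \<and> t \<le> l \<and> dist (\<sigma> t) (a i) \<le> 24 * C + \<kappa> * (\<kappa> * (C + 4) + \<kappa>) + \<kappa>"
proof -
  define J where "J = \<kappa> * (C + 4) + \<kappa>"
  have pos: "0 \<le> \<kappa> * C" "0 \<le> J" using \<kappa> C by (auto simp: J_def)
  then have "idx x \<le> i" "i \<le> idx y" using m i \<kappa> by (auto simp: J_def)
  then obtain t where t: "0 \<le> t" "t \<le> l" "real_of_int \<bar>idx (\<sigma> t) - i\<bar> \<le> J"
    using idx_intermediate[OF \<sigma>] unfolding J_def by blast
  have far: "6 * C < dist (a j) (a j')" if "real_of_int \<bar>j - j'\<bar> \<ge> m - J" for j j'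
  proof (rule ccontr)
    assume "\<not> 6 * C < dist (a j) (a j')"
    then have "\<kappa> * dist (a j) (a j') \<le> \<kappa> * (6 * C)" using \<kappa> by (intro mult_left_mono) auto
    then have "real_of_int \<bar>j - j'\<bar> \<le> 6 * \<kappa> * C + \<kappa>" using lower[of j j'] by linarith
    then show False using that m by (simp add: J_def)
  qed
  have "dist (\<sigma> t) (proj (\<sigma> t)) \<le> 24 * C"
    using i t by (intro near_axis_middle[OF \<sigma>] far) linarith+
  moreover have "\<kappa> * real_of_int \<bar>idx (\<sigma> t) - i\<bar> \<le> \<kappa> * J"
    using t(3) \<kappa> by (intro mult_left_mono) auto
  then have "dist (proj (\<sigma> t)) (a i) \<le> \<kappa> * J + \<kappa>"
    using upper[of "idx (\<sigma> t)" i] by linarith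
  ultimately have "dist (\<sigma> t) (a i) \<le> 24 * C + \<kappa> * J + \<kappa>"
    using dist_triangle[of "\<sigma> t" "a i" "proj (\<sigma> t)"] by linarith
  then show ?thesis using t unfolding J_def by blast
qed

lemma idx_nearest:
  assumes "dist x (a i) \<le> dist x (proj x)"
  shows "real_of_int \<bar>i - idx x\<bar> \<le> \<kappa> * C + \<kappa>"
proof -
  have "dist (proj (a i)) (proj x) \<le> C"
    using assms nearest[of x i] nearest_unique[of x i] by simp
  then have "\<kappa> * dist (a i) (proj x) \<le> \<kappa> * C" using \<kappa> by (intro mult_left_mono) auto
  then show ?thesis using lower[of i "idx x"] by linarith
qed

text \<open>On a shortest geodesic to the axis the foot stays a nearest point, so only the choice
  made by \<open>idx\<close> can differ.\<close>

lemma idx_on_perpendicular: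
  assumes \<sigma>: "geodesic_path l \<sigma> x (proj x)" and t: "0 \<le> t" "t \<le> l"
  shows "real_of_int \<bar>idx x - idx (\<sigma> t)\<bar> \<le> \<kappa> * C + \<kappa>"
proof (rule idx_nearest)
  have "dist x (\<sigma> t) = t" "dist (\<sigma> t) (proj x) = l - t" "l = dist x (proj x)"
    using geodesic_path_dist[OF \<sigma>, of 0 t] geodesic_path_dist[OF \<sigma>, of t l] t
      geodesic_path_length[OF \<sigma>] geodesic_path_ends[OF \<sigma>] by auto
  then show "dist (\<sigma> t) (proj x) \<le> dist (\<sigma> t) (proj (\<sigma> t))"
    using nearest[of x "idx (\<sigma> t)"] dist_triangle[of x "proj (\<sigma> t)" "\<sigma> t"] by linarith
qed

text \<open>\<open>f\<close> carries nearest points to nearest points; the error again comes from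
  the choice of \<open>idx\<close>.\<close>

lemma idx_shift:
  assumes "\<And>x y. dist (f x) (f y) = dist x y" "\<And>i. f (a i) = a (i + n)"
  shows "real_of_int \<bar>idx x + n - idx (f x)\<bar> \<le> \<kappa> * C + \<kappa>"
proof (rule idx_nearest)
  have "dist (f x) (a (idx x + n)) = dist x (proj x)"
    using assms by metis
  moreover have "dist (f x) (proj (f x)) = dist x (a (idx (f x) - n))"
    using assms(1)[of x "a (idx (f x) - n)"] assms(2)[of "idx (f x) - n"] by simp
  ultimately show "dist (f x) (a (idx x + n)) \<le> dist (f x) (proj (f x))"
    using nearest by simp
qed

end

text \<open>
  The coarse behaviour of the nearest-index map of a contracting axis \<open>i \<mapsto> pw i p\<close>,
  with all constants merged into one integer \<open>K\<close>.
\<close>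

locale group_axis = proper_isometric_action \<Gamma> p
  for \<Gamma> :: "('x::metric_space \<Rightarrow> 'x) set" and p :: 'x +
  fixes pw :: "int \<Rightarrow> 'x \<Rightarrow> 'x" and idx :: "'x \<Rightarrow> int" and K :: int
  assumes geodesic: "\<And>x y :: 'x. \<exists>l \<sigma>. geodesic_path l \<sigma> x y"
    and pw_mem: "pw i \<in> \<Gamma>"
    and pw_add: "pw (i + j) = pw i \<circ> pw j"
    and K: "1 \<le> K"
    and idx_lip: "\<bar>idx x - idx y\<bar> \<le> K * (dist x y + 1)"
    and morse: "geodesic_path l \<sigma> x y \<Longrightarrow> idx x + K \<le> i \<Longrightarrow> i + K \<le> idx y \<Longrightarrow>
      \<exists>t. 0 \<le> t \<and> t \<le> l \<and> dist (\<sigma> t) (pw i p) \<le> K"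
    and idx_a: "\<bar>idx (pw i p) - i\<bar> \<le> K"
    and idx_pw: "\<bar>idx (pw n x) - (idx x + n)\<bar> \<le> K"
    and idx_perp: "geodesic_path l \<sigma> x (pw (idx x) p) \<Longrightarrow> 0 \<le> t \<Longrightarrow> t \<le> l \<Longrightarrow> \<bar>idx (\<sigma> t) - idx x\<bar> \<le> K"
    and dist_a: "dist (pw i p) (pw j p) \<le> K * (\<bar>i - j\<bar> + 1)"
    and near_axis: "geodesic_path l \<sigma> (pw i p) (pw j p) \<Longrightarrow> 0 \<le> t \<Longrightarrow> t \<le> l \<Longrightarrow>
      dist (\<sigma> t) (pw (idx (\<sigma> t)) p) \<le> K"

lemma contracting_axis_idx:
  fixes a :: "int \<Rightarrow> 'x::metric_space"
  assumes proper: "\<And>(x::'x) r. compact (cball x r)"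
    and "contracting C (range a)"
    and qi: "\<And>i j. real_of_int \<bar>i - j\<bar> / k - c \<le> dist (a i) (a j)"
      "\<And>i j. dist (a i) (a j) \<le> k * real_of_int \<bar>i - j\<bar> + c"
    and kc: "1 \<le> k" "0 \<le> c"
  shows "\<exists>idx C' \<kappa>. contracting_axis a idx C' \<kappa>"
proof -
  have closed: "closed (range a)" and
    contr: "dist x y \<le> infdist x (range a) \<Longrightarrow>
      diameter (nearest_points (range a) x \<union> nearest_points (range a) y) \<le> C" for x y
    using assms(2) by (auto simp: contracting_def)
  have "\<exists>i. dist x (a i) = infdist x (range a)" for x
  proof -
    let ?Z = "range a \<inter> cball x (infdist x (range a) + 1)"
    have "\<exists>z\<in>range a. dist x z < infdist x (range a) + 1"
    proof (rule ccontr)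
      assume "\<not> ?thesis"
      then have "infdist x (range a) + 1 \<le> (INF z\<in>range a. dist x z)"
        by (intro cINF_greatest) (auto simp: not_less)
      moreover have "infdist x (range a) = (INF z\<in>range a. dist x z)"
        by (rule infdist_notempty) simp
      ultimately show False by linarith
    qed
    then obtain z where z: "z \<in> range a" "dist x z < infdist x (range a) + 1" by blast
    have "compact ?Z" using closed proper by (simp add: closed_Int_compact)
    moreover have "?Z \<noteq> {}" using z by (force intro: less_imp_le)
    moreover have "continuous_on ?Z (dist x)" by (intro continuous_intros)
    ultimately have "\<exists>w\<in>?Z. \<forall>v\<in>?Z. dist x w \<le> dist x v" by (rule continuous_attains_inf)
    then obtain w where w: "w \<in> ?Z" "\<And>v. v \<in> ?Z \<Longrightarrow> dist x w \<le> dist x v" by blast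
    have "dist x w \<le> dist x v" if "v \<in> range a" for v
      using w(2)[of v] w(1) that by (cases "v \<in> ?Z") auto
    then have "dist x w \<le> infdist x (range a)"
      by (auto simp: infdist_def intro!: cINF_greatest)
    moreover have "infdist x (range a) \<le> dist x w" using w(1) by (intro infdist_le) auto
    ultimately show ?thesis using w(1) by force
  qed
  then obtain idx where idx: "\<And>x. dist x (a (idx x)) = infdist x (range a)" by metis
  have le: "infdist x (range a) \<le> dist x (a i)" for x i by (intro infdist_le) auto
  have near: "dist (a i) (a j) \<le> C"
    if "dist x y \<le> infdist x (range a)" "dist x (a i) = infdist x (range a)"
      "dist y (a j) = infdist y (range a)" for x y i j
  proof -
    let ?N = "nearest_points (range a) x \<union> nearest_points (range a) y"
    have "?N \<subseteq> cball x (infdist x (range a)) \<union> cball y (infdist y (range a))"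
      by (auto simp: nearest_points_def)
    then have "bounded ?N" by (rule bounded_subset[rotated]) auto
    then have "dist (a i) (a j) \<le> diameter ?N"
      using that by (intro diameter_bounded_bound) (auto simp: nearest_points_def)
    then show ?thesis using contr[OF that(1)] by linarith
  qed
  \<comment> \<open>The term \<open>k * c\<close> arises from inverting the lower quasi-isometry
    inequality; the sum dominates all coefficients at once.\<close>
  define \<kappa> where "\<kappa> = k + k * c + c + 1"
  have "0 \<le> k * c" using kc by simp
  then have \<kappa>: "1 \<le> \<kappa>" "k \<le> \<kappa>" "k * c \<le> \<kappa>" "c \<le> \<kappa>" using kc by (auto simp: \<kappa>_def)
  have lower: "real_of_int \<bar>i - j\<bar> \<le> \<kappa> * dist (a i) (a j) + \<kappa>" for i j
  proof -
    have "real_of_int \<bar>i - j\<bar> \<le> k * (dist (a i) (a j) + c)"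
      using qi(1)[of i j] kc by (simp add: field_simps)
    also have "\<dots> \<le> \<kappa> * dist (a i) (a j) + \<kappa>"
      using \<kappa> mult_right_mono[of k \<kappa> "dist (a i) (a j)"] by (simp add: algebra_simps)
    finally show ?thesis .
  qed
  show ?thesis
  proof (rule exI[of _ idx], rule exI[of _ "max C 1"], rule exI[of _ \<kappa>], rule contracting_axis.intro)
    fix x y :: 'x and i j :: int
    show "dist x (a (idx x)) \<le> dist x (a i)" by (simp add: idx le)
    show "dist (a (idx x)) (a (idx y)) \<le> max C 1" if "dist x y \<le> dist x (a (idx x))"
      using near[of x y "idx x" "idx y"] that idx by (simp add: le_max_iff_disj)
    show "dist (a i) (a (idx x)) \<le> max C 1" if "dist x (a i) = dist x (a (idx x))"
      using near[of x x i "idx x"] that idx by (simp add: le_max_iff_disj infdist_nonneg)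
    show "dist (a i) (a j) \<le> \<kappa> * real_of_int \<bar>i - j\<bar> + \<kappa>"
      using qi(2)[of i j] \<kappa> mult_right_mono[of k \<kappa> "real_of_int \<bar>i - j\<bar>"] by linarith
  qed (use \<kappa> lower in auto)
qed

lemma group_axis_exists:
  fixes p :: "'x::metric_space"
  assumes act: "proper_isometric_action \<Gamma> p" and \<Gamma>: "subgroup \<Gamma> isometry_group"
    and proper: "\<And>(x::'x) r. compact (cball x r)"
    and geodesic: "\<And>x y::'x. \<exists>S. geodesic_segment x y S"
    and g: "g \<in> \<Gamma>" "contracting_isometry p g"
  shows "\<exists>pw idx K. group_axis \<Gamma> p pw idx K"
proof -
  interpret proper_isometric_action \<Gamma> p by (rule act)
  interpret grp: group "isometry_group :: ('x \<Rightarrow> 'x) monoid" by (rule group_isometry_group)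
  define pw where "pw i = g [^]\<^bsub>isometry_group\<^esub> (i::int)" for i
  have gc: "g \<in> carrier isometry_group" using g \<Gamma> by (meson subgroup.mem_carrier)
  have pw_mem: "pw i \<in> \<Gamma>" for i
    unfolding pw_def using grp.subgroup_int_pow_closed[OF \<Gamma> g(1)] by simp
  have pw_add: "pw (i + j) = pw i \<circ> pw j" for i j
    unfolding pw_def using grp.int_pow_mult[OF gc, of i j] by (simp add: isometry_group_def)
  obtain k c where qi: "quasi_isometric_embedding k c \<int> (\<lambda>t. pw \<lfloor>t\<rfloor> p)"
    using g(2) unfolding contracting_isometry_def pw_def by blast
  obtain C0 where C0: "contracting C0 (range (\<lambda>n. pw n p))"
    using g(2) unfolding contracting_isometry_def pw_def by blast
  have "\<exists>idx C' \<kappa>. contracting_axis (\<lambda>n. pw n p) idx C' \<kappa>"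
  proof (rule contracting_axis_idx[OF proper C0])
    fix i j :: int
    show "real_of_int \<bar>i - j\<bar> / k - c \<le> dist (pw i p) (pw j p)"
      "dist (pw i p) (pw j p) \<le> k * real_of_int \<bar>i - j\<bar> + c"
      using qi[unfolded quasi_isometric_embedding_def] Ints_of_int[of i] Ints_of_int[of j]
      by (metis (no_types, lifting) floor_of_int of_int_abs of_int_diff)+
    show "1 \<le> k" "0 \<le> c" using qi by (auto simp: quasi_isometric_embedding_def)
  qed
  then obtain idx C \<kappa> where ax: "contracting_axis (\<lambda>n. pw n p) idx C \<kappa>" by blast
  interpret contracting_axis "\<lambda>n. pw n p" idx C \<kappa> by (rule ax)
  \<comment> \<open>The two brackets are the index margin and the distance bound of
    \<open>idx_morse\<close>; their sum dominates every other error, as listed in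
    \<open>KM\<close>.\<close>
  define M where "M = 1 + (6 * \<kappa> * C + \<kappa> + \<kappa> * (C + 4) + \<kappa>) + (24 * C + \<kappa> * (\<kappa> * (C + 4) + \<kappa>) + \<kappa>)"
  define K where "K = \<lceil>M\<rceil>"
  have pos: "0 \<le> \<kappa> * C" "0 \<le> \<kappa> * (\<kappa> * (C + 4) + \<kappa>)" "0 \<le> \<kappa> * (C + 4)" "\<kappa> * (C + 4) = \<kappa> * C + 4 * \<kappa>"
    using \<kappa> C by (auto simp: algebra_simps)
  have "M \<le> K" by (simp add: K_def le_of_int_ceiling)
  then have KM: "1 \<le> K" "\<kappa> \<le> K" "\<kappa> * C + \<kappa> \<le> K" "\<kappa> * C + 5 * \<kappa> \<le> K" "24 * C \<le> K"
    "6 * \<kappa> * C + \<kappa> + \<kappa> * (C + 4) + \<kappa> < K" "24 * C + \<kappa> * (\<kappa> * (C + 4) + \<kappa>) + \<kappa> \<le> K"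
    using pos \<kappa> C unfolding M_def by linarith+
  have "group_axis \<Gamma> p pw idx K"
  proof unfold_locales
    fix x y :: 'x
    obtain S where "geodesic_segment x y S" using geodesic by blast
    then show "\<exists>l \<sigma>. geodesic_path l \<sigma> x y"
      unfolding geodesic_segment_def geodesic_path_def by blast
    have "\<kappa> * (C + 4 * dist x y) + \<kappa> = (\<kappa> * C + \<kappa>) + 4 * \<kappa> * dist x y" by (simp add: algebra_simps)
    also have "\<dots> \<le> K + K * dist x y"
    proof -
      have "4 * \<kappa> \<le> K" using KM(4) pos(1) \<kappa> by linarith
      then show ?thesis using KM(3) mult_right_mono[of "4 * \<kappa>" K "dist x y"] by simp
    qed
    finally show "\<bar>idx x - idx y\<bar> \<le> K * (dist x y + 1)"
      using idx_lipschitz[of x y] by (simp add: algebra_simps)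
  next
    fix l \<sigma> x y i
    assume "geodesic_path l \<sigma> x y" "idx x + K \<le> i" "i + K \<le> idx y"
    then show "\<exists>t. 0 \<le> t \<and> t \<le> l \<and> dist (\<sigma> t) (pw i p) \<le> K"
      using idx_morse[of l \<sigma> x y K i] KM by (force intro: order_trans)
  next
    fix i
    show "\<bar>idx (pw i p) - i\<bar> \<le> K"
      using idx_nearest[of "pw i p" i] KM by (simp add: abs_minus_commute)
  next
    fix n x
    have "pw n (pw i p) = pw (i + n) p" for i
      by (metis add.commute comp_apply pw_add)
    then show "\<bar>idx (pw n x) - (idx x + n)\<bar> \<le> K"
      using idx_shift[of "pw n" n x] KM dist_act[OF pw_mem] by (simp add: abs_minus_commute)
  next
    fix l \<sigma> x and t :: real
    assume "geodesic_path l \<sigma> x (pw (idx x) p)" "0 \<le> t" "t \<le> l"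
    then show "\<bar>idx (\<sigma> t) - idx x\<bar> \<le> K"
      using idx_on_perpendicular[of l \<sigma> x t] KM by (simp add: abs_minus_commute)
  next
    fix i j
    show "dist (pw i p) (pw j p) \<le> K * (\<bar>i - j\<bar> + 1)"
      using upper[of i j] KM mult_right_mono[of \<kappa> K "real_of_int (\<bar>i - j\<bar> + 1)"] by (simp add: algebra_simps)
  next
    fix l \<sigma> i j and t :: real
    assume "geodesic_path l \<sigma> (pw i p) (pw j p)" "0 \<le> t" "t \<le> l"
    then show "dist (\<sigma> t) (pw (idx (\<sigma> t)) p) \<le> K"
      using near_axis_between[of l \<sigma> i j t] KM by simp
  qed (use KM pw_mem pw_add in auto)
  then show ?thesis by blast
qed

section \<open>Barriers\<close>

context group_axis
begin

lemma pw_0 [simp]: "pw 0 = id"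
proof -
  have "pw 0 (pw 0 x) = pw 0 x" for x using pw_add[of 0 0] by (metis add.right_neutral comp_apply)
  then have "pw 0 x = x" for x using pw_mem[of 0] by (metis inv_apply(1))
  then show ?thesis by auto
qed

lemma pw_inverse: "inverse_map (pw i) = pw (- i)"
proof
  fix x
  have "pw i (pw (- i) x) = x" using pw_add[of i "- i"] by (metis add.right_inverse comp_apply id_apply pw_0)
  then show "inverse_map (pw i) x = pw (- i) x" using pw_mem[of i] by (metis inv_apply(1))
qed

lemma dist_p_pw: "dist p (pw i p) \<le> K * (\<bar>i\<bar> + 1)"
  using dist_a[of 0 i] by simp

lemma idx_p: "\<bar>idx p\<bar> \<le> K"
  using idx_a[of 0] by simp

lemma idx_lip_at:
  fixes r :: int
  assumes "f \<in> \<Gamma>" "dist x y \<le> r"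
  shows "\<bar>idx (inverse_map f x) - idx (inverse_map f y)\<bar> \<le> K * (r + 1)"
proof -
  have "real_of_int K * (dist x y + 1) \<le> real_of_int K * (r + 1)"
    using assms(2) K by (intro mult_left_mono) simp_all
  then have "real_of_int \<bar>idx (inverse_map f x) - idx (inverse_map f y)\<bar> \<le> real_of_int (K * (r + 1))"
    using idx_lip[of "inverse_map f x" "inverse_map f y"] assms(1) by simp
  then show ?thesis by (simp only: of_int_le_iff)
qed

lemma idx_lip_int: "dist x y \<le> real_of_int r \<Longrightarrow> \<bar>idx x - idx y\<bar> \<le> K * (r + 1)"
  using idx_lip_at[OF id_mem] by simp

lemma morse_at:
  assumes f: "f \<in> \<Gamma>" and \<sigma>: "geodesic_path l \<sigma> x y"
    and i: "idx (inverse_map f x) + K \<le> i \<and> i + K \<le> idx (inverse_map f y) \<or>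
      idx (inverse_map f y) + K \<le> i \<and> i + K \<le> idx (inverse_map f x)"
  shows "\<exists>t. 0 \<le> t \<and> t \<le> l \<and> dist (\<sigma> t) (f (pw i p)) \<le> K"
proof -
  have path: "geodesic_path l (\<lambda>t. inverse_map f (\<sigma> t)) (inverse_map f x) (inverse_map f y)"
    by (rule geodesic_path_isometry[OF \<sigma>, of "inverse_map f"]) (simp add: f)
  from i have "\<exists>t. 0 \<le> t \<and> t \<le> l \<and> dist (inverse_map f (\<sigma> t)) (pw i p) \<le> K"
  proof (elim disjE conjE)
    assume "idx (inverse_map f y) + K \<le> i" "i + K \<le> idx (inverse_map f x)"
    from morse[OF geodesic_path_rev[OF path] this] obtain t where
      "0 \<le> t" "t \<le> l" "dist (inverse_map f (\<sigma> (l - t))) (pw i p) \<le> K" by blast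
    then show ?thesis by (intro exI[of _ "l - t"]) auto
  qed (rule morse[OF path])
  then show ?thesis using f by (simp add: dist_inv_left)
qed

text \<open>In the coordinate of the translated axis the endpoints lie on opposite sides of the
  centre \<open>f p\<close>, which has index about 0; \<open>m\<close> measures how far. Either
  direction is allowed.\<close>

definition barrier :: "int \<Rightarrow> 'x \<Rightarrow> 'x \<Rightarrow> ('x \<Rightarrow> 'x) \<Rightarrow> bool" where
  "barrier m x z f \<longleftrightarrow>
     idx (inverse_map f x) \<le> - m \<and> m \<le> idx (inverse_map f z) \<or>
     m \<le> idx (inverse_map f x) \<and> idx (inverse_map f z) \<le> - m"

lemma barrier_commute: "barrier m x z f \<longleftrightarrow> barrier m z x f"
  by (auto simp: barrier_def)

lemma barrier_translate:
  "g \<in> \<Gamma> \<Longrightarrow> f \<in> \<Gamma> \<Longrightarrow> barrier m (inverse_map g x) (inverse_map g z) f \<longleftrightarrow> barrier m x z (g \<circ> f)"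
  by (simp add: barrier_def inv_comp_distrib)

lemma barrier_exists:
  assumes f: "f \<in> \<Gamma>" and far: "2 * m + 2 * K \<le> \<bar>idx (inverse_map f x) - idx (inverse_map f y)\<bar>"
  shows "\<exists>g\<in>\<Gamma>. barrier m x y g"
proof -
  have *: "\<exists>g\<in>\<Gamma>. barrier m x y g"
    if "idx (inverse_map f x) + 2 * m + 2 * K \<le> idx (inverse_map f y)" for x y
  proof -
    \<comment> \<open>Moving the origin of the axis to \<open>r\<close> gives \<open>x\<close> the
      index \<open>- m - K\<close>, up to the error \<open>K\<close> of
      \<open>idx_pw\<close>.\<close>
    define r where "r = idx (inverse_map f x) + m + K"
    let ?g = "f \<circ> pw r"
    have g: "inverse_map ?g z = pw (- r) (inverse_map f z)" for z
      using f pw_mem by (simp add: inv_comp_distrib pw_inverse)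
    have "idx (inverse_map ?g x) \<le> - m" "m \<le> idx (inverse_map ?g y)"
      using that idx_pw[of "- r" "inverse_map f x"] idx_pw[of "- r" "inverse_map f y"] r_def
      unfolding g by linarith+
    then show ?thesis using f pw_mem comp_mem unfolding barrier_def by blast
  qed
  show ?thesis
  proof (cases "idx (inverse_map f x) \<le> idx (inverse_map f y)")
    case True
    then show ?thesis using * far by auto
  next
    case False
    then show ?thesis using *[of y x] far by (auto simp: barrier_commute)
  qed
qed

text \<open>\<open>K\<close> is the error of \<open>morse_at\<close> at an axis point of index
  \<open>K\<close> or \<open>- K\<close>; the second term is the distance from that point to the
  centre.\<close>

definition barrier_radius :: int where
  "barrier_radius = K + K * (K + 1)"

lemma dist_barrier_centre:
  assumes "f \<in> \<Gamma>" "dist x (f (pw i p)) \<le> K" "\<bar>i\<bar> = K"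
  shows "dist x (f p) \<le> barrier_radius"
proof -
  have "dist (f (pw i p)) (f p) \<le> K * (K + 1)"
    using dist_p_pw[of i] assms(3) dist_act[OF assms(1)] by (simp add: dist_commute)
  then show ?thesis
    using assms(2) dist_triangle[of x "f p" "f (pw i p)"] by (simp add: barrier_radius_def)
qed

text \<open>If the index \<open>Y\<close> of \<open>y\<close> is nonnegative, the geodesic joining
  \<open>y\<close> to the endpoint of index at most \<open>- 2 * K\<close> crosses
  \<open>- K\<close>; otherwise the geodesic to the opposite endpoint crosses \<open>K\<close>. Both
  axis points are close to \<open>f p\<close>, and the margin \<open>2 * K\<close> leaves the
  \<open>K\<close> needed by \<open>morse_at\<close>.\<close>

lemma barrier_dichotomy:
  assumes f: "f \<in> \<Gamma>" and b: "barrier (2 * K) x z f"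
    and \<sigma>: "geodesic_path l \<sigma> x y" and \<tau>: "geodesic_path l' \<tau> y z"
  shows "(\<exists>t. 0 \<le> t \<and> t \<le> l \<and> dist (\<sigma> t) (f p) \<le> barrier_radius) \<or>
    (\<exists>t. 0 \<le> t \<and> t \<le> l' \<and> dist (\<tau> t) (f p) \<le> barrier_radius)"
proof -
  define X Y Z where "X = idx (inverse_map f x)" and "Y = idx (inverse_map f y)" and "Z = idx (inverse_map f z)"
  have "(X + K \<le> - K \<and> - K + K \<le> Y \<or> Y + K \<le> - K \<and> - K + K \<le> X) \<or>
      (X + K \<le> K \<and> K + K \<le> Y \<or> Y + K \<le> K \<and> K + K \<le> X) \<or>
      (Y + K \<le> - K \<and> - K + K \<le> Z \<or> Z + K \<le> - K \<and> - K + K \<le> Y) \<or>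
      (Y + K \<le> K \<and> K + K \<le> Z \<or> Z + K \<le> K \<and> K + K \<le> Y)"
    using b K unfolding barrier_def X_def[symmetric] Z_def[symmetric]
    by (cases "0 \<le> Y") (elim disjE conjE; simp)+
  moreover have "\<exists>t. 0 \<le> t \<and> t \<le> l \<and> dist (\<sigma> t) (f p) \<le> barrier_radius"
    if "X + K \<le> i \<and> i + K \<le> Y \<or> Y + K \<le> i \<and> i + K \<le> X" "\<bar>i\<bar> = K" for i
    using morse_at[OF f \<sigma>, of i] dist_barrier_centre[OF f _ that(2)] that(1) unfolding X_def Y_def by blast
  moreover have "\<exists>t. 0 \<le> t \<and> t \<le> l' \<and> dist (\<tau> t) (f p) \<le> barrier_radius"
    if "Y + K \<le> i \<and> i + K \<le> Z \<or> Z + K \<le> i \<and> i + K \<le> Y" "\<bar>i\<bar> = K" for i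
    using morse_at[OF f \<tau>, of i] dist_barrier_centre[OF f _ that(2)] that(1) unfolding Y_def Z_def by blast
  moreover have "\<bar>K\<bar> = K" "\<bar>- K\<bar> = K" using K by auto
  ultimately show ?thesis by blast
qed

lemma barrier_radius_pos: "0 < barrier_radius"
  using K by (simp add: barrier_radius_def add_pos_nonneg)

text \<open>
  A geodesic cannot backtrack along the axis: it would pass twice near the same point and so
  stay near it in between.
\<close>

lemma no_backtracking:
  assumes f: "f \<in> \<Gamma>" and \<gamma>: "geodesic_path l \<gamma> x y" and st: "0 \<le> s" "s \<le> t" "t \<le> l"
    and m: "5 * K + 3 * (K * K) < m"
    and idx: "idx (inverse_map f (\<gamma> s)) \<le> - m" "m \<le> idx (inverse_map f (\<gamma> t))"
  shows "idx (inverse_map f x) \<le> - (2 * K)"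
proof (rule ccontr)
  assume *: "\<not> ?thesis"
  have KK: "0 \<le> K * K" by simp
  \<comment> \<open>The pieces before and after time \<open>s\<close> both pass within
    \<open>K\<close> of \<open>?q\<close>, so \<open>\<gamma> s\<close> is within
    \<open>3 * K\<close> of it and its index is at least \<open>- (5 * K + 3 * (K * K))\<close>.
    This is the origin of the bound on \<open>m\<close>.\<close>
  let ?q = "f (pw (- 3 * K) p)"
  have path1: "geodesic_path s \<gamma> x (\<gamma> s)"
    using geodesic_path_sub[OF \<gamma>, of 0 s] st geodesic_path_ends[OF \<gamma>] by simp
  have path2: "geodesic_path (t - s) (\<lambda>u. \<gamma> (s + u)) (\<gamma> s) (\<gamma> t)"
    using geodesic_path_sub[OF \<gamma> st] .
  obtain r1 where r1: "0 \<le> r1" "r1 \<le> s" "dist (\<gamma> r1) ?q \<le> K"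
    using morse_at[OF f path1, of "- 3 * K"] * idx m KK K by auto
  obtain r2 where r2: "0 \<le> r2" "r2 \<le> t - s" "dist (\<gamma> (s + r2)) ?q \<le> K"
    using morse_at[OF f path2, of "- 3 * K"] * idx m KK K by auto
  have "dist (\<gamma> r1) (\<gamma> (s + r2)) = s + r2 - r1" "dist (\<gamma> s) (\<gamma> r1) = s - r1"
    using geodesic_path_dist[OF \<gamma>, of r1 "s + r2"] geodesic_path_dist[OF \<gamma>, of s r1] r1 r2 st by auto
  then have "dist (\<gamma> s) ?q \<le> real_of_int (3 * K)"
    using r1 r2 dist_triangle2[of "\<gamma> r1" "\<gamma> (s + r2)" ?q] dist_triangle[of "\<gamma> s" ?q "\<gamma> r1"] by simp
  then have "\<bar>idx (inverse_map f (\<gamma> s)) - idx (pw (- 3 * K) p)\<bar> \<le> K * (3 * K + 1)"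
    using idx_lip_at[OF f, of _ ?q] inv_apply(1)[OF f] by fastforce
  then show False
    using idx_a[of "- 3 * K"] idx m by (simp add: algebra_simps)
qed

lemma no_backtracking':
  assumes f: "f \<in> \<Gamma>" and \<gamma>: "geodesic_path l \<gamma> x y" and st: "0 \<le> s" "s \<le> t" "t \<le> l"
    and m: "5 * K + 3 * (K * K) < m"
    and idx: "idx (inverse_map f (\<gamma> s)) \<le> - m" "m \<le> idx (inverse_map f (\<gamma> t))"
  shows "2 * K \<le> idx (inverse_map f y)"
proof (rule ccontr)
  assume *: "\<not> ?thesis"
  have KK: "0 \<le> K * K" by simp
  let ?q = "f (pw (3 * K) p)"
  have path1: "geodesic_path (l - t) (\<lambda>u. \<gamma> (t + u)) (\<gamma> t) y"
    using geodesic_path_sub[OF \<gamma>, of t l] st geodesic_path_ends[OF \<gamma>] by simp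
  have path2: "geodesic_path (t - s) (\<lambda>u. \<gamma> (s + u)) (\<gamma> s) (\<gamma> t)"
    using geodesic_path_sub[OF \<gamma> st] .
  obtain r1 where r1: "0 \<le> r1" "r1 \<le> l - t" "dist (\<gamma> (t + r1)) ?q \<le> K"
    using morse_at[OF f path1, of "3 * K"] * idx m KK K by auto
  obtain r2 where r2: "0 \<le> r2" "r2 \<le> t - s" "dist (\<gamma> (s + r2)) ?q \<le> K"
    using morse_at[OF f path2, of "3 * K"] * idx m KK K by auto
  have "dist (\<gamma> (t + r1)) (\<gamma> (s + r2)) = t + r1 - (s + r2)" "dist (\<gamma> t) (\<gamma> (t + r1)) = r1"
    using geodesic_path_dist[OF \<gamma>, of "t + r1" "s + r2"] geodesic_path_dist[OF \<gamma>, of t "t + r1"] r1 r2 st by auto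
  then have "dist (\<gamma> t) ?q \<le> real_of_int (3 * K)"
    using r1 r2 dist_triangle2[of "\<gamma> (t + r1)" "\<gamma> (s + r2)" ?q] dist_triangle[of "\<gamma> t" ?q "\<gamma> (t + r1)"] by simp
  then have "\<bar>idx (inverse_map f (\<gamma> t)) - idx (pw (3 * K) p)\<bar> \<le> K * (3 * K + 1)"
    using idx_lip_at[OF f, of _ ?q] inv_apply(1)[OF f] by fastforce
  then show False
    using idx_a[of "3 * K"] idx m by (simp add: algebra_simps)
qed

text \<open>Absence of backtracking makes a long barrier of a subsegment visible from the ends of
  the whole geodesic, with the margin \<open>2 * K\<close> that \<open>barrier_dichotomy\<close>
  requires.\<close>

lemma barrier_extend:
  assumes f: "f \<in> \<Gamma>" and \<gamma>: "geodesic_path l \<gamma> x y" and st: "0 \<le> s" "s \<le> t" "t \<le> l"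
    and m: "5 * K + 3 * (K * K) < m" and b: "barrier m (\<gamma> s) (\<gamma> t) f"
  shows "barrier (2 * K) x y f"
    and "\<exists>r. s \<le> r \<and> r \<le> t \<and> dist (\<gamma> r) (f p) \<le> barrier_radius"
proof -
  consider "idx (inverse_map f (\<gamma> s)) \<le> - m" "m \<le> idx (inverse_map f (\<gamma> t))"
    | "m \<le> idx (inverse_map f (\<gamma> s))" "idx (inverse_map f (\<gamma> t)) \<le> - m"
    using b unfolding barrier_def by blast
  then show "barrier (2 * K) x y f"
  proof cases
    case 1
    then show ?thesis
      using no_backtracking[OF f \<gamma> st m] no_backtracking'[OF f \<gamma> st m] by (simp add: barrier_def)
  next
    case 2
    then show ?thesis
      using no_backtracking[OF f geodesic_path_rev[OF \<gamma>], of "l - t" "l - s"]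
        no_backtracking'[OF f geodesic_path_rev[OF \<gamma>], of "l - t" "l - s"] st m
      by (simp add: barrier_def)
  qed
  have path: "geodesic_path (t - s) (\<lambda>u. \<gamma> (s + u)) (\<gamma> s) (\<gamma> t)"
    using geodesic_path_sub[OF \<gamma> st] .
  have "0 \<le> K * K" by simp
  then have "2 * K \<le> m" using m K by linarith
  then obtain r where "0 \<le> r" "r \<le> t - s" "dist (\<gamma> (s + r)) (f (pw K p)) \<le> K"
    using morse_at[OF f path, of K] b K unfolding barrier_def by auto
  then show "\<exists>r. s \<le> r \<and> r \<le> t \<and> dist (\<gamma> r) (f p) \<le> barrier_radius"
    using dist_barrier_centre[OF f] K by (intro exI[of _ "s + r"]) auto
qed

end

section \<open>Elements without barriers\<close>

context group_axis
begin

definition unbarred_path :: "int \<Rightarrow> real \<Rightarrow> (real \<Rightarrow> 'x) \<Rightarrow> bool" where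
  "unbarred_path m l \<beta> \<longleftrightarrow>
     (\<forall>f\<in>\<Gamma>. \<forall>s t. 0 \<le> s \<longrightarrow> s \<le> t \<longrightarrow> t \<le> l \<longrightarrow> \<not> barrier m (\<beta> s) (\<beta> t) f)"

text \<open>The geodesic only has to end near \<open>p\<close> and \<open>v p\<close>, since it will
  arise by cutting a longer one near the orbit. The length bound \<open>L\<close> is the parameter
  of a later induction.\<close>

definition unbarred_upto :: "real \<Rightarrow> int \<Rightarrow> real \<Rightarrow> ('x \<Rightarrow> 'x) set" where
  "unbarred_upto M m L = {v \<in> \<Gamma>. \<exists>l \<beta> x y. geodesic_path l \<beta> x y \<and> l \<le> L \<and>
     dist p x \<le> M \<and> dist (v p) y \<le> M \<and> unbarred_path m l \<beta>}"

definition unbarred :: "real \<Rightarrow> int \<Rightarrow> ('x \<Rightarrow> 'x) set" where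
  "unbarred M m = (\<Union>L. unbarred_upto M m L)"

lemma unbarred_sub: "unbarred M m \<subseteq> \<Gamma>"
  by (auto simp: unbarred_def unbarred_upto_def)

lemma unbarredE:
  assumes "v \<in> unbarred M m"
  obtains l \<beta> x y where "v \<in> \<Gamma>" "geodesic_path l \<beta> x y" "dist p x \<le> M" "dist (v p) y \<le> M" "unbarred_path m l \<beta>"
  using assms unfolding unbarred_def unbarred_upto_def by blast

lemma unbarred_uptoI:
  "v \<in> \<Gamma> \<Longrightarrow> geodesic_path l \<beta> x y \<Longrightarrow> l \<le> L \<Longrightarrow> dist p x \<le> M \<Longrightarrow> dist (v p) y \<le> M \<Longrightarrow>
    unbarred_path m l \<beta> \<Longrightarrow> v \<in> unbarred_upto M m L"
  unfolding unbarred_upto_def by blast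

lemma unbarred_pathD:
  "unbarred_path m l \<beta> \<Longrightarrow> f \<in> \<Gamma> \<Longrightarrow> 0 \<le> s \<Longrightarrow> s \<le> t \<Longrightarrow> t \<le> l \<Longrightarrow> \<not> barrier m (\<beta> s) (\<beta> t) f"
  by (simp add: unbarred_path_def)

text \<open>Reversing a geodesic reverses the direction of its barriers; this is where the symmetry
  of \<open>barrier\<close> is used.\<close>

lemma unbarred_inverse:
  assumes "v \<in> unbarred M m"
  shows "inverse_map v \<in> unbarred M m"
  using assms
proof (rule unbarredE)
  fix l \<beta> x y
  assume v: "v \<in> \<Gamma>" and \<beta>: "geodesic_path l \<beta> x y" and ends: "dist p x \<le> M" "dist (v p) y \<le> M"
    and nb: "unbarred_path m l \<beta>"
  have path: "geodesic_path l (\<lambda>u. inverse_map v (\<beta> (l - u))) (inverse_map v y) (inverse_map v x)"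
    by (rule geodesic_path_isometry[OF geodesic_path_rev[OF \<beta>], of "inverse_map v"]) (simp add: v)
  have "dist p (inverse_map v y) \<le> M"
    using ends(2) dist_inv_left[OF v, of y p] by (simp add: dist_commute)
  moreover have "dist (inverse_map v p) (inverse_map v x) \<le> M"
    using ends(1) v by simp
  moreover have "\<not> barrier m (inverse_map v (\<beta> (l - s))) (inverse_map v (\<beta> (l - t))) f"
    if "f \<in> \<Gamma>" "0 \<le> s" "s \<le> t" "t \<le> l" for s t f
    unfolding barrier_translate[OF v that(1)]
    using unbarred_pathD[OF nb comp_mem[OF v that(1)], of "l - t" "l - s"] that by (simp add: barrier_commute)
  then have "unbarred_path m l (\<lambda>u. inverse_map v (\<beta> (l - u)))" by (simp add: unbarred_path_def)
  ultimately show ?thesis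
    using unbarred_uptoI[OF inv_mem[OF v] path order_refl] unfolding unbarred_def by blast
qed

text \<open>A larger gap could be recentred by \<open>barrier_exists\<close> into a barrier between
  the ends of the geodesic; the last term accounts for moving these ends to \<open>p\<close> and
  \<open>v p\<close>.\<close>

lemma unbarred_idx:
  assumes v: "v \<in> unbarred M m" and f: "f \<in> \<Gamma>"
  shows "\<bar>idx (inverse_map f p) - idx (inverse_map f (v p))\<bar> < 2 * m + 2 * K + 2 * (K * (\<lceil>M\<rceil> + 1))"
  using v
proof (rule unbarredE)
  fix l \<beta> x y
  assume \<beta>: "geodesic_path l \<beta> x y" and ends: "dist p x \<le> M" "dist (v p) y \<le> M"
    and nb: "unbarred_path m l \<beta>"
  have "\<not> barrier m x y g" if "g \<in> \<Gamma>" for g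
    using unbarred_pathD[OF nb that, of 0 l] geodesic_path_ends[OF \<beta>] by simp
  then have *: "\<bar>idx (inverse_map f x) - idx (inverse_map f y)\<bar> < 2 * m + 2 * K"
    using barrier_exists[OF f, of m x y] by force
  have ends': "dist p x \<le> real_of_int \<lceil>M\<rceil>" "dist (v p) y \<le> real_of_int \<lceil>M\<rceil>"
    using ends by (meson le_of_int_ceiling order_trans)+
  show ?thesis
    using * idx_lip_at[OF f ends'(1)] idx_lip_at[OF f ends'(2)] by linarith
qed

end

section \<open>Ping-pong for elements with short projections to all translates of the axis\<close>

locale short_projections = group_axis +
  fixes V :: "('a \<Rightarrow> 'a) set" and B :: int
  assumes V_sub: "V \<subseteq> \<Gamma>"
    and V_inverse: "v \<in> V \<Longrightarrow> inverse_map v \<in> V"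
    and V_idx: "v \<in> V \<Longrightarrow> f \<in> \<Gamma> \<Longrightarrow> \<bar>idx (inverse_map f p) - idx (inverse_map f (v p))\<bar> < B"
begin

lemma B_pos: "v \<in> V \<Longrightarrow> 0 < B"
  using V_idx[OF _ id_mem] by fastforce

text \<open>A hierarchy of index bounds: \<open>K0\<close> for the points \<open>v p\<close>,
  \<open>K1\<close> for the axis translated by the inverse of a long \<open>v\<close>
  (\<open>axis_projection\<close>), \<open>K2\<close> for words beginning with a long letter
  (\<open>idx_step\<close>).\<close>

definition K0 :: int where "K0 = B + K"
definition K1 :: int where "K1 = K0 + 2 * K"
definition K2 :: int where "K2 = K1 + 2 * K"

lemma idx_v: "v \<in> V \<Longrightarrow> \<bar>idx (v p)\<bar> \<le> K0"
  using V_idx[OF _ id_mem, of v] idx_p by (simp add: K0_def)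

lemma idx_inv_v: "v \<in> V \<Longrightarrow> \<bar>idx (inverse_map v p)\<bar> \<le> K0"
  using idx_v[OF V_inverse] by simp

text \<open>If \<open>axis_projection\<close> fails, \<open>v p\<close> is within
  \<open>r = 2 * K + K * (K0 + K + 1)\<close> of an axis point whose index is at most
  \<open>K0 + K * (r + 1) + K\<close> in absolute value; \<open>R0\<close> is the resulting bound on
  \<open>len v\<close>.\<close>

definition R0 :: int where
  "R0 = K * (K0 + K * (2 * K + K * (K0 + K + 1) + 1) + K + 1) + (2 * K + K * (K0 + K + 1))"

text \<open>
  If the axis had a long projection to its \<open>v\<close>-translate, the two axes would come close to each
  other; by the bounds on the projections of \<open>p\<close> and \<open>v p\<close> they would do so near both of these
  points, which would then be close to each other.
\<close>

lemma axis_projection: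
  assumes v: "v \<in> V" and far: "R0 < len v"
  shows "\<bar>idx (inverse_map v (pw i p))\<bar> \<le> K1"
proof (rule ccontr)
  assume "\<not> ?thesis"
  then have big: "K0 + 2 * K < \<bar>idx (inverse_map v (pw i p))\<bar>" by (simp add: K1_def)
  have v\<Gamma>: "v \<in> \<Gamma>" using v V_sub by auto
  obtain l \<sigma> where \<sigma>: "geodesic_path l \<sigma> p (pw i p)" using geodesic by blast
  \<comment> \<open>An index beyond the range \<open>K0\<close> of \<open>p\<close> seen from
    \<open>v\<close>, on the side of the far projection, leaving margin \<open>K\<close> on either
    side.\<close>
  define j where "j = (if 0 \<le> idx (inverse_map v (pw i p)) then K0 + K else - (K0 + K))"
  have j: "\<bar>j\<bar> = K0 + K" using K B_pos[OF v] by (simp add: j_def K0_def)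
  obtain t where t: "0 \<le> t" "t \<le> l" "dist (\<sigma> t) (v (pw j p)) \<le> K"
  proof -
    have "idx (inverse_map v p) + K \<le> j \<and> j + K \<le> idx (inverse_map v (pw i p)) \<or>
      idx (inverse_map v (pw i p)) + K \<le> j \<and> j + K \<le> idx (inverse_map v p)"
      using big idx_inv_v[OF v] by (auto simp: j_def)
    then show thesis using morse_at[OF v\<Gamma> \<sigma>] that by blast
  qed
  define n where "n = idx (\<sigma> t)"
  define r where "r = 2 * K + K * (K0 + K + 1)"
  have "geodesic_path l \<sigma> (pw 0 p) (pw i p)" using \<sigma> by simp
  from near_axis[OF this t(1,2)] have a: "dist (\<sigma> t) (pw n p) \<le> K" by (simp add: n_def)
  have "dist (v p) (v (pw j p)) \<le> K * (K0 + K + 1)"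
    using dist_p_pw[of j] dist_act[OF v\<Gamma>] j by (simp add: dist_commute)
  then have vn: "dist (v p) (pw n p) \<le> real_of_int r"
    using a t(3) dist_triangle[of "v p" "pw n p" "v (pw j p)"] dist_triangle3[of "v (pw j p)" "pw n p" "\<sigma> t"]
    by (simp add: r_def)
  from idx_lip_int[OF vn] have n: "\<bar>n\<bar> \<le> K0 + K * (r + 1) + K"
    using idx_v[OF v] idx_a[of n] by linarith
  have "real_of_int (K * (\<bar>n\<bar> + 1)) \<le> real_of_int (K * (K0 + K * (r + 1) + K + 1))"
    unfolding of_int_le_iff using n K by (intro mult_left_mono) auto
  then have "len v \<le> real_of_int (K * (K0 + K * (r + 1) + K + 1) + r)"
    using vn dist_p_pw[of n] dist_triangle[of p "v p" "pw n p"] by (simp add: dist_commute)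
  then show False using far by (simp add: R0_def r_def)
qed

definition N0 :: int where "N0 = K1 + K * (K + 1) + K2 + 2 * K + 1"

text \<open>Put \<open>w = inverse_map v\<close> and \<open>y = pw n x\<close>. The axis seen from
  \<open>w\<close> has indices at most \<open>K1\<close>. If \<open>v y\<close> had large index, the
  shortest geodesic from \<open>y\<close> to the axis would therefore pass near the
  \<open>w\<close>-translate of the axis, whose points have index at most \<open>K1\<close>. But
  along that geodesic the index is nearly constant and within \<open>K2 + K\<close> of
  \<open>n\<close>, hence too large.\<close>

lemma idx_step:
  assumes v: "v \<in> V" and far: "R0 < len v" and x: "\<bar>idx x\<bar> \<le> K2" and n: "N0 \<le> \<bar>n\<bar>"
  shows "\<bar>idx (v (pw n x))\<bar> \<le> K2"
proof (rule ccontr)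
  assume "\<not> ?thesis"
  then have big: "K1 + 2 * K < \<bar>idx (v (pw n x))\<bar>" by (simp add: K2_def)
  have v\<Gamma>: "v \<in> \<Gamma>" using v V_sub by auto
  define w where "w = inverse_map v"
  have w: "w \<in> V" "w \<in> \<Gamma>" "inverse_map w = v" "R0 < len w"
    using v v\<Gamma> V_inverse inv_mem far len_inv by (simp_all add: w_def)
  define y where "y = pw n x"
  obtain l \<sigma> where \<sigma>: "geodesic_path l \<sigma> y (pw (idx y) p)" using geodesic by blast
  have K1: "0 \<le> K1" using K B_pos[OF v] by (simp add: K1_def K0_def)
  define j where "j = (if 0 \<le> idx (v y) then K1 + K else - (K1 + K))"
  obtain t where t: "0 \<le> t" "t \<le> l" "dist (\<sigma> t) (w (pw j p)) \<le> K"
  proof -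
    have "\<bar>idx (v (pw (idx y) p))\<bar> \<le> K1" using axis_projection[OF w(1,4)] w(3) by simp
    then have "idx (inverse_map w y) + K \<le> j \<and> j + K \<le> idx (inverse_map w (pw (idx y) p)) \<or>
      idx (inverse_map w (pw (idx y) p)) + K \<le> j \<and> j + K \<le> idx (inverse_map w y)"
      using big K unfolding w(3) by (auto simp: j_def y_def)
    then show thesis using morse_at[OF w(2) \<sigma>] that by blast
  qed
  have "\<bar>idx (w (pw j p))\<bar> \<le> K1" using axis_projection[OF v far, of j] by (simp add: w_def)
  then have "\<bar>idx y\<bar> \<le> K1 + K * (K + 1) + K"
    using idx_lip_int[OF t(3)] idx_perp[OF \<sigma> t(1,2)] by linarith
  then show False using idx_pw[of n x] x n by (simp add: y_def N0_def)
qed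

definition R1 :: int where
  "R1 = 2 * (K * (B + K0 + K + 1)) + 4 * K + 2 * (K * (K0 + K + 1))"

definition N1 :: int where "N1 = N0 + B + K0 + 2 * K + K2 + K"

text \<open>The common endpoint \<open>q\<close> lies far along both translated axes because
  \<open>N1\<close> is large. Hence \<open>[p, q]\<close> passes near \<open>v' p\<close> and
  \<open>[v' p, q]\<close> passes near \<open>v p\<close>. Comparing lengths,
  \<open>dist (v p) (v' p)\<close> is at most \<open>len v - len v'\<close> up to a
  constant.\<close>

lemma first_letter_aux:
  assumes v: "v \<in> V" "R0 < len v" and v': "v' \<in> V" "R0 < len v'"
    and z: "\<bar>idx z\<bar> \<le> K2" "\<bar>idx z'\<bar> \<le> K2" and eq: "v (pw N1 z) = v' (pw N1 z')"
    and le: "len v \<le> len v'"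
  shows "dist (v p) (v' p) \<le> R1"
proof -
  have in\<Gamma>: "v \<in> \<Gamma>" "v' \<in> \<Gamma>" using v v' V_sub by auto
  have B: "0 < B" by (rule B_pos[OF v(1)])
  have K1: "0 \<le> K1" "0 \<le> K2" "0 \<le> K * K" using K B by (auto simp: K1_def K0_def K2_def)
  define q where "q = v (pw N1 z)"
  have iq: "N1 - K2 - K \<le> idx (inverse_map v q)" "N1 - K2 - K \<le> idx (inverse_map v' q)"
    using idx_pw[of N1 z] idx_pw[of N1 z'] z inv_apply(1)[OF in\<Gamma>(1)] inv_apply(1)[OF in\<Gamma>(2)]
    by (simp_all add: q_def) (simp add: eq)
  have N1: "B + K0 + 2 * K + K2 + K \<le> N1"
    using K1 K by (simp add: N1_def N0_def algebra_simps)
  define r where "r = B + K0 + K"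
  define r' where "r' = K0 + K"
  have ivv': "idx (inverse_map v (v' p)) < B + K0"
    using V_idx[OF v'(1) in\<Gamma>(1)] idx_inv_v[OF v(1)] by linarith
  obtain l \<tau> where \<tau>: "geodesic_path l \<tau> (v' p) q" using geodesic by blast
  obtain l' \<sigma> where \<sigma>: "geodesic_path l' \<sigma> p q" using geodesic by blast
  obtain t where t: "0 \<le> t" "t \<le> l" "dist (\<tau> t) (v (pw r p)) \<le> K"
    using morse_at[OF in\<Gamma>(1) \<tau>, of r] ivv' iq N1 unfolding r_def by auto
  have iv': "idx (inverse_map v' p) \<le> K0" using idx_inv_v[OF v'(1)] by linarith
  obtain t' where t': "0 \<le> t'" "t' \<le> l'" "dist (\<sigma> t') (v' (pw r' p)) \<le> K"
    using morse_at[OF in\<Gamma>(2) \<sigma>, of r'] iv' iq N1 B unfolding r'_def by auto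
  have r0: "0 \<le> r" "0 \<le> r'" using B K by (auto simp: r_def r'_def K0_def)
  have d: "dist (v p) (v (pw r p)) \<le> K * (r + 1)" "dist (v' p) (v' (pw r' p)) \<le> K * (r' + 1)"
    using dist_p_pw[of r] dist_p_pw[of r'] r0 dist_act[OF in\<Gamma>(1)] dist_act[OF in\<Gamma>(2)]
    by simp_all
  have "dist (v p) (v' p) \<le> 2 * (K * (r + 1)) + 4 * K + 2 * (K * (r' + 1))"
    using geodesic_path_near[OF \<tau> t] geodesic_path_near[OF \<sigma> t'] d le
      dist_triangle[of p q "v (pw r p)"] dist_triangle[of p "v (pw r p)" "v p"]
      dist_triangle2[of p "v' p" "v' (pw r' p)"] dist_triangle[of "v' p" q "v' (pw r' p)"]
      dist_triangle2[of "v p" "v' p" "v (pw r p)"]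
    by linarith
  then show ?thesis by (simp add: R1_def r_def r'_def)
qed

lemma first_letter:
  assumes "v \<in> V" "R0 < len v" "v' \<in> V" "R0 < len v'"
    and "\<bar>idx z\<bar> \<le> K2" "\<bar>idx z'\<bar> \<le> K2" and "v (pw N1 z) = v' (pw N1 z')"
  shows "dist (v p) (v' p) \<le> R1"
  using first_letter_aux[OF assms] first_letter_aux[OF assms(3,4,1,2,6,5) assms(7)[symmetric]]
  by (cases "len v \<le> len v'") (auto simp: dist_commute)

end

text \<open>Zorn's lemma; \<open>d\<close> is abstract because the distance of orbit points is only
  a pseudometric on group elements.\<close>

lemma maximal_separated_subset:
  fixes d :: "'a \<Rightarrow> 'a \<Rightarrow> real"
  assumes sym: "\<And>a b. d a b = d b a" and refl: "\<And>a. d a a \<le> r"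
  shows "\<exists>S\<subseteq>A. (\<forall>s\<in>S. \<forall>t\<in>S. d s t \<le> r \<longrightarrow> s = t) \<and> (\<forall>a\<in>A. \<exists>s\<in>S. d s a \<le> r)"
proof -
  let ?P = "{S. S \<subseteq> A \<and> (\<forall>s\<in>S. \<forall>t\<in>S. d s t \<le> r \<longrightarrow> s = t)}"
  have "\<Union> \<C> \<in> ?P" if chain: "subset.chain ?P \<C>" for \<C>
  proof -
    have sub: "\<C> \<subseteq> ?P" and lin: "\<forall>X\<in>\<C>. \<forall>Y\<in>\<C>. X \<subseteq> Y \<or> Y \<subseteq> X"
      using conjunct1[OF chain[unfolded subset_chain_def]] conjunct2[OF chain[unfolded subset_chain_def]] .
    have "s = t" if st: "s \<in> \<Union> \<C>" "t \<in> \<Union> \<C>" "d s t \<le> r" for s t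
    proof -
      obtain X where X: "X \<in> \<C>" "s \<in> X" using st(1) by (rule UnionE)
      obtain Y where Y: "Y \<in> \<C>" "t \<in> Y" using st(2) by (rule UnionE)
      have "\<exists>Z. Z \<in> \<C> \<and> s \<in> Z \<and> t \<in> Z"
        using bspec[OF bspec[OF lin X(1)] Y(1)]
      proof
        assume "X \<subseteq> Y"
        then show ?thesis using X Y by (intro exI[of _ Y]) auto
      next
        assume "Y \<subseteq> X"
        then show ?thesis using X Y by (intro exI[of _ X]) auto
      qed
      then obtain Z where Z: "Z \<in> \<C>" "s \<in> Z" "t \<in> Z" by (elim exE conjE)
      have "Z \<in> ?P" using sub Z(1) by (rule subsetD)
      then show ?thesis using Z st(3) by simp
    qed
    moreover have "\<Union> \<C> \<subseteq> A" using sub by (intro Union_least) auto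
    ultimately show ?thesis by (intro CollectI conjI ballI impI)
  qed
  then have "\<exists>S\<in>?P. \<forall>X\<in>?P. S \<subseteq> X \<longrightarrow> X = S" by (rule subset_Zorn')
  then obtain S where S: "S \<in> ?P" and max: "\<forall>X\<in>?P. S \<subseteq> X \<longrightarrow> X = S" by (elim bexE)
  have "\<exists>s\<in>S. d s a \<le> r" if "a \<in> A" for a
  proof (rule ccontr)
    assume *: "\<not> ?thesis"
    have "r < d a s" "r < d s a" if "s \<in> S" for s using * that sym[of a s] by (auto simp: not_le)
    then have "insert a S \<in> ?P" using S \<open>a \<in> A\<close> by (auto simp: not_le[symmetric])
    then have "insert a S = S" using max by (meson subset_insertI)
    then show False using * refl[of a] by auto
  qed
  moreover have "S \<subseteq> A" "\<forall>s\<in>S. \<forall>t\<in>S. d s t \<le> r \<longrightarrow> s = t" using S by simp_all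
  ultimately show ?thesis by blast
qed

context proper_isometric_action
begin

text \<open>The terms increase as \<open>s\<close> decreases to \<omega>, so by monotone convergence
  a series divergent at \<omega> is already arbitrarily large slightly above it.\<close>

lemma poincare_series_right_continuous:
  assumes "0 \<le> \<omega>" and inf: "poincare_series p A \<omega> = \<infinity>" and c: "c < \<infinity>"
  shows "\<exists>s>\<omega>. s \<le> \<omega> + 1 \<and> c < poincare_series p A s"
proof -
  define s where "s n = \<omega> + 1 / real (Suc n)" for n
  define f where "f n g = ennreal (exp (- s n * len g))" for n g
  have s_mono: "s j \<le> s i" if "i \<le> j" for i j
    using that by (simp add: s_def frac_le)
  have "incseq f"
  proof (intro incseq_SucI le_funI)
    fix n g
    have "s (Suc n) * len g \<le> s n * len g" by (intro mult_right_mono s_mono) auto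
    then show "f n g \<le> f (Suc n) g" unfolding f_def by (intro ennreal_leI) simp
  qed
  have "(SUP n. f n g) = ennreal (exp (- \<omega> * len g))" for g
  proof (rule LIMSEQ_unique[OF LIMSEQ_SUP])
    show "incseq (\<lambda>n. f n g)" using \<open>incseq f\<close> by (auto simp: incseq_def le_fun_def)
    have "(\<lambda>n. 1 / real (Suc n)) \<longlonglongrightarrow> 0" by (rule LIMSEQ_inverse_real_of_nat[unfolded inverse_eq_divide])
    then have "s \<longlonglongrightarrow> \<omega>" unfolding s_def using tendsto_add[OF tendsto_const, of _ 0] by fastforce
    then show "(\<lambda>n. f n g) \<longlonglongrightarrow> ennreal (exp (- \<omega> * len g))"
      unfolding f_def by (intro tendsto_ennrealI tendsto_exp tendsto_mult tendsto_minus tendsto_const)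
  qed
  then have "poincare_series p A \<omega> = (\<integral>\<^sup>+g. (SUP n. f n g) \<partial>count_space A)"
    by (simp add: poincare_series_def)
  also have "\<dots> = (SUP n. \<integral>\<^sup>+g. f n g \<partial>count_space A)"
    using \<open>incseq f\<close> by (intro nn_integral_monotone_convergence_SUP) auto
  also have "\<dots> = (SUP n. poincare_series p A (s n))"
    by (simp add: poincare_series_def f_def)
  finally have "c < (SUP n. poincare_series p A (s n))" using inf c by simp
  then obtain n where "c < poincare_series p A (s n)" by (auto simp: less_SUP_iff)
  moreover have "\<omega> < s n" "s n \<le> \<omega> + 1" by (auto simp: s_def)
  ultimately show ?thesis by blast
qed

end

section \<open>The free semigroup generated by separated letters and an axis power\<close>

context short_projections
begin

primrec words :: "('a \<Rightarrow> 'a) set \<Rightarrow> nat \<Rightarrow> ('a \<Rightarrow> 'a) set" where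
  "words S 0 = {id}"
| "words S (Suc n) = (\<lambda>z. fst z \<circ> (pw N1 \<circ> snd z)) ` (S \<times> words S n)"

text \<open>The second alternative covers empty \<open>S\<close>: without a letter there is no
  positivity of \<open>B\<close>, hence no bound on \<open>idx p\<close> by
  \<open>K2\<close>.\<close>

lemma words_props:
  assumes S: "\<And>v. v \<in> S \<Longrightarrow> v \<in> V \<and> R0 < len v" and r: "r \<in> words S n"
  shows "r \<in> \<Gamma> \<and> \<bar>idx (r p)\<bar> \<le> K2 \<or> S = {} \<and> r \<in> \<Gamma>"
  using r
proof (induction n arbitrary: r)
  case 0
  have "\<bar>idx p\<bar> \<le> K2" if "v \<in> S" for v
    using idx_p B_pos[of v] S[OF that] K by (simp add: K2_def K1_def K0_def)
  moreover have "r = id" using 0 by simp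
  ultimately show ?case using id_mem by (metis equals0I id_apply)
next
  case (Suc n)
  then obtain v r' where v: "v \<in> S" and r': "r' \<in> words S n" "r = v \<circ> (pw N1 \<circ> r')" by auto
  have B: "0 < B" using B_pos S[OF v] by blast
  have IH: "r' \<in> \<Gamma>" "\<bar>idx (r' p)\<bar> \<le> K2" using Suc.IH[OF r'(1)] v by auto
  have "N0 \<le> \<bar>N1\<bar>" using B K by (simp add: N1_def K2_def K1_def K0_def)
  then have "\<bar>idx (r p)\<bar> \<le> K2" using idx_step[of v "r' p" N1] S[OF v] IH by (simp add: r'(2))
  moreover have "r \<in> \<Gamma>" using r'(2) IH S[OF v] V_sub pw_mem comp_mem by auto
  ultimately show ?case by simp
qed

text \<open>A product determines the orbit point of its first letter up to \<open>R1\<close> by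
  \<open>first_letter\<close>, hence the letter itself in a separated set.\<close>

lemma words_inj:
  assumes S: "\<And>v. v \<in> S \<Longrightarrow> v \<in> V \<and> R0 < len v"
    and sep: "\<And>v v'. v \<in> S \<Longrightarrow> v' \<in> S \<Longrightarrow> dist (v p) (v' p) \<le> R1 \<Longrightarrow> v = v'"
  shows "inj_on (\<lambda>z. fst z \<circ> (pw N1 \<circ> snd z)) (S \<times> words S n)"
proof (rule inj_onI, clarsimp)
  fix v r v' r'
  assume v: "v \<in> S" "v' \<in> S" and r: "r \<in> words S n" "r' \<in> words S n"
    and eq: "v \<circ> (pw N1 \<circ> r) = v' \<circ> (pw N1 \<circ> r')"
  have idx: "\<bar>idx (r p)\<bar> \<le> K2" "\<bar>idx (r' p)\<bar> \<le> K2"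
    using words_props[OF S r(1)] words_props[OF S r(2)] v by auto
  have "v (pw N1 (r p)) = v' (pw N1 (r' p))" using fun_cong[OF eq, of p] by simp
  then have "v = v'" using first_letter[of v v'] S[OF v(1)] S[OF v(2)] idx sep v by blast
  moreover have "r x = r' x" for x
  proof -
    have "v (pw N1 (r x)) = v (pw N1 (r' x))" using fun_cong[OF eq, of x] \<open>v = v'\<close> by simp
    moreover have "v \<in> \<Gamma>" using S[OF v(1)] V_sub by auto
    ultimately have "pw N1 (r x) = pw N1 (r' x)" using inv_apply(1) by metis
    then show ?thesis using inv_apply(1)[OF pw_mem] by metis
  qed
  ultimately show "v = v' \<and> r = r'" by auto
qed

text \<open>Lengths are subadditive and words are distinct, so powers of the series of the letters
  are bounded by series over subsets of the group.\<close>

lemma poincare_series_words: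
  assumes S: "\<And>v. v \<in> S \<Longrightarrow> v \<in> V \<and> R0 < len v"
    and sep: "\<And>v v'. v \<in> S \<Longrightarrow> v' \<in> S \<Longrightarrow> dist (v p) (v' p) \<le> R1 \<Longrightarrow> v = v'"
    and s: "0 \<le> s"
  shows "(poincare_series p S s * ennreal (exp (- s * len (pw N1)))) ^ n \<le> poincare_series p (words S n) s"
proof (induction n)
  case 0
  show ?case by (simp add: poincare_series_def nn_integral_count_space_finite)
next
  case (Suc n)
  let ?c = "ennreal (exp (- s * len (pw N1)))"
  have S\<Gamma>: "S \<subseteq> \<Gamma>" "words S n \<subseteq> \<Gamma>" using S V_sub words_props[OF S] by blast+
  have "(poincare_series p S s * ?c) ^ Suc n \<le> poincare_series p S s * ?c * poincare_series p (words S n) s"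
    using Suc.IH by (simp add: mult_left_mono)
  also have "\<dots> = (\<integral>\<^sup>+v. ennreal (exp (- s * len v)) * ?c \<partial>count_space S) *
      (\<integral>\<^sup>+r. ennreal (exp (- s * len r)) \<partial>count_space (words S n))"
    by (simp add: poincare_series_def nn_integral_multc)
  also have "\<dots> = (\<integral>\<^sup>+z. ennreal (exp (- s * len (fst z))) * ?c * ennreal (exp (- s * len (snd z)))
      \<partial>count_space (S \<times> words S n))"
    using countable_subset[OF S\<Gamma>(1) countable_G] countable_subset[OF S\<Gamma>(2) countable_G]
    by (intro count_sum_Times[symmetric])
  also have "\<dots> \<le> (\<integral>\<^sup>+z. ennreal (exp (- s * len (fst z \<circ> (pw N1 \<circ> snd z)))) \<partial>count_space (S \<times> words S n))"
  proof (intro count_sum_mono, clarify)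
    fix v r assume "v \<in> S" "r \<in> words S n"
    then have "len (v \<circ> (pw N1 \<circ> r)) \<le> len v + len (pw N1) + len r"
      using len_comp[of v "pw N1 \<circ> r"] len_comp[OF pw_mem, of N1 r] S\<Gamma> by force
    then have "s * len (v \<circ> (pw N1 \<circ> r)) \<le> s * (len v + len (pw N1) + len r)"
      using s by (rule mult_left_mono)
    then have "exp (- s * len v) * exp (- s * len (pw N1)) * exp (- s * len r) \<le> exp (- s * len (v \<circ> (pw N1 \<circ> r)))"
      by (simp add: exp_add[symmetric] algebra_simps)
    then show "ennreal (exp (- s * len (fst (v, r)))) * ?c * ennreal (exp (- s * len (snd (v, r))))
      \<le> ennreal (exp (- s * len (fst (v, r) \<circ> (pw N1 \<circ> snd (v, r)))))"
      by (simp add: ennreal_mult'[symmetric] del: comp_apply)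
  qed
  also have "\<dots> = poincare_series p (words S (Suc n)) s"
    unfolding poincare_series_def words.simps
    by (rule nn_integral_bij_count_space) (rule inj_on_imp_bij_betw[OF words_inj[OF S sep]])
  finally show ?case .
qed

text \<open>Divergence at \<omega> would pass to a separated set of long letters and make the base
  of \<open>poincare_series_words\<close> at least 2 for some \<open>s > \<omega>\<close>; the
  series of \<Gamma> at \<open>s\<close> would then exceed every power of 2.\<close>

theorem poincare_series_V_finite:
  assumes \<omega>: "0 \<le> \<omega>" and fin: "\<And>s. \<omega> < s \<Longrightarrow> poincare_series p \<Gamma> s < \<infinity>"
  shows "poincare_series p V \<omega> < \<infinity>"
proof (rule ccontr)
  assume "\<not> ?thesis"
  then have inf: "poincare_series p V \<omega> = \<infinity>" by (simp add: not_less top_unique)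
  then have "V \<noteq> {}" by (auto simp: poincare_series_def nn_integral_count_space_finite)
  then have B: "0 < B" using B_pos by blast
  then have R1: "0 \<le> R1" using K by (simp add: R1_def K0_def)
  define V' where "V' = {v \<in> V. R0 < len v}"
  have "V' \<union> {v \<in> V. len v \<le> R0} = V" by (auto simp: V'_def)
  moreover have "poincare_series p (V' \<union> {v \<in> V. len v \<le> R0}) \<omega> \<le>
      poincare_series p V' \<omega> + poincare_series p {v \<in> V. len v \<le> R0} \<omega>"
    unfolding poincare_series_def by (rule count_sum_Un_le)
  ultimately have "poincare_series p V \<omega> \<le> poincare_series p V' \<omega> + poincare_series p {v \<in> V. len v \<le> R0} \<omega>"
    by simp
  moreover have "poincare_series p {v \<in> V. len v \<le> R0} \<omega> < \<infinity>"
    using V_sub by (intro poincare_series_finite_set[of _ R0]) auto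
  ultimately have V': "poincare_series p V' \<omega> = \<infinity>" using inf by (auto simp: top_unique top.not_eq_extremum)
  define d where "d v w = dist (v p) (w p)" for v w :: "'a \<Rightarrow> 'a"
  have "\<exists>S\<subseteq>V'. (\<forall>s\<in>S. \<forall>t\<in>S. d s t \<le> R1 \<longrightarrow> s = t) \<and> (\<forall>a\<in>V'. \<exists>s\<in>S. d s a \<le> R1)"
    by (rule maximal_separated_subset) (use R1 in \<open>simp_all add: d_def dist_commute\<close>)
  then obtain S where S: "S \<subseteq> V'" and sep': "\<forall>s\<in>S. \<forall>t\<in>S. d s t \<le> R1 \<longrightarrow> s = t"
    and net: "\<forall>a\<in>V'. \<exists>s\<in>S. d s a \<le> R1"
    by (elim exE conjE)
  have sep: "v = v'" if "v \<in> S" "v' \<in> S" "dist (v p) (v' p) \<le> R1" for v v'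
    using sep' that by (simp add: d_def)
  have S\<Gamma>: "S \<subseteq> \<Gamma>" using S V_sub by (auto simp: V'_def)
  define F where "F = {q \<in> \<Gamma>. len q \<le> R1}"
  \<comment> \<open>The net property writes \<open>V'\<close> as \<open>S\<close> times a finite
    ball, so divergence is inherited by \<open>S\<close>.\<close>
  have "V' \<subseteq> (\<lambda>z. fst z \<circ> snd z) ` (S \<times> F)"
  proof
    fix v assume v: "v \<in> V'"
    then obtain u where u: "u \<in> S" "dist (u p) (v p) \<le> R1"
      using bspec[OF net v] unfolding d_def by (elim bexE)
    have u\<Gamma>: "u \<in> \<Gamma>" and v\<Gamma>: "v \<in> \<Gamma>" using u S\<Gamma> v V_sub by (auto simp: V'_def)
    have "v = u \<circ> (inverse_map u \<circ> v)" using inv_comp(2)[OF u\<Gamma>] by (simp add: comp_assoc[symmetric])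
    moreover have "inverse_map u \<circ> v \<in> F"
      using u(2) dist_inv_left[OF u\<Gamma>, of "v p" p] inv_mem[OF u\<Gamma>] v\<Gamma> comp_mem
      by (simp add: F_def dist_commute)
    ultimately show "v \<in> (\<lambda>z. fst z \<circ> snd z) ` (S \<times> F)"
      using u(1) by (intro image_eqI[where x = "(u, inverse_map u \<circ> v)"]) simp_all
  qed
  then have "poincare_series p V' \<omega> \<le> (\<integral>\<^sup>+z. ennreal (exp (- \<omega> * len (fst z \<circ> snd z))) \<partial>count_space (S \<times> F))"
    unfolding poincare_series_def by (rule count_sum_le_cover)
  also have "\<dots> \<le> (\<integral>\<^sup>+z. ennreal (exp (- \<omega> * len (fst z))) * ennreal (exp (\<omega> * R1)) \<partial>count_space (S \<times> F))"
  proof (intro count_sum_mono, clarify)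
    fix u q assume "u \<in> S" "q \<in> F"
    then have "u \<in> \<Gamma>" "len q \<le> R1" using S\<Gamma> by (auto simp: F_def)
    then have "len u - R1 \<le> len (u \<circ> q)"
      using dist_triangle[of p "u p" "u (q p)"] dist_act[of u "q p" p] by (simp add: dist_commute)
    then have "\<omega> * (len u - R1) \<le> \<omega> * len (u \<circ> q)" using \<omega> by (rule mult_left_mono)
    then have "exp (- \<omega> * len (u \<circ> q)) \<le> exp (- \<omega> * len u) * exp (\<omega> * R1)"
      by (simp add: exp_add[symmetric] algebra_simps)
    then show "ennreal (exp (- \<omega> * len (fst (u, q) \<circ> snd (u, q)))) \<le>
      ennreal (exp (- \<omega> * len (fst (u, q)))) * ennreal (exp (\<omega> * R1))"
      by (simp add: ennreal_mult'[symmetric] ennreal_leI del: comp_apply)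
  qed
  also have "\<dots> = poincare_series p S \<omega> * (\<integral>\<^sup>+q. ennreal (exp (\<omega> * R1)) \<partial>count_space F)"
    unfolding poincare_series_def
    by (rule count_sum_Times) (auto simp: F_def intro: countable_subset[OF S\<Gamma> countable_G] countable_finite finite_ball)
  finally have "poincare_series p S \<omega> * (\<integral>\<^sup>+q. ennreal (exp (\<omega> * R1)) \<partial>count_space F) = \<infinity>"
    using V' by (simp add: top_unique)
  moreover have "(\<integral>\<^sup>+q. ennreal (exp (\<omega> * R1)) \<partial>count_space F) < \<infinity>"
    using finite_ball by (simp add: F_def nn_integral_count_space_finite ennreal_mult_less_top of_nat_less_top)
  ultimately have Sinf: "poincare_series p S \<omega> = \<infinity>"
    by (auto simp: ennreal_mult_eq_top_iff)
  \<comment> \<open>The threshold compensates the weight of the separator \<open>pw N1\<close> for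
    every exponent up to \<open>\<omega> + 1\<close> and leaves a factor 2.\<close>
  obtain s where s: "\<omega> < s" "s \<le> \<omega> + 1" and big: "ennreal (2 * exp ((\<omega> + 1) * len (pw N1))) < poincare_series p S s"
    using poincare_series_right_continuous[OF \<omega> Sinf, of "ennreal (2 * exp ((\<omega> + 1) * len (pw N1)))"] by auto
  let ?b = "poincare_series p S s * ennreal (exp (- s * len (pw N1)))"
  have "2 \<le> ennreal (2 * exp ((\<omega> + 1) * len (pw N1))) * ennreal (exp (- s * len (pw N1)))"
  proof -
    have "s * len (pw N1) \<le> (\<omega> + 1) * len (pw N1)" using s by (intro mult_right_mono) auto
    then have "1 \<le> exp ((\<omega> + 1) * len (pw N1)) * exp (- s * len (pw N1))"
      by (simp add: exp_add[symmetric])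
    then have "2 \<le> 2 * exp ((\<omega> + 1) * len (pw N1)) * exp (- s * len (pw N1))" by simp
    then have "ennreal 2 \<le> ennreal (2 * exp ((\<omega> + 1) * len (pw N1)) * exp (- s * len (pw N1)))"
      by (rule ennreal_leI)
    then show ?thesis by (simp add: ennreal_mult'[symmetric])
  qed
  also have "\<dots> \<le> ?b" using big by (intro mult_right_mono) (auto intro: less_imp_le)
  finally have b: "2 \<le> ?b" .
  have le: "2 ^ n \<le> poincare_series p \<Gamma> s" for n
  proof -
    have S': "v \<in> V \<and> R0 < len v" if "v \<in> S" for v using S that by (auto simp: V'_def)
    have "2 ^ n \<le> ?b ^ n" using b by (rule power_mono) simp
    also have "\<dots> \<le> poincare_series p (words S n) s"
      using \<omega> s by (intro poincare_series_words S' sep) auto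
    also have "\<dots> \<le> poincare_series p \<Gamma> s"
      unfolding poincare_series_def using words_props[OF S'] by (intro count_sum_mono_set) blast
    finally show ?thesis .
  qed
  have "poincare_series p \<Gamma> s = \<infinity>"
  proof (rule ccontr)
    assume "poincare_series p \<Gamma> s \<noteq> \<infinity>"
    then obtain x where x: "0 \<le> x" "poincare_series p \<Gamma> s = ennreal x" by (cases "poincare_series p \<Gamma> s") auto
    obtain n where "x < 2 ^ n" using real_arch_pow[of 2 x] by auto
    moreover have "ennreal (2 ^ n) \<le> ennreal x" using le[of n] x by (simp add: ennreal_power[symmetric])
    ultimately show False using x by simp
  qed
  then show False using fin[OF s(1)] by simp
qed

end

context group_axis
begin

lemma poincare_series_unbarred_finite:
  assumes "0 \<le> \<omega>" "\<And>s. \<omega> < s \<Longrightarrow> poincare_series p \<Gamma> s < \<infinity>"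
  shows "poincare_series p (unbarred M m) \<omega> < \<infinity>"
proof -
  interpret short_projections \<Gamma> p pw idx K "unbarred M m" "2 * m + 2 * K + 2 * (K * (\<lceil>M\<rceil> + 1))"
    by unfold_locales (use unbarred_sub unbarred_inverse unbarred_idx in auto)
  show ?thesis by (rule poincare_series_V_finite[OF assms])
qed

end

section \<open>Excursions from the orbit\<close>

context proper_isometric_action
begin

text \<open>Only finitely many group elements bring \<open>p\<close> within \<open>r + 1\<close> of
  \<open>x\<close>, so the infimum is attained.\<close>

lemma near_orbit:
  assumes "infdist x (orbit_of p G) \<le> r"
  shows "\<exists>f\<in>G. dist x (f p) \<le> r"
proof (rule ccontr)
  assume far: "\<not> ?thesis"
  define F where "F = {g \<in> G. dist x (g p) \<le> r + 1}"
  have F: "finite F" unfolding F_def by (rule finite_near)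
  define m where "m = Min (insert (r + 1) ((\<lambda>g. dist x (g p)) ` F))"
  have "r < m" unfolding m_def using F far by (auto simp: F_def)
  moreover have "m \<le> dist x q" if q: "q \<in> orbit_of p G" for q
  proof -
    obtain g where g: "g \<in> G" "q = g p" using q by blast
    show ?thesis
    proof (cases "g \<in> F")
      case True
      then show ?thesis unfolding m_def g(2) using F by (intro Min_le) auto
    next
      case False
      then have "r + 1 \<le> dist x q" using g by (auto simp: F_def)
      moreover have "m \<le> r + 1" unfolding m_def using F by (intro Min_le) auto
      ultimately show ?thesis by linarith
    qed
  qed
  then have "m \<le> infdist x (orbit_of p G)"
    using id_mem by (subst infdist_notempty) (auto intro!: cINF_greatest)
  ultimately show False using assms by linarith
qed

lemma infdist_orbit_inv:
  assumes g: "g \<in> G" and "infdist (inverse_map g x) (orbit_of p G) \<le> r"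
  shows "infdist x (orbit_of p G) \<le> r"
proof -
  obtain f where f: "f \<in> G" "dist (inverse_map g x) (f p) \<le> r" using near_orbit[OF assms(2)] by blast
  have "infdist x (orbit_of p G) \<le> dist x ((g \<circ> f) p)"
    using comp_mem[OF g f(1)] by (intro infdist_le) blast
  also have "\<dots> \<le> r" using f(2) dist_inv_left[OF g] by simp
  finally show ?thesis .
qed

lemma barrier_freeI:
  assumes g: "g \<in> G" "g' \<in> G" and \<beta>: "geodesic_path l \<beta> x y" and st: "0 \<le> s" "s \<le> t" "t \<le> l"
    and near: "dist (g p) (\<beta> s) \<le> M2" "dist (g' p) (\<beta> t) \<le> M2"
    and far: "\<And>u. s < u \<Longrightarrow> u < t \<Longrightarrow> M1 < infdist (\<beta> u) (orbit_of p G)"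
  shows "inverse_map g \<circ> g' \<in> barrier_free p G M1 M2"
proof -
  let ?\<gamma> = "\<lambda>u. inverse_map g (\<beta> (s + u))"
  have path: "geodesic_path (t - s) ?\<gamma> (inverse_map g (\<beta> s)) (inverse_map g (\<beta> t))"
    by (rule geodesic_path_isometry[OF geodesic_path_sub[OF \<beta> st], of "inverse_map g"]) (simp add: g)
  have "infdist (?\<gamma> 0) {p} \<le> M2"
    using near(1) dist_inv_left[OF g(1), of "\<beta> s" p] by (simp add: dist_commute)
  moreover have "infdist (?\<gamma> (t - s)) {(inverse_map g \<circ> g') p} \<le> M2"
    using near(2) g(1) by (simp add: dist_commute)
  moreover have "?\<gamma> ` {0<..<t - s} \<inter> nbhd M1 (orbit_of p G) = {}"
  proof -
    have "\<not> infdist (?\<gamma> u) (orbit_of p G) \<le> M1" if "0 < u" "u < t - s" for u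
      using infdist_orbit_inv[OF g(1), of "\<beta> (s + u)" M1] far[of "s + u"] that by fastforce
    then show ?thesis by (auto simp: nbhd_def)
  qed
  moreover have "geodesic_on {0..t - s} ?\<gamma>" "0 \<le> t - s" using path by (auto simp: geodesic_path_def)
  moreover have "inverse_map g \<circ> g' \<in> G" using g inv_mem comp_mem by blast
  ultimately show ?thesis
    unfolding barrier_free_def nbhd_def by blast
qed

text \<open>\<open>(s, t)\<close> is the gap around \<open>\<tau>\<close> in the closed set
  \<open>T\<close> of times close to the orbit, with \<open>0\<close> and \<open>l\<close> added; it
  is empty if \<open>\<tau>\<close> is in \<open>T\<close>. At a time in \<open>T\<close> an orbit
  point is at hand, at \<open>0\<close> and \<open>l\<close> the given ones serve. Fixing
  \<open>g' = f1\<close> at \<open>t = l\<close> matters when a cut consumes the whole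
  geodesic.\<close>

lemma excursion:
  assumes \<beta>: "geodesic_path l \<beta> x y" and f: "f0 \<in> G" "f1 \<in> G"
    and ends: "dist (f0 p) x \<le> M2" "dist (f1 p) y \<le> M2" and M: "M1 \<le> M2"
    and \<tau>: "0 \<le> \<tau>" "\<tau> \<le> l"
  obtains s t g g' where "0 \<le> s" "s \<le> \<tau>" "\<tau> \<le> t" "t \<le> l" "g \<in> G" "g' \<in> G"
    "dist (g p) (\<beta> s) \<le> M2" "dist (g' p) (\<beta> t) \<le> M2" "t = l \<Longrightarrow> g' = f1"
    "inverse_map g \<circ> g' \<in> barrier_free p G M1 M2"
proof -
  define T where "T = {0..l} \<inter> (\<lambda>t. infdist (\<beta> t) (orbit_of p G)) -` {..M1}"
  have "continuous_on {0..l} (\<lambda>t. infdist (\<beta> t) (orbit_of p G))"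
    by (intro continuous_on_infdist geodesic_path_continuous[OF \<beta>])
  then have "closed T"
    unfolding T_def by (rule continuous_closed_preimage) auto
  then have closed: "closed (insert 0 T)" "closed (insert l T)" by auto
  have T: "T \<subseteq> {0..l}" by (auto simp: T_def)
  have "compact (insert 0 T \<inter> {0..\<tau>})" "compact (insert l T \<inter> {\<tau>..l})"
    using closed by (auto intro: closed_Int_compact)
  moreover have "insert 0 T \<inter> {0..\<tau>} \<noteq> {}" "insert l T \<inter> {\<tau>..l} \<noteq> {}" using \<tau> by auto
  ultimately obtain s t where s: "s \<in> insert 0 T \<inter> {0..\<tau>}" "\<forall>u\<in>insert 0 T \<inter> {0..\<tau>}. u \<le> s"
    and t: "t \<in> insert l T \<inter> {\<tau>..l}" "\<forall>u\<in>insert l T \<inter> {\<tau>..l}. t \<le> u"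
    using compact_attains_sup[of "insert 0 T \<inter> {0..\<tau>}"] compact_attains_inf[of "insert l T \<inter> {\<tau>..l}"] by metis
  have orbit: "\<exists>g\<in>G. dist (g p) (\<beta> u) \<le> M2" if "u \<in> T" for u
  proof -
    have "infdist (\<beta> u) (orbit_of p G) \<le> M1" using that by (simp add: T_def)
    from near_orbit[OF this] obtain f where "f \<in> G" "dist (\<beta> u) (f p) \<le> M1" by blast
    then show ?thesis using M by (intro bexI[of _ f]) (simp_all add: dist_commute)
  qed
  have "\<exists>g\<in>G. dist (g p) (\<beta> s) \<le> M2"
    using s(1) orbit f(1) ends(1) geodesic_path_ends[OF \<beta>] by auto
  then obtain g where g: "g \<in> G" "dist (g p) (\<beta> s) \<le> M2" by blast
  have "\<exists>g'\<in>G. dist (g' p) (\<beta> t) \<le> M2 \<and> (t = l \<longrightarrow> g' = f1)"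
    using t(1) orbit f(2) ends(2) geodesic_path_ends[OF \<beta>] by (cases "t = l") auto
  then obtain g' where g': "g' \<in> G" "dist (g' p) (\<beta> t) \<le> M2" "t = l \<longrightarrow> g' = f1" by blast
  have "inverse_map g \<circ> g' \<in> barrier_free p G M1 M2"
  proof (rule barrier_freeI[OF g(1) g'(1) \<beta> _ _ _ g(2) g'(2)])
    show "0 \<le> s" "s \<le> t" "t \<le> l" using s t by auto
    fix u assume u: "s < u" "u < t"
    have "u \<notin> T"
    proof
      assume "u \<in> T"
      then have "u \<le> s \<or> t \<le> u"
        using s(2) t(2) T by (cases "u \<le> \<tau>") auto
      then show False using u by linarith
    qed
    then show "M1 < infdist (\<beta> u) (orbit_of p G)" using u s(1) t(1) by (auto simp: T_def)
  qed
  then show thesis using that[of s t g g'] s t g g' by auto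
qed

lemma id_barrier_free: "0 \<le> M2 \<Longrightarrow> id \<in> barrier_free p G M1 M2"
  unfolding barrier_free_def nbhd_def using id_mem
  by (auto intro!: exI[of _ "\<lambda>_. p"] exI[of _ 0] simp: geodesic_on_def)

lemma poincare_series_mono: "A \<subseteq> B \<Longrightarrow> poincare_series p A s \<le> poincare_series p B s"
  unfolding poincare_series_def by (rule count_sum_mono_set)

lemma poincare_series_antimono: "s \<le> s' \<Longrightarrow> poincare_series p A s' \<le> poincare_series p A s"
  unfolding poincare_series_def
  by (intro count_sum_mono ennreal_leI) (auto intro: mult_right_mono)

end

context group_axis
begin

lemma unbarred_path_sub:
  assumes nb: "unbarred_path m l \<beta>" and st: "0 \<le> s" "s \<le> t" "t \<le> l" and g: "g \<in> \<Gamma>"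
  shows "unbarred_path m (t - s) (\<lambda>u. inverse_map g (\<beta> (s + u)))"
  unfolding unbarred_path_def
proof (intro ballI allI impI)
  fix f u v assume "f \<in> \<Gamma>" "0 \<le> u" "u \<le> v" "v \<le> t - s"
  then show "\<not> barrier m (inverse_map g (\<beta> (s + u))) (inverse_map g (\<beta> (s + v))) f"
    unfolding barrier_translate[OF g \<open>f \<in> \<Gamma>\<close>]
    using st by (intro unbarred_pathD[OF nb comp_mem[OF g]]) auto
qed

lemma unbarred_subpath:
  assumes \<beta>: "geodesic_path l \<beta> x y" and nb: "unbarred_path m (t - s) (\<lambda>u. \<beta> (s + u))"
    and st: "0 \<le> s" "s \<le> t" "t \<le> l"
    and g: "g \<in> \<Gamma>" "g' \<in> \<Gamma>" "dist (g p) (\<beta> s) \<le> M" "dist (g' p) (\<beta> t) \<le> M"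
    and L: "t - s \<le> L"
  shows "inverse_map g \<circ> g' \<in> unbarred_upto M m L"
proof (rule unbarred_uptoI)
  show "inverse_map g \<circ> g' \<in> \<Gamma>" using g inv_mem comp_mem by blast
  show "geodesic_path (t - s) (\<lambda>u. inverse_map g (\<beta> (s + u))) (inverse_map g (\<beta> s)) (inverse_map g (\<beta> t))"
    by (rule geodesic_path_isometry[OF geodesic_path_sub[OF \<beta> st], of "inverse_map g"]) (simp add: g)
  show "dist p (inverse_map g (\<beta> s)) \<le> M"
    using g(3) dist_inv_left[OF g(1), of "\<beta> s" p] by (simp add: dist_commute)
  show "dist ((inverse_map g \<circ> g') p) (inverse_map g (\<beta> t)) \<le> M" using g by simp
  have "0 \<le> t - s" using st by simp
  from unbarred_path_sub[OF nb order_refl this order_refl g(1)]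
  show "unbarred_path m (t - s) (\<lambda>u. inverse_map g (\<beta> (s + u)))" by simp
qed (rule L)

end

section \<open>Recursive cutting of unbarred geodesics near the orbit\<close>

locale scc_axis = group_axis +
  fixes M1 M :: real and m :: int
  assumes M: "0 < M1" "M1 \<le> M"
begin

abbreviation V :: "('a \<Rightarrow> 'a) set" where "V \<equiv> unbarred M m"
abbreviation BF :: "('a \<Rightarrow> 'a) set" where "BF \<equiv> barrier_free p \<Gamma> M1 M"

lemma BF_sub: "BF \<subseteq> \<Gamma>" by (auto simp: barrier_free_def)

text \<open>The shape of an initial piece stopped at the first orbit approach after time
  \<open>N\<close>. Its only unbounded part is one excursion, so its series converges wherever that
  of \<open>BF\<close> does.\<close>

definition tame :: "real \<Rightarrow> ('a \<Rightarrow> 'a) set" where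
  "tame N = {u \<circ> v |u v. u \<in> \<Gamma> \<and> len u \<le> N + 2 * M \<and> v \<in> BF}"

text \<open>
  Cut an unbarred geodesic at the first point after time \<open>N\<close> that is close to the orbit.
\<close>

lemma unbarred_chop:
  assumes v: "v \<in> unbarred_upto M m (L + N)" and LN: "0 \<le> L" "0 \<le> N"
  shows "v \<in> tame N \<or> (\<exists>w\<in>V \<inter> tame N. \<exists>r\<in>unbarred_upto M m L.
    N - 2 * M \<le> len w \<and> v = w \<circ> r \<and> len w + len r - 6 * M \<le> len v)"
proof -
  obtain l \<beta> x y where v\<Gamma>: "v \<in> \<Gamma>" and \<beta>: "geodesic_path l \<beta> x y" and l: "l \<le> L + N"
    and ends: "dist p x \<le> M" "dist (v p) y \<le> M" and nb: "unbarred_path m l \<beta>"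
    using v unfolding unbarred_upto_def by blast
  have l0: "0 \<le> l" and len_l: "l = dist x y" using geodesic_path_ends[OF \<beta>] geodesic_path_length[OF \<beta>] by auto
  have nb': "unbarred_path m (t - s) (\<lambda>u. \<beta> (s + u))" if "0 \<le> s" "s \<le> t" "t \<le> l" for s t
    using unbarred_path_sub[OF nb that id_mem] by simp
  have len_near: "len g \<le> t + 2 * M" "t - 2 * M \<le> len g"
    if "0 \<le> t" "t \<le> l" "dist (g p) (\<beta> t) \<le> M" for g t
  proof -
    have "dist x (\<beta> t) = t" using geodesic_path_dist[OF \<beta>, of 0 t] geodesic_path_ends[OF \<beta>] that l0 by simp
    then show "len g \<le> t + 2 * M" "t - 2 * M \<le> len g"
      using that(3) ends(1) dist_triangle[of p "g p" x] dist_triangle[of x "g p" "\<beta> t"]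
        dist_triangle[of x "\<beta> t" p] dist_triangle[of p "\<beta> t" "g p"] by (auto simp: dist_commute)
  qed
  have tame: "u \<circ> (inverse_map u \<circ> w) = w" if "u \<in> \<Gamma>" for u w
    using inv_comp(2)[OF that] by (simp add: comp_assoc[symmetric])
  show ?thesis
  proof (cases "l \<le> N")
    case True
    have "len v \<le> l + 2 * M" using len_near(1)[of l v] l0 ends geodesic_path_ends[OF \<beta>] by simp
    then have "v \<in> tame N"
      unfolding tame_def using True v\<Gamma> id_barrier_free[of M M1] M by (intro CollectI exI[of _ v] exI[of _ id]) auto
    then show ?thesis ..
  next
    case False
    have e: "dist (id p) x \<le> M" using ends by simp
    obtain s t g g' where st: "0 \<le> s" "s \<le> N" "N \<le> t" "t \<le> l" and g: "g \<in> \<Gamma>" "g' \<in> \<Gamma>"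
      and near: "dist (g p) (\<beta> s) \<le> M" "dist (g' p) (\<beta> t) \<le> M" and tl: "t = l \<Longrightarrow> g' = v"
      and ex: "inverse_map g \<circ> g' \<in> BF"
      using excursion[OF \<beta> id_mem v\<Gamma> e ends(2) M(2), of N] False LN by (metis not_le less_imp_le)
    have sl: "s \<le> l" "0 \<le> t" using st LN by auto
    have "len g \<le> N + 2 * M" using len_near(1)[of s g] near sl st by simp
    \<comment> \<open>The element \<open>g\<close> is reached by time \<open>s \<le> N\<close>, and
      an excursion leads from it to \<open>g'\<close>.\<close>
    then have g'_tame: "g' \<in> tame N"
      unfolding tame_def using g(1) ex tame[OF g(1), of g']
      by (intro CollectI exI[of _ g] exI[of _ "inverse_map g \<circ> g'"]) simp
    show ?thesis
    proof (cases "t = l")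
      case True
      then show ?thesis using g'_tame tl by simp
    next
      case False
      have x: "dist (id p) (\<beta> 0) \<le> M" and y: "dist (v p) (\<beta> l) \<le> M"
        using ends geodesic_path_ends[OF \<beta>] by simp_all
      have "inverse_map id \<circ> g' \<in> unbarred_upto M m (t - 0)"
        by (rule unbarred_subpath[OF \<beta> nb' order_refl sl(2) st(4) id_mem g(2) x near(2) order_refl])
          (use sl st in auto)
      moreover have "inverse_map id \<circ> g' = g'" by (rule ext) simp
      ultimately have "g' \<in> V" unfolding unbarred_def by (metis UN_I UNIV_I)
      define r where "r = inverse_map g' \<circ> v"
      have "r \<in> unbarred_upto M m L"
        unfolding r_def using unbarred_subpath[OF \<beta> nb' sl(2) st(4) order_refl g(2) v\<Gamma> near(2) y, of L] sl st l by auto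
      moreover have "v = g' \<circ> r" unfolding r_def by (rule tame[OF g(2), symmetric])
      moreover have "N - 2 * M \<le> len g'" using len_near(2)[of t g'] near sl st by simp
      \<comment> \<open>Each of \<open>len g'\<close>, \<open>len r\<close> and \<open>len v\<close>
        differs from the length of its part of the geodesic by at most \<open>2 * M\<close>.\<close>
      moreover have "len g' + len r - 6 * M \<le> len v"
      proof -
        have "dist (\<beta> t) (\<beta> l) = l - t" using geodesic_path_dist[OF \<beta>, of t l] sl st by simp
        moreover have "len r = dist (g' p) (v p)"
          using dist_inv_left[OF g(2), of "v p" p] by (simp add: r_def dist_commute)
        ultimately have "len r \<le> (l - t) + 2 * M"
          using near(2) y dist_triangle[of "g' p" "v p" "\<beta> t"] dist_triangle[of "\<beta> t" "v p" "\<beta> l"]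
          by (simp add: dist_commute)
        then show ?thesis
          using len_near(1)[of t g'] len_near(2)[of l v] near sl st l0 y by linarith
      qed
      ultimately show ?thesis using g'_tame \<open>g' \<in> V\<close> by blast
    qed
  qed
qed

lemma poincare_series_tame:
  assumes "0 \<le> s" "0 \<le> N" and fin: "poincare_series p BF s < \<infinity>"
  shows "poincare_series p (tame N) s < \<infinity>"
proof -
  define F where "F = {u \<in> \<Gamma>. len u \<le> N + 2 * M}"
  have F: "finite F" unfolding F_def by (rule finite_ball)
  have "tame N \<subseteq> (\<lambda>z. fst z \<circ> snd z) ` (F \<times> BF)"
    unfolding tame_def F_def by (auto intro!: image_eqI[where x = "(_, _)"])
  then have "poincare_series p (tame N) s \<le> (\<integral>\<^sup>+z. ennreal (exp (- s * len (fst z \<circ> snd z))) \<partial>count_space (F \<times> BF))"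
    unfolding poincare_series_def by (rule count_sum_le_cover)
  also have "\<dots> \<le> (\<integral>\<^sup>+z. ennreal (exp (s * (N + 2 * M))) * ennreal (exp (- s * len (snd z))) \<partial>count_space (F \<times> BF))"
  proof (intro count_sum_mono, clarify)
    fix u v assume u: "u \<in> F" and "v \<in> BF"
    then have "len v - (N + 2 * M) \<le> len (u \<circ> v)"
      using dist_triangle[of "u p" "u (v p)" p] dist_act[of u p "v p"] by (simp add: dist_commute F_def)
    then have "s * (len v - (N + 2 * M)) \<le> s * len (u \<circ> v)" using assms(1) by (rule mult_left_mono)
    then have "exp (- s * len (u \<circ> v)) \<le> exp (s * (N + 2 * M)) * exp (- s * len v)"
      by (simp add: exp_add[symmetric] algebra_simps)
    then show "ennreal (exp (- s * len (fst (u, v) \<circ> snd (u, v)))) \<le>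
      ennreal (exp (s * (N + 2 * M))) * ennreal (exp (- s * len (snd (u, v))))"
      by (simp add: ennreal_mult'[symmetric] ennreal_leI del: comp_apply)
  qed
  also have "\<dots> = (\<integral>\<^sup>+u. ennreal (exp (s * (N + 2 * M))) \<partial>count_space F) * poincare_series p BF s"
    unfolding poincare_series_def
    using F by (intro count_sum_Times countable_finite countable_subset[OF BF_sub countable_G])
  also have "\<dots> < \<infinity>"
    using fin F by (simp add: nn_integral_count_space_finite ennreal_mult_less_top of_nat_less_top)
  finally show ?thesis .
qed

text \<open>With \<open>a n\<close> the series for geodesics of length at most \<open>n * N\<close>
  and \<open>T\<close> that of \<open>tame N\<close>, cutting gives
  \<open>a (n + 1) \<le> T + a n / 2\<close>. Hence \<open>a n \<le> 2 * T\<close> uniformly, and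
  the sets exhaust \<open>V\<close>.\<close>

lemma poincare_series_unbarred_le:
  assumes s: "0 \<le> s" and N0: "0 < N"
    and small: "ennreal (exp (6 * M * s)) * poincare_series p {w \<in> V \<inter> tame N. N - 2 * M \<le> len w} s \<le> ennreal (1 / 2)"
  shows "poincare_series p V s \<le> 2 * poincare_series p (tame N) s"
proof -
  have N: "0 \<le> N" using N0 by simp
  let ?Q = "{w \<in> V \<inter> tame N. N - 2 * M \<le> len w}" and ?T = "poincare_series p (tame N) s"
  let ?U = "\<lambda>n::nat. unbarred_upto M m (real n * N)"
  have le: "poincare_series p (?U n) s \<le> 2 * ?T" for n
  proof (induction n)
    case 0
    have "?U 0 \<subseteq> tame N"
    proof
      fix v assume v: "v \<in> ?U 0"
      obtain l \<beta> x y where v\<Gamma>: "v \<in> \<Gamma>" and \<beta>: "geodesic_path l \<beta> x y" and l: "l \<le> 0"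
        and ends: "dist p x \<le> M" "dist (v p) y \<le> M"
        using v unfolding unbarred_upto_def by auto
      have "x = y" using geodesic_path_length[OF \<beta>] l by simp
      then have "len v \<le> 2 * M" using ends dist_triangle[of p "v p" x] by (simp add: dist_commute)
      then show "v \<in> tame N"
        unfolding tame_def using N v\<Gamma> id_barrier_free[of M M1] M by (intro CollectI exI[of _ v] exI[of _ id]) auto
    qed
    then have "poincare_series p (?U 0) s \<le> ?T" by (rule poincare_series_mono)
    also have "\<dots> \<le> 2 * ?T" using mult_right_mono[of 1 2 ?T] by simp
    finally show ?case .
  next
    case (Suc n)
    have "?U (Suc n) \<subseteq> tame N \<union> (\<lambda>z. fst z \<circ> snd z) ` {z \<in> ?Q \<times> ?U n. len (fst z) + len (snd z) - 6 * M \<le> len (fst z \<circ> snd z)}"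
    proof
      fix v assume v: "v \<in> ?U (Suc n)"
      have "real (Suc n) * N = real n * N + N" by (simp add: algebra_simps)
      then have "v \<in> tame N \<or> (\<exists>w\<in>V \<inter> tame N. \<exists>r\<in>?U n.
          N - 2 * M \<le> len w \<and> v = w \<circ> r \<and> len w + len r - 6 * M \<le> len v)"
        using unbarred_chop[of v "real n * N" N] v N by simp
      then show "v \<in> tame N \<union> (\<lambda>z. fst z \<circ> snd z) ` {z \<in> ?Q \<times> ?U n. len (fst z) + len (snd z) - 6 * M \<le> len (fst z \<circ> snd z)}"
        (is "v \<in> _ \<union> ?I")
      proof (elim disjE bexE conjE)
        fix w r assume "w \<in> V \<inter> tame N" "r \<in> ?U n" "N - 2 * M \<le> len w" "v = w \<circ> r" "len w + len r - 6 * M \<le> len v"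
        then have "v \<in> ?I" by (intro image_eqI[where x = "(w, r)"]) auto
        then show ?thesis ..
      qed simp
    qed
    then have "poincare_series p (?U (Suc n)) s \<le> poincare_series p (tame N \<union> (\<lambda>z. fst z \<circ> snd z) `
       {z \<in> ?Q \<times> ?U n. len (fst z) + len (snd z) - 6 * M \<le> len (fst z \<circ> snd z)}) s"
      (is "_ \<le> poincare_series p (_ \<union> ?f ` ?Z) s")
      by (rule poincare_series_mono)
    also have "\<dots> \<le> ?T + poincare_series p (?f ` ?Z) s"
      unfolding poincare_series_def by (rule count_sum_Un_le)
    also have "poincare_series p (?f ` ?Z) s \<le> (\<integral>\<^sup>+z. ennreal (exp (- s * len (fst z \<circ> snd z))) \<partial>count_space ?Z)"
      unfolding poincare_series_def by (rule count_sum_le_cover) (rule order_refl)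
    also have "\<dots> \<le> (\<integral>\<^sup>+z. (ennreal (exp (6 * M * s)) * ennreal (exp (- s * len (fst z)))) * ennreal (exp (- s * len (snd z))) \<partial>count_space ?Z)"
    proof (intro count_sum_mono)
      fix z assume "z \<in> ?Z"
      then have "s * (len (fst z) + len (snd z) - 6 * M) \<le> s * len (fst z \<circ> snd z)"
        using s by (intro mult_left_mono) auto
      then have "exp (- s * len (fst z \<circ> snd z)) \<le> exp (6 * M * s) * exp (- s * len (fst z)) * exp (- s * len (snd z))"
        by (simp add: exp_add[symmetric] algebra_simps)
      then show "ennreal (exp (- s * len (fst z \<circ> snd z))) \<le>
        (ennreal (exp (6 * M * s)) * ennreal (exp (- s * len (fst z)))) * ennreal (exp (- s * len (snd z)))"
        by (simp add: ennreal_mult'[symmetric] ennreal_leI del: comp_apply)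
    qed
    also have "\<dots> \<le> (\<integral>\<^sup>+z. (ennreal (exp (6 * M * s)) * ennreal (exp (- s * len (fst z)))) * ennreal (exp (- s * len (snd z))) \<partial>count_space (?Q \<times> ?U n))"
      by (rule count_sum_mono_set) auto
    also have "\<dots> = (\<integral>\<^sup>+w. ennreal (exp (6 * M * s)) * ennreal (exp (- s * len w)) \<partial>count_space ?Q) * poincare_series p (?U n) s"
      unfolding poincare_series_def
    proof (rule count_sum_Times)
      show "countable ?Q" "countable (?U n)"
        by (rule countable_subset[OF _ countable_G], use unbarred_sub in \<open>auto simp: unbarred_upto_def\<close>)+
    qed
    also have "\<dots> = ennreal (exp (6 * M * s)) * poincare_series p ?Q s * poincare_series p (?U n) s"
      by (simp add: poincare_series_def nn_integral_cmult)
    also have "\<dots> \<le> ennreal (1 / 2) * (2 * ?T)"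
      by (rule mult_mono[OF small Suc.IH]) auto
    also have "\<dots> = ?T"
    proof -
      have "ennreal (1 / 2) * ennreal 2 = ennreal (1 / 2 * 2)" by (rule ennreal_mult'[symmetric]) simp
      then have "ennreal (1 / 2) * 2 = 1" by simp
      then show ?thesis by (metis mult.assoc mult_1)
    qed
    finally show ?case by (simp add: mult_2 add_left_mono)
  qed
  have "V = (\<Union>n. ?U n)"
  proof (intro equalityI subsetI)
    fix v assume "v \<in> V"
    then obtain L where L: "v \<in> unbarred_upto M m L" by (auto simp: unbarred_def)
    obtain n :: nat where "L / N \<le> real n" using real_arch_simple by blast
    then have "L \<le> real n * N" using N0 by (simp add: field_simps)
    then have "v \<in> ?U n" using L unfolding unbarred_upto_def by (blast intro: order_trans)
    then show "v \<in> (\<Union>n. ?U n)" by blast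
  qed (auto simp: unbarred_def)
  moreover have "incseq ?U"
  proof (rule incseq_SucI, rule subsetI)
    fix n v assume v: "v \<in> ?U n"
    have "real n * N \<le> real (Suc n) * N" using N by (intro mult_right_mono) auto
    then show "v \<in> ?U (Suc n)" using v unfolding unbarred_upto_def by (blast intro: order_trans)
  qed
  ultimately have "poincare_series p V s = (SUP n. poincare_series p (?U n) s)"
    unfolding poincare_series_def by (simp add: count_sum_SUP)
  then show ?thesis using le by (simp add: SUP_least)
qed

end

context proper_isometric_action
begin

text \<open>Turns convergence at the smaller exponent \<open>s1\<close> into exponential smallness
  in the minimal length.\<close>

lemma poincare_series_tail:
  assumes "\<And>g. g \<in> A \<Longrightarrow> r \<le> len g" "s1 \<le> s"
  shows "poincare_series p A s \<le> ennreal (exp (- (s - s1) * r)) * poincare_series p A s1"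
proof -
  have "poincare_series p A s \<le> (\<integral>\<^sup>+g. ennreal (exp (- (s - s1) * r)) * ennreal (exp (- s1 * len g)) \<partial>count_space A)"
    unfolding poincare_series_def
  proof (rule count_sum_mono)
    fix g assume "g \<in> A"
    then have "(s - s1) * r \<le> (s - s1) * len g" using assms by (intro mult_left_mono) auto
    then have "exp (- s * len g) \<le> exp (- (s - s1) * r) * exp (- s1 * len g)"
      by (simp add: exp_add[symmetric] algebra_simps)
    then show "ennreal (exp (- s * len g)) \<le> ennreal (exp (- (s - s1) * r)) * ennreal (exp (- s1 * len g))"
      by (simp add: ennreal_mult'[symmetric] ennreal_leI)
  qed
  then show ?thesis by (simp add: poincare_series_def nn_integral_cmult)
qed

text \<open>On elements of bounded length the exponent can be lowered at a controlled cost.\<close>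

lemma poincare_series_head:
  assumes "\<And>g. g \<in> A \<Longrightarrow> len g \<le> r" "s \<le> s2"
  shows "poincare_series p A s \<le> ennreal (exp ((s2 - s) * r)) * poincare_series p A s2"
proof -
  have "poincare_series p A s \<le> (\<integral>\<^sup>+g. ennreal (exp ((s2 - s) * r)) * ennreal (exp (- s2 * len g)) \<partial>count_space A)"
    unfolding poincare_series_def
  proof (rule count_sum_mono)
    fix g assume "g \<in> A"
    then have "(s2 - s) * len g \<le> (s2 - s) * r" using assms by (intro mult_left_mono) auto
    then have "exp (- s * len g) \<le> exp ((s2 - s) * r) * exp (- s2 * len g)"
      by (simp add: exp_add[symmetric] algebra_simps)
    then show "ennreal (exp (- s * len g)) \<le> ennreal (exp ((s2 - s) * r)) * ennreal (exp (- s2 * len g))"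
      by (simp add: ennreal_mult'[symmetric] ennreal_leI)
  qed
  then show ?thesis by (simp add: poincare_series_def nn_integral_cmult)
qed

lemma poincare_series_Un: "poincare_series p (A \<union> B) s \<le> poincare_series p A s + poincare_series p B s"
  unfolding poincare_series_def by (rule count_sum_Un_le)

end

context scc_axis
begin

text \<open>The hypothesis of \<open>poincare_series_unbarred_le\<close> is a strict smallness at
  \<omega> that must persist at some \<open>s1 < \<omega>\<close>. For the elements of
  \<open>Q\<close> of length at most \<open>R\<close> it persists by continuity, and the longer ones
  are small already at \<open>s0\<close> because \<open>Q\<close> consists of tame elements.\<close>

lemma poincare_series_unbarred_subcritical:
  assumes s0: "0 \<le> s0" "s0 < \<omega>" and BF: "poincare_series p BF s0 < \<infinity>"
    and fin: "\<And>s. \<omega> < s \<Longrightarrow> poincare_series p \<Gamma> s < \<infinity>"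
  shows "\<exists>s1. 0 \<le> s1 \<and> s1 < \<omega> \<and> poincare_series p (V \<union> BF) s1 < \<infinity>"
proof -
  have "poincare_series p V \<omega> < \<infinity>"
    using s0 by (intro poincare_series_unbarred_finite fin) auto
  \<comment> \<open>The weight of \<open>Q\<close> at \<open>s1\<close> will be at most
    \<open>3 * \<epsilon>\<close>; the divisor 8 turns this into 3/8, below the required
    1/2.\<close>
  define \<epsilon> where "\<epsilon> = exp (- 6 * M * \<omega>) / 8"
  have \<epsilon>: "0 < \<epsilon>" by (simp add: \<epsilon>_def)
  obtain n :: nat where n: "poincare_series p {v \<in> V. real n < len v} \<omega> < ennreal \<epsilon>"
    using count_sum_tail[OF \<open>poincare_series p V \<omega> < \<infinity>\<close>[unfolded poincare_series_def], of "ennreal \<epsilon>" len] \<epsilon>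
    unfolding poincare_series_def by auto
  \<comment> \<open>Elements of \<open>Q\<close> then have length at least \<open>n + 1\<close>, so
    \<open>Q\<close> lies in the small tail.\<close>
  define N where "N = real n + 2 * M + 1"
  have N: "0 < N" using M by (simp add: N_def)
  define Q where "Q = {w \<in> V \<inter> tame N. N - 2 * M \<le> len w}"
  have "poincare_series p Q \<omega> \<le> poincare_series p {v \<in> V. real n < len v} \<omega>"
    by (rule poincare_series_mono) (auto simp: Q_def N_def)
  then have Q\<omega>: "poincare_series p Q \<omega> \<le> ennreal \<epsilon>" using n by (meson less_imp_le order_trans)
  have tame: "poincare_series p (tame N) s0 < \<infinity>"
    using N s0 BF by (intro poincare_series_tame) auto
  have "poincare_series p Q s0 \<le> poincare_series p (tame N) s0"
    by (rule poincare_series_mono) (auto simp: Q_def)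
  then have Qs0: "poincare_series p Q s0 < \<infinity>" using tame by (rule le_less_trans)
  obtain R :: nat where R: "poincare_series p {v \<in> Q. real R < len v} s0 < ennreal \<epsilon>"
    using count_sum_tail[OF Qs0[unfolded poincare_series_def], of "ennreal \<epsilon>" len] \<epsilon>
    unfolding poincare_series_def by auto
  \<comment> \<open>So close to \<omega> that lowering the exponent costs elements of length at most
    \<open>R\<close> a factor at most \<open>exp (1 / 2)\<close>, hence at most 2.\<close>
  define s1 where "s1 = max s0 (\<omega> - 1 / (2 * real R + 2))"
  have s1: "s0 \<le> s1" "s1 < \<omega>" using s0 by (auto simp: s1_def)
  have "(\<omega> - s1) * real R \<le> 1 / (2 * real R + 2) * real R"
    by (intro mult_right_mono) (auto simp: s1_def)
  also have "\<dots> \<le> 1 / 2" by (simp add: field_simps)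
  finally have "exp ((\<omega> - s1) * real R) \<le> exp (1 / 2)" by simp
  also have "exp (1 / 2) \<le> (2::real)"
    using exp_bound_half[of "1/2::real"] by simp
  finally have e2: "exp ((\<omega> - s1) * real R) \<le> 2" .
  have "poincare_series p Q s1 \<le> poincare_series p {v \<in> Q. len v \<le> real R} s1 + poincare_series p {v \<in> Q. real R < len v} s1"
    by (rule order_trans[OF poincare_series_mono poincare_series_Un]) auto
  also have "\<dots> \<le> ennreal (2 * \<epsilon>) + ennreal \<epsilon>"
  proof (rule add_mono)
    have "poincare_series p {v \<in> Q. len v \<le> real R} s1 \<le>
        ennreal (exp ((\<omega> - s1) * real R)) * poincare_series p {v \<in> Q. len v \<le> real R} \<omega>"
      using s1 by (intro poincare_series_head) auto
    also have "\<dots> \<le> ennreal 2 * ennreal \<epsilon>"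
      by (intro mult_mono ennreal_leI e2 order_trans[OF poincare_series_mono Q\<omega>]) auto
    also have "\<dots> = ennreal (2 * \<epsilon>)" using \<epsilon> by (simp add: ennreal_mult')
    finally show "poincare_series p {v \<in> Q. len v \<le> real R} s1 \<le> ennreal (2 * \<epsilon>)" .
    show "poincare_series p {v \<in> Q. real R < len v} s1 \<le> ennreal \<epsilon>"
      using poincare_series_antimono[OF s1(1)] R by (meson less_imp_le order_trans)
  qed
  also have "\<dots> = ennreal (3 * \<epsilon>)" using \<epsilon> by (simp flip: ennreal_plus)
  finally have Q: "poincare_series p Q s1 \<le> ennreal (3 * \<epsilon>)" .
  have "6 * M * s1 \<le> 6 * M * \<omega>" using s1 M by (intro mult_left_mono) auto
  then have "exp (6 * M * s1) * (3 * \<epsilon>) \<le> exp (6 * M * \<omega>) * (3 * \<epsilon>)"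
    using \<epsilon> by (intro mult_right_mono) auto
  also have "\<dots> \<le> 1 / 2" by (simp add: \<epsilon>_def exp_minus field_simps)
  finally have half: "ennreal (exp (6 * M * s1) * (3 * \<epsilon>)) \<le> ennreal (1 / 2)" by (rule ennreal_leI)
  have "ennreal (exp (6 * M * s1)) * poincare_series p Q s1 \<le> ennreal (exp (6 * M * s1)) * ennreal (3 * \<epsilon>)"
    using Q by (rule mult_left_mono) simp
  also have "\<dots> = ennreal (exp (6 * M * s1) * (3 * \<epsilon>))"
    by (rule ennreal_mult'[symmetric]) simp
  also note half
  finally have "ennreal (exp (6 * M * s1)) * poincare_series p Q s1 \<le> ennreal (1 / 2)" .
  then have "poincare_series p V s1 \<le> 2 * poincare_series p (tame N) s1"
    using s0 s1 N unfolding Q_def by (intro poincare_series_unbarred_le) auto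
  also have "\<dots> \<le> 2 * poincare_series p (tame N) s0"
    using s1 by (intro mult_left_mono poincare_series_antimono) auto
  also have "\<dots> < \<infinity>" using tame by (simp add: ennreal_mult_less_top)
  finally have "poincare_series p V s1 < \<infinity>" .
  moreover have "poincare_series p BF s1 < \<infinity>"
    using poincare_series_antimono[OF s1(1)] BF by (rule le_less_trans)
  ultimately have "poincare_series p (V \<union> BF) s1 < \<infinity>"
    using poincare_series_Un[of V BF s1] by (simp add: le_less_trans ennreal_add_less_top)
  then show ?thesis using s0 s1 by (intro exI[of _ s1]) auto
qed

text \<open>The window is \<open>[b - 3 * d, b]\<close>. In the first alternative the geodesic
  contains, starting before \<open>b\<close>, an unbarred piece or excursion of length at least
  \<open>d\<close>; in the second a barrier is centred near the window. In both, lengths add up to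
  \<open>len g\<close> within a constant.\<close>

lemma window:
  assumes g: "g \<in> \<Gamma>" and \<gamma>: "geodesic_path l \<gamma> p (g p)"
    and d: "0 \<le> d" "3 * d \<le> b" "b \<le> l" and m: "5 * K + 3 * (K * K) < m"
  shows "(\<exists>f1\<in>\<Gamma>. \<exists>w\<in>V \<union> BF. \<exists>f3\<in>\<Gamma>. g = f1 \<circ> (w \<circ> f3) \<and> len f1 \<le> b + M \<and> d - 2 * M \<le> len w \<and>
      len f1 + len w + len f3 \<le> len g + 4 * M) \<or>
    (\<exists>f\<in>\<Gamma>. barrier (2 * K) p (g p) f \<and> b - 3 * d - barrier_radius \<le> len f \<and>
      len f \<le> b + barrier_radius \<and> len f + dist (f p) (g p) \<le> len g + 2 * barrier_radius)"
    (is "?bad \<or> ?good")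
proof -
  have l: "l = len g" "0 \<le> l" using geodesic_path_length[OF \<gamma>] geodesic_path_ends[OF \<gamma>] by auto
  have split: ?bad
    if t: "0 \<le> t1" "t1 \<le> b" "d \<le> t2 - t1" "t2 \<le> l" and f: "f1 \<in> \<Gamma>" "f2 \<in> \<Gamma>"
      and near: "dist (f1 p) (\<gamma> t1) \<le> M" "dist (f2 p) (\<gamma> t2) \<le> M"
      and w: "inverse_map f1 \<circ> f2 \<in> V \<union> BF" for t1 t2 f1 f2
  proof -
    have t12: "t1 \<le> t2" using t d by linarith
    have dd: "dist p (\<gamma> t1) = t1" "dist (\<gamma> t1) (\<gamma> t2) = t2 - t1" "dist (\<gamma> t2) (g p) = l - t2"
      using geodesic_path_dist[OF \<gamma>, of 0 t1] geodesic_path_dist[OF \<gamma>, of t1 t2] geodesic_path_dist[OF \<gamma>, of t2 l]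
        geodesic_path_ends[OF \<gamma>] t t12 by auto
    have lens: "len (inverse_map f1 \<circ> f2) = dist (f1 p) (f2 p)" "len (inverse_map f2 \<circ> g) = dist (f2 p) (g p)"
      using dist_inv_left[OF f(1), of "f2 p" p] dist_inv_left[OF f(2), of "g p" p] by (simp_all add: dist_commute)
    have "len f1 \<le> t1 + M"
      using dist_triangle[of p "f1 p" "\<gamma> t1"] dd near by (simp add: dist_commute)
    moreover have "t2 - t1 - 2 * M \<le> dist (f1 p) (f2 p)" "dist (f1 p) (f2 p) \<le> t2 - t1 + 2 * M"
      using dist_triangle[of "\<gamma> t1" "\<gamma> t2" "f1 p"] dist_triangle[of "f1 p" "\<gamma> t2" "f2 p"]
        dist_triangle[of "f1 p" "f2 p" "\<gamma> t1"] dist_triangle[of "\<gamma> t1" "f2 p" "\<gamma> t2"] dd near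
      by (auto simp: dist_commute)
    moreover have "dist (f2 p) (g p) \<le> l - t2 + M"
      using dist_triangle[of "f2 p" "g p" "\<gamma> t2"] dd near by simp
    moreover have "g = f1 \<circ> ((inverse_map f1 \<circ> f2) \<circ> (inverse_map f2 \<circ> g))"
      using inv_apply(2)[OF f(1)] inv_apply(2)[OF f(2)] by (auto simp: fun_eq_iff)
    moreover have "inverse_map f2 \<circ> g \<in> \<Gamma>" using f g inv_mem comp_mem by blast
    ultimately show ?bad
      using f(1) w t l lens
      by (intro bexI[of _ f1] bexI[of _ "inverse_map f1 \<circ> f2"] bexI[of _ "inverse_map f2 \<circ> g"] conjI) linarith+
  qed
  have ends: "dist (id p) p \<le> M" "dist (g p) (g p) \<le> M" using M by auto
  have ab: "0 \<le> b - 2 * d" "b - 2 * d \<le> l" "0 \<le> b" using d by auto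
  obtain s t u v where a: "0 \<le> s" "s \<le> b - 2 * d" "b - 2 * d \<le> t" "t \<le> l" "u \<in> \<Gamma>" "v \<in> \<Gamma>"
    "dist (u p) (\<gamma> s) \<le> M" "dist (v p) (\<gamma> t) \<le> M" "inverse_map u \<circ> v \<in> BF"
    using excursion[OF \<gamma> id_mem g ends M(2) ab(1,2)] by metis
  obtain s' t' u' v' where b: "0 \<le> s'" "s' \<le> b" "b \<le> t'" "t' \<le> l" "u' \<in> \<Gamma>" "v' \<in> \<Gamma>"
    "dist (u' p) (\<gamma> s') \<le> M" "dist (v' p) (\<gamma> t') \<le> M" "inverse_map u' \<circ> v' \<in> BF"
    using excursion[OF \<gamma> id_mem g ends M(2) ab(3) d(3)] by metis
  \<comment> \<open>The excursions around the times \<open>b - 2 * d\<close> and \<open>b\<close>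
    either reach back far enough to have length \<open>d\<close>, or start at times \<open>s\<close>
    in \<open>[b - 3 * d, b - 2 * d]\<close> and \<open>s'\<close> in \<open>[b - d, b]\<close>. In
    the latter case \<open>s\<close> and \<open>s'\<close> bound a piece of length at least
    \<open>d\<close> that is tested for barriers.\<close>
  consider "s < b - 3 * d" | "s' < b - d" | "b - 3 * d \<le> s" "b - d \<le> s'" by linarith
  then show ?thesis
  proof cases
    case 1
    then have ?bad using a d by (intro split[of s t u v]) auto
    then show ?thesis ..
  next
    case 2
    then have ?bad using b d by (intro split[of s' t' u' v']) auto
    then show ?thesis ..
  next
    case 3
    have ss: "s \<le> s'" "s' \<le> l" "d \<le> s' - s" using 3 a b d by auto
    show ?thesis
    proof (cases "unbarred_path m (s' - s) (\<lambda>x. \<gamma> (s + x))")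
      case True
      from unbarred_subpath[OF \<gamma> True a(1) ss(1,2) a(5) b(5) a(7) b(7) order_refl]
      have "inverse_map u \<circ> u' \<in> V" by (auto simp: unbarred_def)
      then have ?bad using a b d ss by (intro split[of s s' u u']) auto
      then show ?thesis ..
    next
      case False
      then obtain f x y where f: "f \<in> \<Gamma>" "0 \<le> x" "x \<le> y" "y \<le> s' - s" "barrier m (\<gamma> (s + x)) (\<gamma> (s + y)) f"
        by (auto simp: unbarred_path_def)
      have xy: "0 \<le> s + x" "s + x \<le> s + y" "s + y \<le> l" using f a ss by auto
      have bar: "barrier (2 * K) p (g p) f"
        by (rule barrier_extend(1)[OF f(1) \<gamma> xy m f(5)])
      obtain r where r: "s + x \<le> r" "r \<le> s + y" "dist (\<gamma> r) (f p) \<le> barrier_radius"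
        using barrier_extend(2)[OF f(1) \<gamma> xy m f(5)] by blast
      have rl: "0 \<le> r" "r \<le> l" using r xy by auto
      have "dist p (\<gamma> r) = r"
        using geodesic_path_dist[OF \<gamma>, of 0 r] geodesic_path_ends[OF \<gamma>] rl by simp
      then have "b - 3 * d - barrier_radius \<le> len f" "len f \<le> b + barrier_radius"
        using r f 3 b dist_triangle[of p "f p" "\<gamma> r"] dist_triangle[of p "\<gamma> r" "f p"] by (auto simp: dist_commute)
      moreover have "len f + dist (f p) (g p) \<le> len g + 2 * barrier_radius"
        using geodesic_path_near[OF \<gamma> rl r(3)] by simp
      ultimately have ?good using bar f(1) by blast
      then show ?thesis ..
    qed
  qed
qed

end

section \<open>Counting orbit points in horospherical shadows\<close>

context scc_axis
begin

definition bad :: "real \<Rightarrow> real \<Rightarrow> ('a \<Rightarrow> 'a) set" where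
  "bad b d = {g. \<exists>f1\<in>\<Gamma>. \<exists>w\<in>V \<union> BF. \<exists>f3\<in>\<Gamma>. g = f1 \<circ> (w \<circ> f3) \<and> len f1 \<le> b + M \<and> d - 2 * M \<le> len w \<and>
      len f1 + len w + len f3 \<le> len g + 4 * M}"

text \<open>Near additivity of the three lengths bounds the series by a product: initial pieces of
  length at most \<open>b + M\<close>, long middle pieces, and arbitrary ends.\<close>

lemma poincare_series_bad:
  assumes s: "0 \<le> s"
  shows "poincare_series p (bad b d) s \<le> ennreal (exp (4 * M * s)) *
    (poincare_series p {f \<in> \<Gamma>. len f \<le> b + M} s * (poincare_series p {w \<in> V \<union> BF. d - 2 * M \<le> len w} s *
      poincare_series p \<Gamma> s))"
proof -
  let ?F = "{f \<in> \<Gamma>. len f \<le> b + M}" and ?W = "{w \<in> V \<union> BF. d - 2 * M \<le> len w}"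
  let ?f = "\<lambda>z. fst z \<circ> (fst (snd z) \<circ> snd (snd z))"
  let ?Z = "{z \<in> ?F \<times> ?W \<times> \<Gamma>. len (fst z) + (len (fst (snd z)) + len (snd (snd z))) \<le> len (?f z) + 4 * M}"
  let ?e = "\<lambda>g. ennreal (exp (- s * len g))"
  have W: "?W \<subseteq> \<Gamma>" using unbarred_sub BF_sub by auto
  have "bad b d \<subseteq> ?f ` ?Z"
  proof
    fix g assume "g \<in> bad b d"
    then obtain f1 w f3 where *: "f1 \<in> \<Gamma>" "w \<in> V \<union> BF" "f3 \<in> \<Gamma>" "g = f1 \<circ> (w \<circ> f3)" "len f1 \<le> b + M"
      "d - 2 * M \<le> len w" "len f1 + len w + len f3 \<le> len g + 4 * M"
      unfolding bad_def by blast
    then have "(f1, w, f3) \<in> ?Z" by simp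
    then show "g \<in> ?f ` ?Z" by (rule rev_image_eqI) (simp add: *(4))
  qed
  then have "poincare_series p (bad b d) s \<le> (\<integral>\<^sup>+z. ?e (?f z) \<partial>count_space ?Z)"
    unfolding poincare_series_def by (rule count_sum_le_cover)
  also have "\<dots> \<le> (\<integral>\<^sup>+z. (ennreal (exp (4 * M * s)) * ?e (fst z)) * (?e (fst (snd z)) * ?e (snd (snd z))) \<partial>count_space ?Z)"
  proof (rule count_sum_mono)
    fix z assume "z \<in> ?Z"
    then have "s * (len (fst z) + (len (fst (snd z)) + len (snd (snd z))) - 4 * M) \<le> s * len (?f z)"
      using s by (intro mult_left_mono) simp_all
    then have "exp (- s * len (?f z)) \<le> (exp (4 * M * s) * exp (- s * len (fst z))) *
        (exp (- s * len (fst (snd z))) * exp (- s * len (snd (snd z))))"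
      by (simp add: exp_add[symmetric] algebra_simps)
    then show "?e (?f z) \<le> (ennreal (exp (4 * M * s)) * ?e (fst z)) * (?e (fst (snd z)) * ?e (snd (snd z)))"
      by (simp add: ennreal_mult'[symmetric] ennreal_leI del: comp_apply)
  qed
  also have "\<dots> \<le> (\<integral>\<^sup>+z. (ennreal (exp (4 * M * s)) * ?e (fst z)) * (?e (fst (snd z)) * ?e (snd (snd z))) \<partial>count_space (?F \<times> (?W \<times> \<Gamma>)))"
    by (rule count_sum_mono_set) auto
  also have "\<dots> = (\<integral>\<^sup>+f. ennreal (exp (4 * M * s)) * ?e f \<partial>count_space ?F) *
     (\<integral>\<^sup>+z. ?e (fst z) * ?e (snd z) \<partial>count_space (?W \<times> \<Gamma>))"
    by (rule count_sum_Times) (use countable_subset[OF W countable_G] countable_G in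
      \<open>auto intro: countable_subset[OF _ countable_G]\<close>)
  also have "(\<integral>\<^sup>+z. ?e (fst z) * ?e (snd z) \<partial>count_space (?W \<times> \<Gamma>)) =
      (\<integral>\<^sup>+w. ?e w \<partial>count_space ?W) * (\<integral>\<^sup>+q. ?e q \<partial>count_space \<Gamma>)"
    by (rule count_sum_Times[OF countable_subset[OF W countable_G] countable_G])
  finally show ?thesis
    by (simp add: poincare_series_def nn_integral_cmult mult.assoc)
qed

definition near_segment :: "(real \<Rightarrow> 'a) \<Rightarrow> real \<Rightarrow> real \<Rightarrow> ('a \<Rightarrow> 'a) set" where
  "near_segment \<sigma> l r = {f \<in> \<Gamma>. r \<le> len f \<and> (\<exists>t. 0 \<le> t \<and> t \<le> l \<and> dist (\<sigma> t) (f p) \<le> barrier_radius)}"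

text \<open>The segment is sampled at integer times; each sample is near a bounded number of orbit
  points, so the count is linear in the length.\<close>

lemma card_near_segment:
  assumes \<sigma>: "geodesic_path l \<sigma> x y"
  shows "finite (near_segment \<sigma> l r)"
    and "real (card (near_segment \<sigma> l r)) \<le> (l + 1) * real (card {g \<in> \<Gamma>. len g \<le> 2 * (barrier_radius + 1)})"
proof -
  define D where "D = real_of_int barrier_radius + 1"
  let ?U = "\<Union>j\<in>{..nat \<lfloor>l\<rfloor>}. {f \<in> \<Gamma>. dist (\<sigma> (real j)) (f p) \<le> D}"
  have l: "0 \<le> l" using geodesic_path_ends[OF \<sigma>] by simp
  have sub: "near_segment \<sigma> l r \<subseteq> ?U"
  proof
    fix f assume "f \<in> near_segment \<sigma> l r"
    then obtain t where f: "f \<in> \<Gamma>" and t: "0 \<le> t" "t \<le> l" "dist (\<sigma> t) (f p) \<le> barrier_radius"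
      by (auto simp: near_segment_def)
    define j where "j = nat \<lfloor>t\<rfloor>"
    have j: "real j \<le> t" "t \<le> real j + 1" "j \<le> nat \<lfloor>l\<rfloor>"
      using t by (auto simp: j_def floor_mono nat_mono of_nat_nat)
    have "dist (\<sigma> (real j)) (\<sigma> t) \<le> 1"
      using geodesic_path_dist[OF \<sigma>, of "real j" t] j t by simp
    then have "dist (\<sigma> (real j)) (f p) \<le> D"
      using t(3) dist_triangle[of "\<sigma> (real j)" "f p" "\<sigma> t"] by (simp add: D_def)
    then show "f \<in> ?U" using f j by auto
  qed
  have fin: "finite ?U" using finite_near by auto
  show "finite (near_segment \<sigma> l r)" by (rule finite_subset[OF sub fin])
  have "card (near_segment \<sigma> l r) \<le> card ?U" by (rule card_mono[OF fin sub])
  also have "\<dots> \<le> (\<Sum>j\<in>{..nat \<lfloor>l\<rfloor>}. card {f \<in> \<Gamma>. dist (\<sigma> (real j)) (f p) \<le> D})"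
    by (rule card_UN_le) simp
  also have "\<dots> \<le> (\<Sum>j\<in>{..nat \<lfloor>l\<rfloor>}. card {g \<in> \<Gamma>. len g \<le> 2 * D})"
    using barrier_radius_pos by (intro sum_mono card_near) (simp add: D_def)
  also have "\<dots> = (nat \<lfloor>l\<rfloor> + 1) * card {g \<in> \<Gamma>. len g \<le> 2 * D}" by simp
  finally have "real (card (near_segment \<sigma> l r)) \<le> real ((nat \<lfloor>l\<rfloor> + 1) * card {g \<in> \<Gamma>. len g \<le> 2 * D})"
    by (rule of_nat_mono)
  also have "\<dots> = (real (nat \<lfloor>l\<rfloor>) + 1) * real (card {g \<in> \<Gamma>. len g \<le> 2 * D})"
    by (simp add: distrib_right)
  also have "\<dots> \<le> (l + 1) * real (card {g \<in> \<Gamma>. len g \<le> 2 * D})"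
    using l by (intro mult_right_mono) (auto simp: of_nat_nat)
  finally show "real (card (near_segment \<sigma> l r)) \<le> (l + 1) * real (card {g \<in> \<Gamma>. len g \<le> 2 * (barrier_radius + 1)})"
    by (simp add: D_def)
qed

text \<open>A discrete version of shadows: seen from \<open>p\<close>, the point \<open>g p\<close>
  lies almost straight behind some \<open>f p\<close>.\<close>

definition shadowed :: "('a \<Rightarrow> 'a) set \<Rightarrow> ('a \<Rightarrow> 'a) set" where
  "shadowed F = {g \<in> \<Gamma>. \<exists>f\<in>F. len f + dist (f p) (g p) \<le> len g + 2 * barrier_radius}"

lemma poincare_series_shadowed:
  fixes s r :: real
  assumes s: "0 \<le> s" and F: "finite F" "F \<subseteq> \<Gamma>" "\<And>f. f \<in> F \<Longrightarrow> r \<le> len f"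
  shows "poincare_series p (shadowed F) s \<le>
    ennreal (exp (2 * barrier_radius * s) * exp (- s * r) * real (card F)) * poincare_series p \<Gamma> s"
proof -
  let ?Z = "{z \<in> F \<times> \<Gamma>. len (fst z) + len (snd z) \<le> len (fst z \<circ> snd z) + 2 * barrier_radius}"
  let ?e = "\<lambda>g. ennreal (exp (- s * len g))"
  let ?c = "ennreal (exp (2 * barrier_radius * s) * exp (- s * r))"
  have "shadowed F \<subseteq> (\<lambda>z. fst z \<circ> snd z) ` ?Z"
  proof
    fix g assume "g \<in> shadowed F"
    then obtain f where f: "f \<in> F" "len f + dist (f p) (g p) \<le> len g + 2 * barrier_radius" and g: "g \<in> \<Gamma>"
      by (auto simp: shadowed_def)
    have f\<Gamma>: "f \<in> \<Gamma>" using F f by auto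
    define q where "q = inverse_map f \<circ> g"
    have "q \<in> \<Gamma>" unfolding q_def by (rule comp_mem[OF inv_mem[OF f\<Gamma>] g])
    moreover have "f \<circ> q = g"
      unfolding q_def using inv_comp(2)[OF f\<Gamma>] by (simp add: comp_assoc[symmetric])
    moreover have "len q = dist (f p) (g p)"
      using dist_inv_left[OF f\<Gamma>, of "g p" p] by (simp add: q_def dist_commute)
    ultimately have "(f, q) \<in> ?Z" "g = fst (f, q) \<circ> snd (f, q)" using f by (simp_all del: comp_apply)
    then show "g \<in> (\<lambda>z. fst z \<circ> snd z) ` ?Z" by (rule rev_image_eqI)
  qed
  then have "poincare_series p (shadowed F) s \<le> (\<integral>\<^sup>+z. ?e (fst z \<circ> snd z) \<partial>count_space ?Z)"
    unfolding poincare_series_def by (rule count_sum_le_cover)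
  also have "\<dots> \<le> (\<integral>\<^sup>+z. ?c * ?e (snd z) \<partial>count_space ?Z)"
  proof (rule count_sum_mono)
    fix z assume z: "z \<in> ?Z"
    then have "r + len (snd z) - 2 * barrier_radius \<le> len (fst z \<circ> snd z)" using F(3)[of "fst z"] by auto
    then have "s * (r + len (snd z) - 2 * barrier_radius) \<le> s * len (fst z \<circ> snd z)"
      using s by (rule mult_left_mono)
    then have "exp (- s * len (fst z \<circ> snd z)) \<le> (exp (2 * barrier_radius * s) * exp (- s * r)) * exp (- s * len (snd z))"
      by (simp add: exp_add[symmetric] algebra_simps)
    then show "?e (fst z \<circ> snd z) \<le> ?c * ?e (snd z)"
      by (simp add: ennreal_mult'[symmetric] ennreal_leI del: comp_apply)
  qed
  also have "\<dots> \<le> (\<integral>\<^sup>+z. ?c * ?e (snd z) \<partial>count_space (F \<times> \<Gamma>))"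
    by (rule count_sum_mono_set) auto
  also have "\<dots> = (\<integral>\<^sup>+f. ?c \<partial>count_space F) * (\<integral>\<^sup>+q. ?e q \<partial>count_space \<Gamma>)"
    using F countable_G by (intro count_sum_Times) (auto intro: countable_finite)
  also have "(\<integral>\<^sup>+f. ?c \<partial>count_space F) = ennreal (exp (2 * barrier_radius * s) * exp (- s * r) * real (card F))"
    using F by (simp add: nn_integral_count_space_finite ennreal_mult' ennreal_of_nat_eq_real_of_nat)
  finally show ?thesis by (simp add: poincare_series_def)
qed

definition horo :: "('a \<Rightarrow> 'a) set \<Rightarrow> real \<Rightarrow> nat \<Rightarrow> ('a \<Rightarrow> 'a) set" where
  "horo H L n = {g \<in> \<Gamma>. \<exists>h\<in>H. 2 * real n \<le> len h \<and> len h < 2 * real n + 2 \<and> dist (h p) (g p) < len g + L}"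

lemma horo_subset:
  fixes b d L :: real
  assumes H: "\<And>h. h \<in> H \<Longrightarrow> geodesic_path (len h) (sg h) p (h p)"
    and m: "5 * K + 3 * (K * K) < m"
    and d: "0 \<le> d" "3 * d \<le> b" and n: "2 * b + 4 * barrier_radius + \<bar>L\<bar> < 2 * real n"
  shows "horo H L n \<subseteq> bad b d \<union> shadowed (\<Union>h\<in>{h \<in> H. 2 * real n \<le> len h \<and> len h < 2 * real n + 2}.
    near_segment (sg h) (len h) (b - 3 * d - barrier_radius))"
proof
  fix g assume "g \<in> horo H L n"
  then obtain h where g: "g \<in> \<Gamma>" and h: "h \<in> H" "2 * real n \<le> len h" "len h < 2 * real n + 2"
    and hg: "dist (h p) (g p) < len g + L" unfolding horo_def by blast
  obtain l \<gamma> where \<gamma>: "geodesic_path l \<gamma> p (g p)" using geodesic by blast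
  have l: "l = len g" by (rule geodesic_path_length[OF \<gamma>])
  have "len h \<le> len g + dist (h p) (g p)" using dist_triangle[of p "h p" "g p"] by (simp add: dist_commute)
  \<comment> \<open>As \<open>h p\<close> is not much farther from \<open>g p\<close> than
    \<open>p\<close> is, \<open>len g\<close> is at least about \<open>n\<close>, and the window
    fits into \<open>[p, g p]\<close>.\<close>
  then have bl: "b \<le> l" using h hg n barrier_radius_pos unfolding l by linarith
  show "g \<in> bad b d \<union> shadowed (\<Union>h\<in>{h \<in> H. 2 * real n \<le> len h \<and> len h < 2 * real n + 2}.
    near_segment (sg h) (len h) (b - 3 * d - barrier_radius))"
    using window[OF g \<gamma> d bl m]
  proof (elim disjE)
    assume "\<exists>f\<in>\<Gamma>. barrier (2 * K) p (g p) f \<and> b - 3 * d - barrier_radius \<le> len f \<and>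
      len f \<le> b + barrier_radius \<and> len f + dist (f p) (g p) \<le> len g + 2 * barrier_radius"
    then obtain f where f: "f \<in> \<Gamma>" and bar: "barrier (2 * K) p (g p) f"
      and lf: "b - 3 * d - barrier_radius \<le> len f" "len f \<le> b + barrier_radius"
      and fg: "len f + dist (f p) (g p) \<le> len g + 2 * barrier_radius" by blast
    obtain l' \<tau> where \<tau>: "geodesic_path l' \<tau> (h p) (g p)" using geodesic by blast
    \<comment> \<open>Passing near \<open>f p\<close> on the way from \<open>h p\<close> to
      \<open>g p\<close> would give \<open>len h < 2 * len f + L + 2 * barrier_radius\<close>; with
      \<open>len f \<le> b + barrier_radius\<close> this contradicts the bound on \<open>b\<close>,
      whence its \<open>4 * barrier_radius\<close>.\<close>
    have "\<not> (0 \<le> t \<and> t \<le> l' \<and> dist (\<tau> t) (f p) \<le> barrier_radius)" for t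
    proof
      assume "0 \<le> t \<and> t \<le> l' \<and> dist (\<tau> t) (f p) \<le> barrier_radius"
      then have "dist (h p) (f p) + dist (f p) (g p) \<le> dist (h p) (g p) + 2 * barrier_radius"
        using geodesic_path_near[OF \<tau>, of t "f p" barrier_radius] by simp
      moreover have "len g \<le> len f + dist (f p) (g p)" by (rule dist_triangle)
      moreover have "len h \<le> len f + dist (h p) (f p)"
        using dist_triangle[of p "h p" "f p"] by (simp add: dist_commute)
      ultimately have "len h < 2 * len f + L + 2 * barrier_radius" using hg by simp
      then show False using h lf(2) n by simp
    qed
    then have "\<exists>t. 0 \<le> t \<and> t \<le> len h \<and> dist (sg h t) (f p) \<le> barrier_radius"
      using barrier_dichotomy[OF f bar H[OF h(1)] \<tau>] by blast
    then have "f \<in> near_segment (sg h) (len h) (b - 3 * d - barrier_radius)"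
      using f lf by (simp add: near_segment_def)
    then have "g \<in> shadowed (\<Union>h\<in>{h \<in> H. 2 * real n \<le> len h \<and> len h < 2 * real n + 2}.
      near_segment (sg h) (len h) (b - 3 * d - barrier_radius))"
      using fg g h unfolding shadowed_def by blast
    then show ?thesis ..
  qed (simp add: bad_def)
qed

text \<open>Convergence at \<sigma> makes the shell counts summable against
  \<open>exp (- 2 * \<sigma> * n)\<close>; the excess of \<theta> over \<open>2 * \<sigma>\<close>
  absorbs the linear factor coming from \<open>card_near_segment\<close>.\<close>

lemma summable_shells:
  assumes "proper_isometric_action H p" and fin: "poincare_series p H \<sigma> < \<infinity>" and \<sigma>: "0 \<le> \<sigma>" "2 * \<sigma> < \<theta>"
  shows "summable (\<lambda>n. real (card {h \<in> H. 2 * real n \<le> len h \<and> len h < 2 * real n + 2}) * (2 * real n + 3) * exp (- \<theta> * real n))"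
proof -
  interpret H: proper_isometric_action H p by (rule assms(1))
  let ?H = "\<lambda>n. {h \<in> H. 2 * real n \<le> len h \<and> len h < 2 * real n + 2}"
  have finH: "finite (?H n)" for n
    by (rule finite_subset[OF _ H.finite_ball[of "2 * real n + 2"]]) auto
  define \<eta> where "\<eta> = \<theta> - 2 * \<sigma>"
  have \<eta>: "0 < \<eta>" using \<sigma> by (simp add: \<eta>_def)
  define x where "x n = real (card (?H n)) * exp (- \<sigma> * (2 * real n + 2))" for n
  have "summable x"
  proof (rule summableI_nonneg_bounded[of _ "enn2real (poincare_series p H \<sigma>)"])
    show "0 \<le> x n" for n by (simp add: x_def)
    fix N
    have "(\<Sum>n<N. x n) \<le> (\<Sum>n<N. \<Sum>h\<in>?H n. exp (- \<sigma> * len h))"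
    proof (rule sum_mono)
      fix n
      have "x n = (\<Sum>h\<in>?H n. exp (- \<sigma> * (2 * real n + 2)))" by (simp add: x_def)
      also have "\<dots> \<le> (\<Sum>h\<in>?H n. exp (- \<sigma> * len h))"
        using \<sigma> by (intro sum_mono) (auto intro: mult_left_mono)
      finally show "x n \<le> (\<Sum>h\<in>?H n. exp (- \<sigma> * len h))" .
    qed
    also have "\<dots> = (\<Sum>h\<in>(\<Union>n<N. ?H n). exp (- \<sigma> * len h))"
    proof (rule sum.UNION_disjoint[symmetric])
      show "\<forall>i\<in>{..<N}. \<forall>j\<in>{..<N}. i \<noteq> j \<longrightarrow> ?H i \<inter> ?H j = {}"
      proof (intro ballI impI)
        fix i j :: nat assume "i \<noteq> j"
        then have "real i + 1 \<le> real j \<or> real j + 1 \<le> real i" by linarith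
        then show "?H i \<inter> ?H j = {}" by auto
      qed
    qed (use finH in auto)
    finally have le: "(\<Sum>n<N. x n) \<le> (\<Sum>h\<in>(\<Union>n<N. ?H n). exp (- \<sigma> * len h))" .
    have "finite (\<Union>n<N. ?H n)" using finH by auto
    then have "ennreal (\<Sum>h\<in>(\<Union>n<N. ?H n). exp (- \<sigma> * len h)) = poincare_series p (\<Union>n<N. ?H n) \<sigma>"
      by (simp add: poincare_series_def nn_integral_count_space_finite sum_ennreal)
    also have "\<dots> \<le> poincare_series p H \<sigma>" by (rule H.poincare_series_mono) auto
    finally have "enn2real (ennreal (\<Sum>h\<in>(\<Union>n<N. ?H n). exp (- \<sigma> * len h))) \<le> enn2real (poincare_series p H \<sigma>)"
      using fin by (intro enn2real_mono) auto
    then show "(\<Sum>n<N. x n) \<le> enn2real (poincare_series p H \<sigma>)"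
      using le by (simp add: sum_nonneg)
  qed
  then have sm: "summable (\<lambda>n. exp (2 * \<sigma>) * (2 / \<eta> + 3) * x n)" by (rule summable_mult)
  show ?thesis
  proof (rule summable_comparison_test'[OF sm, of 0])
    fix n :: nat
    have "\<eta> * real n \<le> exp (\<eta> * real n)" using exp_ge_add_one_self[of "\<eta> * real n"] by linarith
    then have "2 * real n \<le> 2 / \<eta> * exp (\<eta> * real n)" using \<eta> by (simp add: field_simps)
    moreover have "1 \<le> exp (\<eta> * real n)" using \<eta> by simp
    ultimately have "2 * real n + 3 \<le> (2 / \<eta> + 3) * exp (\<eta> * real n)"
      unfolding distrib_right by linarith
    then have "(2 * real n + 3) * exp (- \<theta> * real n) \<le> (2 / \<eta> + 3) * exp (\<eta> * real n) * exp (- \<theta> * real n)"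
      by (rule mult_right_mono) simp
    also have "\<dots> = exp (2 * \<sigma>) * (2 / \<eta> + 3) * exp (- \<sigma> * (2 * real n + 2))"
      by (simp add: \<eta>_def mult_exp_exp algebra_simps)
    finally have "real (card (?H n)) * ((2 * real n + 3) * exp (- \<theta> * real n)) \<le>
      real (card (?H n)) * (exp (2 * \<sigma>) * (2 / \<eta> + 3) * exp (- \<sigma> * (2 * real n + 2)))"
      by (rule mult_left_mono) simp
    then show "norm (real (card (?H n)) * (2 * real n + 3) * exp (- \<theta> * real n)) \<le> exp (2 * \<sigma>) * (2 / \<eta> + 3) * x n"
      by (simp add: x_def mult.assoc mult.left_commute abs_mult)
  qed
qed

theorem horospheric_estimate:
  fixes L :: real
  assumes H: "proper_isometric_action H p" and \<sigma>: "0 \<le> \<sigma>" "2 * \<sigma> < \<omega>" "poincare_series p H \<sigma> < \<infinity>"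
    and s0: "0 \<le> s0" "s0 < \<omega>" "poincare_series p BF s0 < \<infinity>"
    and fin: "\<And>s. \<omega> < s \<Longrightarrow> poincare_series p \<Gamma> s < \<infinity>"
    and m: "5 * K + 3 * (K * K) < m"
  shows "\<exists>a n0. (\<forall>n. 0 \<le> a n) \<and> summable a \<and> (\<forall>n\<ge>n0. \<forall>s. \<omega> < s \<longrightarrow> s \<le> \<omega> + 1 \<longrightarrow>
    poincare_series p (horo H L n) s \<le> ennreal (a n) * poincare_series p \<Gamma> s)"
proof -
  interpret H: proper_isometric_action H p by (rule H)
  have \<omega>: "0 < \<omega>" using \<sigma> by linarith
  obtain s1 where s1: "0 \<le> s1" "s1 < \<omega>" "poincare_series p (V \<union> BF) s1 < \<infinity>"
    using poincare_series_unbarred_subcritical[OF s0 fin] by blast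
  \<comment> \<open>\<open>c\<close> is the exponential gain per unit length of a long piece. With
    \<open>b n = (1 - \<epsilon>) * n\<close> and \<open>d n = \<epsilon> / 2 * n\<close> a barrier
    has length at least \<open>(1 - 5 / 2 * \<epsilon>) * n - D\<close>, and \<epsilon> is chosen so
    that this factor times \<omega> is \<theta>, the midpoint of \<open>2 * \<sigma>\<close> and
    \<omega>. A long piece gains \<open>c * d n = 2 * \<delta> * n\<close>, against a cost of at
    most \<open>\<delta> * n\<close> for the initial piece, up to constants.\<close>
  define c where "c = \<omega> - s1"
  define \<epsilon> where "\<epsilon> = (\<omega> - 2 * \<sigma>) / (5 * \<omega>)"
  define \<delta> where "\<delta> = c * \<epsilon> / 4"
  define \<theta> where "\<theta> = (\<omega> + 2 * \<sigma>) / 2"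
  have c: "0 < c" and \<epsilon>: "0 < \<epsilon>" "\<epsilon> \<le> 1 / 5" using s1 \<sigma> \<omega> by (auto simp: c_def \<epsilon>_def field_simps)
  then have \<delta>: "0 < \<delta>" by (simp add: \<delta>_def)
  have \<theta>: "2 * \<sigma> < \<theta>" "\<theta> = \<omega> * (1 - 5 / 2 * \<epsilon>)" using \<sigma> \<omega> by (auto simp: \<theta>_def \<epsilon>_def field_simps)
  define D where "D = real_of_int barrier_radius"
  have D: "0 < D" using barrier_radius_pos by (simp add: D_def)
  define b where "b n = (1 - \<epsilon>) * real n" for n
  define d where "d n = \<epsilon> / 2 * real n" for n
  define r where "r n = b n - 3 * d n - D" for n
  have bd: "0 \<le> d n" "3 * d n \<le> b n" "b n \<le> real n" for n
  proof -
    show "0 \<le> d n" using \<epsilon> by (simp add: d_def)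
    have "3 * (\<epsilon> / 2) * real n \<le> (1 - \<epsilon>) * real n" using \<epsilon> by (intro mult_right_mono) auto
    then show "3 * d n \<le> b n" by (simp add: b_def d_def)
    have "(1 - \<epsilon>) * real n \<le> 1 * real n" using \<epsilon> by (intro mult_right_mono) auto
    then show "b n \<le> real n" by (simp add: b_def)
  qed
  have r: "r n = (1 - 5 / 2 * \<epsilon>) * real n - D" for n by (simp add: r_def b_def d_def algebra_simps)
  obtain X where X: "0 \<le> X" "poincare_series p \<Gamma> (\<omega> + \<delta>) = ennreal X"
    using fin[of "\<omega> + \<delta>"] \<delta> by (cases "poincare_series p \<Gamma> (\<omega> + \<delta>)") auto
  obtain Y where Y: "0 \<le> Y" "poincare_series p (V \<union> BF) s1 = ennreal Y"
    using s1(3) by (cases "poincare_series p (V \<union> BF) s1") auto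
  obtain sg where sg: "\<And>h. geodesic_path (len h) (sg h) p (h p)"
  proof -
    have "\<exists>\<sigma>. geodesic_path (len h) \<sigma> p (h p)" for h
      using geodesic[of p "h p"] geodesic_path_length by metis
    then show thesis using that by metis
  qed
  define Hn where "Hn n = {h \<in> H. 2 * real n \<le> len h \<and> len h < 2 * real n + 2}" for n
  have finH: "finite (Hn n)" for n
    unfolding Hn_def by (rule finite_subset[OF _ H.finite_ball[of "2 * real n + 2"]]) auto
  define F where "F n = (\<Union>h\<in>Hn n. near_segment (sg h) (len h) (r n))" for n
  have F: "finite (F n)" "F n \<subseteq> \<Gamma>" "\<And>f. f \<in> F n \<Longrightarrow> r n \<le> len f" for n
    using finH card_near_segment(1)[OF sg] by (auto simp: F_def near_segment_def)
  define c1 where "c1 = real (card {g \<in> \<Gamma>. len g \<le> 2 * (real_of_int barrier_radius + 1)})"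
  have c1: "0 \<le> c1" by (simp add: c1_def)
  have cardF: "real (card (F n)) \<le> real (card (Hn n)) * (2 * real n + 3) * c1" for n
  proof -
    have "real (card (F n)) \<le> real (\<Sum>h\<in>Hn n. card (near_segment (sg h) (len h) (r n)))"
      unfolding F_def by (intro of_nat_mono card_UN_le finH)
    also have "\<dots> = (\<Sum>h\<in>Hn n. real (card (near_segment (sg h) (len h) (r n))))" by simp
    also have "\<dots> \<le> (\<Sum>h\<in>Hn n. (2 * real n + 3) * c1)"
    proof (rule sum_mono)
      fix h assume "h \<in> Hn n"
      then have "(len h + 1) * c1 \<le> (2 * real n + 3) * c1"
        using c1 by (intro mult_right_mono) (auto simp: Hn_def)
      then show "real (card (near_segment (sg h) (len h) (r n))) \<le> (2 * real n + 3) * c1"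
        using card_near_segment(2)[OF sg, of h "r n"] by (simp add: c1_def)
    qed
    finally show ?thesis by (simp add: mult.assoc)
  qed
  define A1 where "A1 = exp (4 * M * (\<omega> + 1)) * (exp (\<delta> * M) * X) * (exp (2 * c * M) * Y)"
  define A2 where "A2 = exp (2 * D * (\<omega> + 1)) * exp (\<omega> * D) * c1"
  have A: "0 \<le> A1" "0 \<le> A2" using X Y c1 by (auto simp: A1_def A2_def)
  define a where "a n = A1 * exp (- \<delta>) ^ n + A2 * (real (card (Hn n)) * (2 * real n + 3) * exp (- \<theta> * real n))" for n
  have "summable a"
    unfolding a_def Hn_def using \<delta>
    by (intro summable_add summable_mult summable_geometric summable_shells[OF H \<sigma>(3,1) \<theta>(1)]) simp
  moreover have "0 \<le> a n" for n using A by (simp add: a_def)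
  \<comment> \<open>From \<open>n0\<close> on \<open>\<epsilon> * n\<close> exceeds
    \<open>4 * D + \<bar>L\<bar>\<close>, which gives both the length condition of
    \<open>horo_subset\<close> and \<open>0 \<le> r n\<close>.\<close>
  moreover define n0 where "n0 = nat \<lceil>(4 * D + \<bar>L\<bar> + 1) / \<epsilon>\<rceil>"
  have "poincare_series p (horo H L n) s \<le> ennreal (a n) * poincare_series p \<Gamma> s"
    if n: "n0 \<le> n" and s: "\<omega> < s" "s \<le> \<omega> + 1" for n s
  proof -
    have "(4 * D + \<bar>L\<bar> + 1) / \<epsilon> \<le> real n" using n by (simp add: n0_def nat_le_iff ceiling_le_iff)
    then have n: "4 * D + \<bar>L\<bar> + 1 \<le> \<epsilon> * real n" using \<epsilon> by (simp add: field_simps)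
    have "\<epsilon> * real n \<le> 1 / 5 * real n" using \<epsilon> by (intro mult_right_mono) auto
    then have rpos: "0 \<le> r n" using n D \<epsilon> by (simp add: r algebra_simps)
    have s0': "0 \<le> s" using s \<omega> by simp
    have "2 * b n + 4 * barrier_radius + \<bar>L\<bar> < 2 * real n"
      using n D by (simp add: b_def D_def algebra_simps)
    then have "horo H L n \<subseteq> bad (b n) (d n) \<union> shadowed (F n)"
      unfolding F_def Hn_def r_def D_def by (intro horo_subset sg m bd)
    then have "poincare_series p (horo H L n) s \<le> poincare_series p (bad (b n) (d n)) s + poincare_series p (shadowed (F n)) s"
      by (rule order_trans[OF poincare_series_mono poincare_series_Un])
    also have "\<dots> \<le> ennreal (A1 * exp (- \<delta>) ^ n) * poincare_series p \<Gamma> s +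
      ennreal (A2 * (real (card (Hn n)) * (2 * real n + 3) * exp (- \<theta> * real n))) * poincare_series p \<Gamma> s"
    proof (rule add_mono)
      \<comment> \<open>A bound uniform in \<open>s\<close>: the truncated series is compared at
        \<omega> and then moved to the exponent \<open>\<omega> + \<delta>\<close>, where the series
        of \<Gamma> converges.\<close>
      have "poincare_series p {f \<in> \<Gamma>. len f \<le> b n + M} s \<le> poincare_series p {f \<in> \<Gamma>. len f \<le> b n + M} \<omega>"
        using s by (intro poincare_series_antimono) simp
      also have "\<dots> \<le> ennreal (exp ((\<omega> + \<delta> - \<omega>) * (b n + M))) * poincare_series p {f \<in> \<Gamma>. len f \<le> b n + M} (\<omega> + \<delta>)"
        using \<delta> by (intro poincare_series_head) auto
      also have "\<dots> \<le> ennreal (exp (\<delta> * (b n + M))) * ennreal X"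
        unfolding X(2)[symmetric] by (intro mult_mono poincare_series_mono) auto
      finally have 1: "poincare_series p {f \<in> \<Gamma>. len f \<le> b n + M} s \<le> ennreal (exp (\<delta> * (b n + M)) * X)"
        using X by (simp add: ennreal_mult')
      have "poincare_series p {w \<in> V \<union> BF. d n - 2 * M \<le> len w} s \<le> poincare_series p {w \<in> V \<union> BF. d n - 2 * M \<le> len w} \<omega>"
        using s by (intro poincare_series_antimono) simp
      also have "\<dots> \<le> ennreal (exp (- (\<omega> - s1) * (d n - 2 * M))) * poincare_series p {w \<in> V \<union> BF. d n - 2 * M \<le> len w} s1"
        using s1 by (intro poincare_series_tail) auto
      also have "\<dots> \<le> ennreal (exp (- c * (d n - 2 * M))) * ennreal Y"
        unfolding Y(2)[symmetric] c_def by (intro mult_mono poincare_series_mono) auto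
      finally have 2: "poincare_series p {w \<in> V \<union> BF. d n - 2 * M \<le> len w} s \<le> ennreal (exp (- c * (d n - 2 * M)) * Y)"
        using Y by (simp add: ennreal_mult')
      have "poincare_series p (bad (b n) (d n)) s \<le> ennreal (exp (4 * M * s)) *
        (poincare_series p {f \<in> \<Gamma>. len f \<le> b n + M} s * (poincare_series p {w \<in> V \<union> BF. d n - 2 * M \<le> len w} s *
          poincare_series p \<Gamma> s))"
        by (rule poincare_series_bad[OF s0'])
      also have "\<dots> \<le> ennreal (exp (4 * M * (\<omega> + 1))) * (ennreal (exp (\<delta> * (b n + M)) * X) *
        (ennreal (exp (- c * (d n - 2 * M)) * Y) * poincare_series p \<Gamma> s))"
        using s M by (intro mult_mono 1 2 ennreal_leI) auto
      also have "\<dots> = ennreal (exp (4 * M * (\<omega> + 1)) * (exp (\<delta> * (b n + M)) * X) * (exp (- c * (d n - 2 * M)) * Y)) * poincare_series p \<Gamma> s"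
        using X Y by (simp add: ennreal_mult' mult.assoc)
      also have "\<dots> \<le> ennreal (A1 * exp (- \<delta>) ^ n) * poincare_series p \<Gamma> s"
      proof (intro mult_right_mono ennreal_leI)
        have "\<delta> * b n \<le> \<delta> * real n" using bd \<delta> by (intro mult_left_mono) auto
        moreover have "c * d n = 2 * (\<delta> * real n)" by (simp add: d_def \<delta>_def)
        ultimately have "\<delta> * (b n + M) + - c * (d n - 2 * M) \<le> \<delta> * M + 2 * c * M + - \<delta> * real n"
          by (simp add: algebra_simps)
        then have "exp (\<delta> * (b n + M)) * exp (- c * (d n - 2 * M)) \<le> exp (\<delta> * M) * exp (2 * c * M) * exp (- \<delta>) ^ n"
          by (simp add: exp_add[symmetric] exp_of_nat_mult[symmetric] mult.commute)
        then have "(exp (\<delta> * (b n + M)) * exp (- c * (d n - 2 * M))) * (exp (4 * M * (\<omega> + 1)) * X * Y)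
          \<le> (exp (\<delta> * M) * exp (2 * c * M) * exp (- \<delta>) ^ n) * (exp (4 * M * (\<omega> + 1)) * X * Y)"
          using X Y by (intro mult_right_mono) auto
        then show "exp (4 * M * (\<omega> + 1)) * (exp (\<delta> * (b n + M)) * X) * (exp (- c * (d n - 2 * M)) * Y) \<le> A1 * exp (- \<delta>) ^ n"
          by (simp only: A1_def mult_ac)
      qed simp
      finally show "poincare_series p (bad (b n) (d n)) s \<le> ennreal (A1 * exp (- \<delta>) ^ n) * poincare_series p \<Gamma> s" .
      have "poincare_series p (shadowed (F n)) s \<le>
          ennreal (exp (2 * barrier_radius * s) * exp (- s * r n) * real (card (F n))) * poincare_series p \<Gamma> s"
        by (rule poincare_series_shadowed) (use s0' F in auto)
      also have "\<dots> \<le> ennreal (A2 * (real (card (Hn n)) * (2 * real n + 3) * exp (- \<theta> * real n))) * poincare_series p \<Gamma> s"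
      proof (intro mult_right_mono ennreal_leI)
        have "D * s \<le> D * (\<omega> + 1)" using D s by (intro mult_left_mono) auto
        then have e1: "exp (2 * barrier_radius * s) \<le> exp (2 * D * (\<omega> + 1))" by (simp add: D_def)
        \<comment> \<open>The sign of \<open>r n\<close> matters: it allows \<open>s\<close> to be
          replaced by \<omega> uniformly.\<close>
        have "\<omega> * r n \<le> s * r n" using s rpos by (intro mult_right_mono) auto
        then have e2: "exp (- s * r n) \<le> exp (\<omega> * D) * exp (- \<theta> * real n)"
          by (simp add: exp_add[symmetric] r \<theta>(2) algebra_simps)
        have "exp (2 * barrier_radius * s) * exp (- s * r n) * real (card (F n)) \<le>
          exp (2 * D * (\<omega> + 1)) * (exp (\<omega> * D) * exp (- \<theta> * real n)) * (real (card (Hn n)) * (2 * real n + 3) * c1)"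
          using e1 e2 cardF by (intro mult_mono) auto
        then show "exp (2 * barrier_radius * s) * exp (- s * r n) * real (card (F n)) \<le>
          A2 * (real (card (Hn n)) * (2 * real n + 3) * exp (- \<theta> * real n))"
          by (simp only: A2_def mult_ac)
      qed simp
      finally show "poincare_series p (shadowed (F n)) s \<le>
        ennreal (A2 * (real (card (Hn n)) * (2 * real n + 3) * exp (- \<theta> * real n))) * poincare_series p \<Gamma> s" .
    qed
    also have "\<dots> = ennreal (a n) * poincare_series p \<Gamma> s"
      using A unfolding a_def by (subst ennreal_plus) (auto simp: distrib_right)
    finally show ?thesis .
  qed
  ultimately show ?thesis by (intro exI[of _ a] exI[of _ n0]) blast
qed

end

section \<open>Horospherical regions in the compactification\<close>

text \<open>
  The largest open set whose trace on \<open>X\<close> lies in \<open>{z. dist x z - dist y z < L}\<close>; on the boundary it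
  replaces the sublevel set of the upper semicontinuous function
  \<open>\<xi> \<mapsto> limsup (dist x z - dist y z)\<close> for \<open>z\<close> tending to \<open>\<xi>\<close>.
\<close>

definition horo_region :: "('x::metric_space \<Rightarrow> 'b::metric_space) \<Rightarrow> 'x \<Rightarrow> 'x \<Rightarrow> real \<Rightarrow> 'b set" where
  "horo_region \<iota> x y L = \<Union>{U. open U \<and> (\<forall>z. \<iota> z \<in> U \<longrightarrow> dist x z - dist y z < L)}"

lemma open_horo_region [simp]: "open (horo_region \<iota> x y L)"
  unfolding horo_region_def by blast

lemma horo_regionI:
  "open U \<Longrightarrow> \<xi> \<in> U \<Longrightarrow> (\<And>z. \<iota> z \<in> U \<Longrightarrow> dist x z - dist y z < L) \<Longrightarrow> \<xi> \<in> horo_region \<iota> x y L"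
  unfolding horo_region_def by blast

lemma horo_regionE:
  assumes "\<xi> \<in> horo_region \<iota> x y L"
  obtains U where "open U" "\<xi> \<in> U" "\<And>z. \<iota> z \<in> U \<Longrightarrow> dist x z - dist y z < L"
  using assms unfolding horo_region_def by blast

lemma horo_region_mono: "\<xi> \<in> horo_region \<iota> x y L \<Longrightarrow> L \<le> L' \<Longrightarrow> \<xi> \<in> horo_region \<iota> x y L'"
  by (erule horo_regionE) (force intro: horo_regionI)

text \<open>Otherwise there is a sequence converging to \<open>\<xi>\<close> itself on which
  \<open>f\<close> stays at least \<open>c'\<close>; by reflexivity it tends to the class of
  \<open>\<xi>\<close> and so contributes to the limsup.\<close>

lemma class_limsup_less:
  fixes \<iota> :: "'x::metric_space \<Rightarrow> 'b::metric_space"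
  assumes le: "class_limsup \<iota> R \<xi> f \<le> ereal c" and c: "c < c'" and refl: "(\<xi>, \<xi>) \<in> R"
  shows "\<exists>U. open U \<and> \<xi> \<in> U \<and> (\<forall>z. \<iota> z \<in> U \<longrightarrow> f z < c')"
proof (rule ccontr)
  assume *: "\<not> ?thesis"
  have "\<exists>z. \<iota> z \<in> ball \<xi> (1 / real (Suc n)) \<and> c' \<le> f z" for n
  proof (rule ccontr)
    assume "\<not> ?thesis"
    then have "\<forall>z. \<iota> z \<in> ball \<xi> (1 / real (Suc n)) \<longrightarrow> f z < c'" by (meson not_le)
    then have "open (ball \<xi> (1 / real (Suc n))) \<and> \<xi> \<in> ball \<xi> (1 / real (Suc n)) \<and>
      (\<forall>z. \<iota> z \<in> ball \<xi> (1 / real (Suc n)) \<longrightarrow> f z < c')" by simp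
    then show False using * by blast
  qed
  then obtain z where z: "\<And>n. \<iota> (z n) \<in> ball \<xi> (1 / real (Suc n))" "\<And>n. c' \<le> f (z n)" by metis
  have lim: "(\<lambda>n. \<iota> (z n)) \<longlonglongrightarrow> \<xi>"
  proof (rule tendstoI)
    fix e :: real assume "0 < e"
    then have "\<forall>\<^sub>F n in sequentially. 1 / real (Suc n) < e"
      using order_tendstoD(2)[OF LIMSEQ_inverse_real_of_nat, of e] by (simp add: inverse_eq_divide)
    then show "\<forall>\<^sub>F n in sequentially. dist (\<iota> (z n)) \<xi> < e"
    proof eventually_elim
      case (elim n)
      then show ?case using z(1)[of n] by (simp add: dist_commute)
    qed
  qed
  have "tends_to_class \<iota> R z \<xi>"
    unfolding tends_to_class_def
  proof (intro allI impI, elim conjE)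
    fix r l assume "strict_mono (r :: nat \<Rightarrow> nat)" "(\<lambda>n. \<iota> (z (r n))) \<longlonglongrightarrow> l"
    then have "l = \<xi>"
      using LIMSEQ_unique[OF _ LIMSEQ_subseq_LIMSEQ[OF lim, unfolded o_def]] by simp
    then show "l \<in> R `` {\<xi>}" using refl by simp
  qed
  then have "limsup (\<lambda>n. ereal (f (z n))) \<le> class_limsup \<iota> R \<xi> f"
    unfolding class_limsup_def by (intro SUP_upper) simp
  moreover have "ereal c' \<le> limsup (\<lambda>n. ereal (f (z n)))"
    using z(2) by (intro le_Limsup) auto
  ultimately have "ereal c' \<le> ereal c" using le by (meson order_trans)
  then show False using c by simp
qed

lemma horoball_horo_region:
  assumes "q \<in> horoball p \<iota> R \<xi> L" "(\<xi>, \<xi>) \<in> R"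
  shows "\<xi> \<in> horo_region \<iota> q p (L + 1)"
proof -
  have "class_limsup \<iota> R \<xi> (\<lambda>z. dist q z - dist p z) \<le> ereal L"
    using assms(1) by (simp add: horoball_def class_busemann_def)
  from class_limsup_less[OF this _ assms(2), of "L + 1"] show ?thesis
    by (auto intro: horo_regionI)
qed


section \<open>Upper bounds for weak limits of orbit measures\<close>

text \<open>The half of the portmanteau theorem for open sets; the continuous functions
  \<open>f k\<close> increase to the indicator of \<open>U\<close>.\<close>

lemma weak_limit_open_le:
  fixes \<mu> :: "'b::metric_space measure"
  assumes lim: "weak_limit \<nu> \<mu>" and sets: "sets \<mu> = sets borel" "\<And>i. sets (\<nu> i) = sets borel"
    and fin: "finite_measure \<mu>" and U: "open U"
    and ev: "\<forall>\<^sub>F i in sequentially. emeasure (\<nu> i) U \<le> ennreal a" and a: "0 \<le> a"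
  shows "emeasure \<mu> U \<le> ennreal a"
proof -
  interpret finite_measure \<mu> by (rule fin)
  \<comment> \<open>For \<open>U = UNIV\<close> the complement is empty and \<open>infdist\<close>
    has the value 0, hence the separate case.\<close>
  define f where "f k x = (if U = UNIV then 1 else min 1 (real k * infdist x (- U)))" for k x
  have cont: "continuous_on UNIV (f k)" for k
    unfolding f_def by (cases "U = UNIV") (auto intro!: continuous_intros)
  have f: "0 \<le> f k x" "f k x \<le> indicator U x" for k x
  proof -
    show "0 \<le> f k x" by (simp add: f_def infdist_nonneg)
    show "f k x \<le> indicator U x" by (cases "x \<in> U") (auto simp: f_def)
  qed
  have f1: "f k x \<le> 1" for k x using f(2)[of k x] by (auto split: split_indicator_asm)
  have meas: "f k \<in> borel_measurable \<mu>" for k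
    by (subst measurable_cong_sets[OF sets(1) refl]) (rule borel_measurable_continuous_onI[OF cont])
  have mono: "f k x \<le> f (Suc k) x" for k x
  proof -
    have "real k * infdist x (- U) \<le> real (Suc k) * infdist x (- U)"
      by (intro mult_right_mono infdist_nonneg) simp
    from min.mono[OF order_refl this, of 1] show ?thesis by (simp add: f_def)
  qed
  have "(SUP k. ennreal (f k x)) = indicator U x" for x
  proof (cases "x \<in> U \<and> U \<noteq> UNIV")
    case True
    then have pos: "0 < infdist x (- U)"
      using U by (metis ComplD closed_Compl double_complement compl_bot_eq in_closed_iff_infdist_zero infdist_nonneg less_le)
    obtain k :: nat where "1 / infdist x (- U) \<le> real k" using real_arch_simple by blast
    then have "f k x = 1" using True pos by (simp add: f_def field_simps min_def)
    then have "1 \<le> (SUP k. ennreal (f k x))" by (intro SUP_upper2[of k]) auto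
    moreover have "(SUP k. ennreal (f k x)) \<le> 1" using f1 by (intro SUP_least) (simp add: ennreal_le_1)
    ultimately have "(SUP k. ennreal (f k x)) = 1" by (intro antisym)
    then show ?thesis using True by simp
  next
    case False
    then have "f k x = indicator U x" for k using f[of k x] by (cases "x \<in> U") (auto simp: f_def)
    then show ?thesis by (simp split: split_indicator)
  qed
  then have "emeasure \<mu> U = (\<integral>\<^sup>+x. (SUP k. ennreal (f k x)) \<partial>\<mu>)"
    using U sets by simp
  also have "\<dots> = (SUP k. \<integral>\<^sup>+x. ennreal (f k x) \<partial>\<mu>)"
    using mono meas by (intro nn_integral_monotone_convergence_SUP incseq_SucI) (auto simp: le_fun_def intro: ennreal_leI)
  also have "\<dots> \<le> ennreal a"
  proof (rule SUP_least)
    fix k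
    have "bounded (range (f k))"
      using f(1)[of k] f1[of k] by (intro boundedI[of _ 1]) (auto simp: abs_le_iff intro: order_trans[of _ 0])
    then have "(\<lambda>i. integral\<^sup>L (\<nu> i) (f k)) \<longlonglongrightarrow> integral\<^sup>L \<mu> (f k)"
      using lim cont unfolding weak_limit_def by blast
    moreover have "\<forall>\<^sub>F i in sequentially. integral\<^sup>L (\<nu> i) (f k) \<le> a"
      using ev
    proof eventually_elim
      case (elim i)
      have "ennreal (integral\<^sup>L (\<nu> i) (f k)) \<le> (\<integral>\<^sup>+x. ennreal (f k x) \<partial>\<nu> i)"
      \<comment> \<open>The \<open>\<nu> i\<close> are not assumed finite; a function that is not
        integrable has integral 0, which satisfies the bound.\<close>
      proof (cases "integrable (\<nu> i) (f k)")
        case True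
        then show ?thesis using f by (simp add: nn_integral_eq_integral)
      next
        case False
        then show ?thesis by (simp add: not_integrable_integral_eq)
      qed
      also have "\<dots> \<le> (\<integral>\<^sup>+x. indicator U x \<partial>\<nu> i)"
      proof (rule nn_integral_mono)
        fix x
        show "ennreal (f k x) \<le> indicator U x"
          using f(2)[of k x] by (cases "x \<in> U") (auto simp: ennreal_le_1 f1 ennreal_neg)
      qed
      also have "\<dots> = emeasure (\<nu> i) U" using U sets by simp
      finally have "ennreal (integral\<^sup>L (\<nu> i) (f k)) \<le> ennreal a" using elim by (rule order_trans)
      then show ?case using a by simp
    qed
    ultimately have "integral\<^sup>L \<mu> (f k) \<le> a"
      by (rule tendsto_upperbound) simp
    moreover have "integrable \<mu> (f k)"
      using meas f f1 by (intro integrable_const_bound[of _ 1]) (auto simp: abs_le_iff intro: order_trans[of _ 0])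
    ultimately show "(\<integral>\<^sup>+x. ennreal (f k x) \<partial>\<mu>) \<le> ennreal a"
      using f by (simp add: nn_integral_eq_integral ennreal_leI)
  qed
  finally show ?thesis .
qed

lemma sets_orbit_measure [simp]: "sets (orbit_measure p \<iota> \<Gamma> s x) = sets borel"
  by (simp add: orbit_measure_def)

lemma emeasure_orbit_measure:
  assumes "U \<in> sets borel"
  shows "emeasure (orbit_measure p \<iota> \<Gamma> s p) U =
    poincare_series p {g \<in> \<Gamma>. \<iota> (g p) \<in> U} s / poincare_series p \<Gamma> s"
proof -
  let ?P = "poincare_series p \<Gamma> s" and ?e = "\<lambda>g. ennreal (exp (- s * dist p (g p)))"
  let ?A = "{g \<in> \<Gamma>. \<iota> (g p) \<in> U}"
  have "emeasure (orbit_measure p \<iota> \<Gamma> s p) U =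
      emeasure (density (count_space \<Gamma>) (\<lambda>g. ?e g / ?P)) ?A"
    unfolding orbit_measure_def using assms
    by (subst emeasure_distr) (auto intro!: arg_cong2[where f = emeasure])
  also have "\<dots> = (\<integral>\<^sup>+g. ?e g / ?P * indicator ?A g \<partial>count_space \<Gamma>)"
    by (subst emeasure_density) auto
  also have "\<dots> = (\<integral>\<^sup>+g. ?e g * indicator ?A g / ?P \<partial>count_space \<Gamma>)"
    by (intro nn_integral_cong) (auto split: split_indicator)
  also have "\<dots> = (\<integral>\<^sup>+g. ?e g * indicator ?A g \<partial>count_space \<Gamma>) / ?P"
    by (rule nn_integral_divide) simp
  also have "(\<integral>\<^sup>+g. ?e g * indicator ?A g \<partial>count_space \<Gamma>) = (\<integral>\<^sup>+g. ?e g \<partial>count_space ?A)"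
    unfolding count_sum_indicator[of \<Gamma>] count_sum_indicator[of ?A]
    by (intro nn_integral_cong) (auto split: split_indicator)
  finally show ?thesis by (simp add: poincare_series_def)
qed

context scc_axis
begin

text \<open>The union \<open>U n\<close> of the regions of the n-th shell is open, and the orbit
  points in it belong to \<open>horo H L n\<close>. After division by the Poincare series the
  estimate therefore bounds \<open>emeasure \<mu> (U n)\<close> by \<open>a n\<close>, which is
  summable.\<close>

theorem horospheric_null:
  fixes \<iota> :: "'a \<Rightarrow> 'b::metric_space" and L :: real
  assumes H: "proper_isometric_action H p" and \<sigma>: "0 \<le> \<sigma>" "2 * \<sigma> < \<omega>" "poincare_series p H \<sigma> < \<infinity>"
    and s0: "0 \<le> s0" "s0 < \<omega>" "poincare_series p BF s0 < \<infinity>"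
    and fin: "\<And>s. \<omega> < s \<Longrightarrow> poincare_series p \<Gamma> s < \<infinity>"
    and m: "5 * K + 3 * (K * K) < m"
    and \<mu>: "sets \<mu> = sets borel" "finite_measure \<mu>"
    and si: "\<And>i. \<omega> < s i" "s \<longlonglongrightarrow> \<omega>" and lim: "weak_limit (\<lambda>i. orbit_measure p \<iota> \<Gamma> (s i) p) \<mu>"
  shows "\<exists>Z\<in>null_sets \<mu>. {\<xi>. infinite {h \<in> H. \<xi> \<in> horo_region \<iota> (h p) p L}} \<subseteq> Z"
proof -
  interpret H: proper_isometric_action H p by (rule H)
  interpret \<mu>: finite_measure \<mu> by (rule \<mu>(2))
  have "\<exists>a n0. (\<forall>n. 0 \<le> a n) \<and> summable a \<and> (\<forall>n\<ge>n0. \<forall>s. \<omega> < s \<longrightarrow> s \<le> \<omega> + 1 \<longrightarrow>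
      poincare_series p (horo H L n) s \<le> ennreal (a n) * poincare_series p \<Gamma> s)"
    by (rule horospheric_estimate[OF H \<sigma> s0 _ m]) (rule fin)
  then obtain a n0 where an: "(\<forall>n. 0 \<le> a n) \<and> summable a \<and> (\<forall>n\<ge>n0. \<forall>s. \<omega> < s \<longrightarrow> s \<le> \<omega> + 1 \<longrightarrow>
      poincare_series p (horo H L n) s \<le> ennreal (a n) * poincare_series p \<Gamma> s)"
    by (elim exE)
  then have a: "\<And>n. 0 \<le> a n" "summable a"
    and est: "\<And>n s. n0 \<le> n \<Longrightarrow> \<omega> < s \<Longrightarrow> s \<le> \<omega> + 1 \<Longrightarrow>
      poincare_series p (horo H L n) s \<le> ennreal (a n) * poincare_series p \<Gamma> s"
    by simp_all
  define U where "U n = (\<Union>h\<in>{h \<in> H. 2 * real n \<le> len h \<and> len h < 2 * real n + 2}. horo_region \<iota> (h p) p L)" for n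
  have U: "open (U n)" for n unfolding U_def by auto
  have bound: "emeasure \<mu> (U n) \<le> ennreal (a n)" if n: "n0 \<le> n" for n
  proof (rule weak_limit_open_le[OF lim \<mu>(1) _ \<mu>(2) U _ a(1)])
    have "\<forall>\<^sub>F i in sequentially. s i < \<omega> + 1" using order_tendstoD(2)[OF si(2), of "\<omega> + 1"] by simp
    then show "\<forall>\<^sub>F i in sequentially. emeasure (orbit_measure p \<iota> \<Gamma> (s i) p) (U n) \<le> ennreal (a n)"
    proof eventually_elim
      case (elim i)
      let ?P = "poincare_series p \<Gamma> (s i)"
      have "{g \<in> \<Gamma>. \<iota> (g p) \<in> U n} \<subseteq> horo H L n"
      proof clarify
        fix g assume g: "g \<in> \<Gamma>" "\<iota> (g p) \<in> U n"
        then obtain h where h: "h \<in> H" "2 * real n \<le> len h" "len h < 2 * real n + 2"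
          "\<iota> (g p) \<in> horo_region \<iota> (h p) p L" by (auto simp: U_def)
        from h(4) have "dist (h p) (g p) - dist p (g p) < L" by (rule horo_regionE)
        then show "g \<in> horo H L n" using g h unfolding horo_def by force
      qed
      then have "poincare_series p {g \<in> \<Gamma>. \<iota> (g p) \<in> U n} (s i) \<le> poincare_series p (horo H L n) (s i)"
        by (rule poincare_series_mono)
      also have "\<dots> \<le> ennreal (a n) * ?P" using est[OF n si(1), of i] elim by simp
      finally have "poincare_series p {g \<in> \<Gamma>. \<iota> (g p) \<in> U n} (s i) \<le> ennreal (a n) * ?P" .
      then have "poincare_series p {g \<in> \<Gamma>. \<iota> (g p) \<in> U n} (s i) / ?P \<le> ennreal (a n) * ?P / ?P"
        by (rule divide_right_mono_ennreal)
      also have "\<dots> = ennreal (a n)"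
      proof (rule mult_divide_eq_ennreal)
        have "ennreal (exp (- s i * len id)) \<le> ?P"
          unfolding poincare_series_def by (rule nn_integral_ge_point[OF id_mem])
        then show "?P \<noteq> 0" by auto
        show "?P \<noteq> top_class.top" using fin[OF si(1)[of i]] by simp
      qed
      finally show ?case using U by (simp add: emeasure_orbit_measure)
    qed
  qed simp
  \<comment> \<open>The estimate holds only from \<open>n0\<close> on; dropping finitely many sets
    does not change the limsup.\<close>
  define A where "A n = (if n0 \<le> n then U n else {})" for n
  have "limsup A \<in> null_sets \<mu>"
  proof (rule borel_cantelli_limsup1)
    show "A n \<in> sets \<mu>" for n using U by (simp add: A_def \<mu>(1))
    show "emeasure \<mu> (A n) < \<infinity>" for n
      by (simp add: \<mu>.emeasure_eq_measure)
    show "summable (\<lambda>n. measure \<mu> (A n))"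
    proof (rule summable_comparison_test'[OF a(2), of 0])
      fix n
      have "emeasure \<mu> (A n) \<le> ennreal (a n)" using bound a by (simp add: A_def)
      then show "norm (measure \<mu> (A n)) \<le> a n"
        using a(1)[of n] by (simp add: \<mu>.emeasure_eq_measure)
    qed
  qed
  moreover have "{\<xi>. infinite {h \<in> H. \<xi> \<in> horo_region \<iota> (h p) p L}} \<subseteq> limsup A"
  proof clarify
    fix \<xi> assume inf: "infinite {h \<in> H. \<xi> \<in> horo_region \<iota> (h p) p L}"
    have "\<exists>m\<ge>n. \<xi> \<in> A m" for n
    proof -
      define N where "N = max n n0"
      have "\<not> {h \<in> H. \<xi> \<in> horo_region \<iota> (h p) p L} \<subseteq> {h \<in> H. len h \<le> 2 * real N}"
      proof
        assume "{h \<in> H. \<xi> \<in> horo_region \<iota> (h p) p L} \<subseteq> {h \<in> H. len h \<le> 2 * real N}"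
        then have "finite {h \<in> H. \<xi> \<in> horo_region \<iota> (h p) p L}" by (rule finite_subset) (rule H.finite_ball)
        then show False using inf by simp
      qed
      then obtain h where "h \<in> {h \<in> H. \<xi> \<in> horo_region \<iota> (h p) p L}" "h \<notin> {h \<in> H. len h \<le> 2 * real N}"
        by (meson subsetI)
      then have h: "h \<in> H" "\<xi> \<in> horo_region \<iota> (h p) p L" "2 * real N < len h" by simp_all
      define m where "m = nat \<lfloor>len h / 2\<rfloor>"
      have "int m = \<lfloor>len h / 2\<rfloor>" by (simp add: m_def)
      then have m: "2 * real m \<le> len h" "len h < 2 * real m + 2" by linarith+
      then have "N \<le> m" using h(3) by linarith
      moreover have "\<xi> \<in> U m" unfolding U_def by (rule UN_I[of h]) (use h m in simp_all)
      ultimately show ?thesis unfolding A_def N_def by (intro exI[of _ m]) simp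
    qed
    then show "\<xi> \<in> limsup A"
      unfolding limsup_INF_SUP INT_iff UN_iff Bex_def atLeast_iff by simp
  qed
  ultimately show ?thesis by (rule rev_bexI)
qed

end

section \<open>A fundamental domain on the boundary\<close>

context convergence_boundary
begin

lemma act_homeo:
  assumes "f \<in> carrier isometry_group"
  shows "continuous_on UNIV (act f)" "inj (act f)" "surj (act f)"
proof -
  obtain h where h: "homeomorphism UNIV UNIV (act f) h" using act_homeomorphism[OF assms] by blast
  then show "continuous_on UNIV (act f)" by (simp add: homeomorphism_def)
  have "h (act f x) = x" for x using h by (simp add: homeomorphism_def)
  then show "inj (act f)" by (metis injI)
  show "surj (act f)" using h by (simp add: homeomorphism_def)
qed

lemma act_in_bdry:
  assumes f: "f \<in> carrier isometry_group"
  shows "act f \<xi> \<in> bdry \<iota> \<longleftrightarrow> \<xi> \<in> bdry \<iota>"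
proof -
  have "surj f" using f by (simp add: isometry_group_def)
  have "act f \<xi> \<in> range \<iota> \<longleftrightarrow> \<xi> \<in> range \<iota>"
  proof
    assume "act f \<xi> \<in> range \<iota>"
    then obtain y where y: "act f \<xi> = \<iota> y" by blast
    obtain x where "y = f x" using \<open>surj f\<close> by (rule surjE)
    then have "act f \<xi> = act f (\<iota> x)" using y act_extends[OF f, of x] by simp
    then have "\<xi> = \<iota> x" using act_homeo(2)[OF f] by (simp add: inj_eq)
    then show "\<xi> \<in> range \<iota>" by blast
  next
    assume "\<xi> \<in> range \<iota>"
    then obtain x where "\<xi> = \<iota> x" by blast
    then show "act f \<xi> \<in> range \<iota>" using act_extends[OF f, of x] by simp
  qed
  then show ?thesis by simp
qed

lemma act_horo_region:
  assumes f: "f \<in> carrier isometry_group"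
  shows "act f \<xi> \<in> horo_region \<iota> (f x) (f y) L \<longleftrightarrow> \<xi> \<in> horo_region \<iota> x y L"
proof
  have iso: "dist (f x) (f y) = dist x y" "surj f" for x y
    using f by (auto simp: isometry_group_def)
  obtain h where h: "homeomorphism UNIV UNIV (act f) h" using act_homeomorphism[OF f] by blast
  {
    assume "act f \<xi> \<in> horo_region \<iota> (f x) (f y) L"
    then obtain U where U: "open U" "act f \<xi> \<in> U" "\<And>z. \<iota> z \<in> U \<Longrightarrow> dist (f x) z - dist (f y) z < L"
      by (rule horo_regionE) blast
    show "\<xi> \<in> horo_region \<iota> x y L"
    proof (rule horo_regionI)
      show "open (act f -` U)" using open_vimage[OF U(1) act_homeo(1)[OF f]] .
      show "\<xi> \<in> act f -` U" using U(2) by simp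
      fix z assume "\<iota> z \<in> act f -` U"
      then show "dist x z - dist y z < L" using U(3)[of "f z"] act_extends[OF f, of z] iso by simp
    qed
  }
  {
    assume "\<xi> \<in> horo_region \<iota> x y L"
    then obtain U where U: "open U" "\<xi> \<in> U" "\<And>z. \<iota> z \<in> U \<Longrightarrow> dist x z - dist y z < L"
      by (rule horo_regionE) blast
    have h': "continuous_on UNIV h" "h (act f \<eta>) = \<eta>" "act f (h \<eta>) = \<eta>" for \<eta>
      using h by (auto simp: homeomorphism_def)
    show "act f \<xi> \<in> horo_region \<iota> (f x) (f y) L"
    proof (rule horo_regionI)
      show "open (h -` U)" using open_vimage[OF U(1) h'(1)] .
      show "act f \<xi> \<in> h -` U" using U(2) h' by simp
      fix z assume z: "\<iota> z \<in> h -` U"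
      obtain w where w: "z = f w" using iso(2) by (rule surjE)
      have "h (\<iota> z) = \<iota> w" using h'(2)[of "\<iota> w"] act_extends[OF f, of w] by (simp add: w)
      then show "dist (f x) z - dist (f y) z < L" using U(3)[of w] z iso by (simp add: w)
    qed
  }
qed

text \<open>\<open>act\<close> is only given as an extension of single isometries; the identity
  holds on \<open>range \<iota>\<close> and extends by continuity and density.\<close>

lemma act_inverse:
  assumes f: "f \<in> carrier isometry_group" and g: "g \<in> carrier isometry_group" and gf: "\<And>x. g (f x) = x"
  shows "act g (act f \<xi>) = \<xi>"
proof -
  have "continuous_on UNIV (\<lambda>\<xi>. act g (act f \<xi>))"
    using continuous_on_compose2[OF act_homeo(1)[OF g] act_homeo(1)[OF f]] by simp
  then have "closed {\<xi>. act g (act f \<xi>) = \<xi>}"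
    by (intro closed_Collect_eq) auto
  moreover have "range \<iota> \<subseteq> {\<xi>. act g (act f \<xi>) = \<xi>}"
    using act_extends[OF f] act_extends[OF g] gf by auto
  ultimately have "closure (range \<iota>) \<subseteq> {\<xi>. act g (act f \<xi>) = \<xi>}" by (rule closure_minimal[rotated])
  then show ?thesis using dense_range by auto
qed

end

section \<open>Finite subsets of \<open>H\<close> attached equivariantly to boundary points\<close>

locale boundary_action = convergence_boundary \<Gamma> \<iota> act R + proper_isometric_action H p
  for \<Gamma> :: "('x::metric_space \<Rightarrow> 'x) set" and \<iota> :: "'x \<Rightarrow> 'b::metric_space" and act R
    and H :: "('x \<Rightarrow> 'x) set" and p :: 'x
begin

lemma carrier: "h \<in> H \<Longrightarrow> h \<in> carrier isometry_group"
  using bij dist_act by (simp add: isometry_group_def bij_is_surj)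

lemma act_inv: "h \<in> H \<Longrightarrow> act (inverse_map h) (act h \<xi>) = \<xi>"
  by (rule act_inverse) (auto intro: carrier inv_mem inv_apply)

text \<open>The elements whose orbit points are, up to the error \<open>n\<close>, closest to
  \<open>\<xi>\<close> among all of \<open>H p\<close>. Open regions replace Busemann functions:
  they give Borel sets, and equivariance holds without any error.\<close>

definition near_min :: "nat \<Rightarrow> 'b \<Rightarrow> ('x \<Rightarrow> 'x) set" where
  "near_min n \<xi> = {h \<in> H. \<forall>k\<in>H. \<xi> \<in> horo_region \<iota> (h p) (k p) (real n)}"

lemma near_min_sub: "near_min n \<xi> \<subseteq> H"
  by (auto simp: near_min_def)

lemma near_min_act_aux:
  assumes g: "g \<in> H" and h: "h \<in> near_min n \<xi>"
  shows "g \<circ> h \<in> near_min n (act g \<xi>)"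
proof -
  have "act g \<xi> \<in> horo_region \<iota> ((g \<circ> h) p) (k p) (real n)" if k: "k \<in> H" for k
  proof -
    have "\<xi> \<in> horo_region \<iota> (h p) ((inverse_map g \<circ> k) p) (real n)"
    proof -
      have "\<forall>k\<in>H. \<xi> \<in> horo_region \<iota> (h p) (k p) (real n)" using h by (simp add: near_min_def)
      then show ?thesis using comp_mem[OF inv_mem[OF g] k] by (rule bspec)
    qed
    from iffD2[OF act_horo_region[OF carrier[OF g]] this] show ?thesis
      by (simp add: inv_apply(2)[OF g])
  qed
  moreover have "h \<in> H" using h by (simp add: near_min_def)
  ultimately show ?thesis using comp_mem[OF g] by (simp add: near_min_def)
qed

lemma near_min_act:
  assumes g: "g \<in> H"
  shows "near_min n (act g \<xi>) = (\<lambda>h. g \<circ> h) ` near_min n \<xi>"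
proof (intro equalityI subsetI)
  fix k assume "k \<in> near_min n (act g \<xi>)"
  from near_min_act_aux[OF inv_mem[OF g] this] have "inverse_map g \<circ> k \<in> near_min n \<xi>"
    by (simp add: act_inv[OF g])
  moreover have "k = g \<circ> (inverse_map g \<circ> k)"
    using inv_comp(2)[OF g] by (simp add: comp_assoc[symmetric])
  ultimately show "k \<in> (\<lambda>h. g \<circ> h) ` near_min n \<xi>"
    by (intro image_eqI[where x = "inverse_map g \<circ> k"])
qed (use near_min_act_aux[OF g] in auto)

lemma sets_near_min: "{\<xi>. near_min n \<xi> = S} \<in> sets borel"
proof (cases "S \<subseteq> H")
  case True
  have 1: "{\<xi>. h \<in> near_min n \<xi>} \<in> sets borel" if "h \<in> H" for h
  proof -
    have "{\<xi>. h \<in> near_min n \<xi>} = (\<Inter>k\<in>H. horo_region \<iota> (h p) (k p) (real n))"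
      using that by (auto simp: near_min_def)
    also have "\<dots> \<in> sets borel"
      using countable_G id_mem by (intro sets.countable_INT') auto
    finally show ?thesis .
  qed
  have "{\<xi>. (h \<in> near_min n \<xi>) = (h \<in> S)} \<in> sets borel" if "h \<in> H" for h
  proof (cases "h \<in> S")
    case True
    then show ?thesis using 1[OF that] by simp
  next
    case False
    have "{\<xi>. h \<notin> near_min n \<xi>} = - {\<xi>. h \<in> near_min n \<xi>}" by auto
    then show ?thesis using 1[OF that] False by simp
  qed
  then have "(\<Inter>h\<in>H. {\<xi>. (h \<in> near_min n \<xi>) = (h \<in> S)}) \<in> sets borel"
    using countable_G id_mem by (intro sets.countable_INT') auto
  moreover have "{\<xi>. near_min n \<xi> = S} = (\<Inter>h\<in>H. {\<xi>. (h \<in> near_min n \<xi>) = (h \<in> S)})"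
    using True near_min_sub by blast
  ultimately show ?thesis by simp
next
  case False
  then have "{\<xi>. near_min n \<xi> = S} = {}" using near_min_sub by blast
  then show ?thesis by simp
qed

text \<open>The tolerance needed depends on \<open>\<xi>\<close>, since the Busemann error may vary
  with the class; the least one that works is invariant under \<open>H\<close>.\<close>

definition first :: "'b \<Rightarrow> nat" where
  "first \<xi> = (LEAST n. near_min n \<xi> \<noteq> {})"

definition minima :: "'b \<Rightarrow> ('x \<Rightarrow> 'x) set" where
  "minima \<xi> = near_min (first \<xi>) \<xi>"

definition core :: "'b set" where
  "core = {\<xi> \<in> bdry \<iota>. (\<exists>n. near_min n \<xi> \<noteq> {}) \<and> finite (minima \<xi>)}"

lemma minima_act: "g \<in> H \<Longrightarrow> minima (act g \<xi>) = (\<lambda>h. g \<circ> h) ` minima \<xi>"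
  by (simp add: minima_def first_def near_min_act)

lemma core_act: "g \<in> H \<Longrightarrow> \<xi> \<in> core \<Longrightarrow> act g \<xi> \<in> core"
  by (simp add: core_def minima_act near_min_act) (use act_in_bdry[OF carrier] in blast)

lemma minima_core: "\<xi> \<in> core \<Longrightarrow> minima \<xi> \<noteq> {} \<and> finite (minima \<xi>) \<and> minima \<xi> \<subseteq> H"
  unfolding core_def minima_def first_def
  using near_min_sub LeastI_ex[of "\<lambda>n. near_min n \<xi> \<noteq> {}"] by blast

lemma sets_bdry: "bdry \<iota> \<in> sets borel"
  using open_range by (simp add: borel_closed closed_Compl)

lemma sets_minima:
  assumes S: "S \<noteq> {}" "finite S"
  shows "{\<xi> \<in> core. minima \<xi> = S} \<in> sets borel"
proof -
  have "{\<xi> \<in> core. minima \<xi> = S} =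
    bdry \<iota> \<inter> (\<Union>n. {\<xi>. near_min n \<xi> = S} \<inter> (\<Inter>m\<in>{..n}. {\<xi>. m < n \<longrightarrow> near_min m \<xi> = {}}))" (is "?L = ?R")
  proof (intro equalityI subsetI)
    fix \<xi> assume \<xi>: "\<xi> \<in> ?L"
    then have "near_min (first \<xi>) \<xi> = S" "\<xi> \<in> bdry \<iota>" by (auto simp: minima_def core_def)
    moreover have "near_min m \<xi> = {}" if "m < first \<xi>" for m
      using not_less_Least[of m "\<lambda>n. near_min n \<xi> \<noteq> {}"] that by (simp add: first_def)
    ultimately show "\<xi> \<in> ?R" by auto
  next
    fix \<xi> assume "\<xi> \<in> ?R"
    then obtain n where n: "\<xi> \<in> bdry \<iota>" "near_min n \<xi> = S" "\<And>m. m < n \<Longrightarrow> near_min m \<xi> = {}" by auto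
    have "first \<xi> = n"
      unfolding first_def by (rule Least_equality) (use n S in \<open>auto simp: not_less[symmetric]\<close>)
    then have "minima \<xi> = S" using n by (simp add: minima_def)
    then show "\<xi> \<in> ?L" using n S by (auto simp: core_def)
  qed
  moreover have "(\<Inter>m\<in>{..n}. {\<xi>. m < n \<longrightarrow> near_min m \<xi> = {}}) \<in> sets borel" for n :: nat
  proof (rule sets.finite_INT)
    fix m show "{\<xi>. m < n \<longrightarrow> near_min m \<xi> = {}} \<in> sets borel"
      using sets_near_min[of m "{}"] by (cases "m < n") auto
  qed auto
  then have "{\<xi>. near_min n \<xi> = S} \<inter> (\<Inter>m\<in>{..n}. {\<xi>. m < n \<longrightarrow> near_min m \<xi> = {}}) \<in> sets borel" for n
    by (rule sets.Int[OF sets_near_min])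
  then have "(\<Union>n. {\<xi>. near_min n \<xi> = S} \<inter> (\<Inter>m\<in>{..n}. {\<xi>. m < n \<longrightarrow> near_min m \<xi> = {}})) \<in> sets borel"
    by (intro sets.countable_UN'') auto
  ultimately show ?thesis using sets.Int[OF sets_bdry] by simp
qed

definition translates :: "('x \<Rightarrow> 'x) set \<Rightarrow> ('x \<Rightarrow> 'x) set set" where
  "translates S = {(\<lambda>h. g \<circ> h) ` S |g. g \<in> H}"

text \<open>The choice is made from the orbit of \<open>S\<close> and not from \<open>S\<close>, so
  it is constant along the orbit.\<close>

definition repr :: "('x \<Rightarrow> 'x) set \<Rightarrow> ('x \<Rightarrow> 'x) set" where
  "repr S = (SOME T. T \<in> translates S)"

lemma repr_translates: "repr S \<in> translates S"
  unfolding repr_def by (rule someI_ex) (use id_mem in \<open>auto simp: translates_def\<close>)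

lemma translates_translate:
  assumes g: "g \<in> H"
  shows "translates ((\<lambda>h. g \<circ> h) ` S) = translates S"
proof -
  have sub: "translates ((\<lambda>h. g \<circ> h) ` S) \<subseteq> translates S" if "g \<in> H" for g S
  proof
    fix T assume "T \<in> translates ((\<lambda>h. g \<circ> h) ` S)"
    then obtain f where f: "f \<in> H" "T = (\<lambda>h. f \<circ> h) ` (\<lambda>h. g \<circ> h) ` S" by (auto simp: translates_def)
    then have "T = (\<lambda>h. (f \<circ> g) \<circ> h) ` S" by (simp add: image_image comp_assoc)
    then show "T \<in> translates S" using comp_mem[OF f(1) that] unfolding translates_def by blast
  qed
  have "S = (\<lambda>h. inverse_map g \<circ> h) ` (\<lambda>h. g \<circ> h) ` S"
    by (simp add: image_image comp_assoc[symmetric] inv_comp(1)[OF g])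
  then show ?thesis using sub[OF g, of S] sub[OF inv_mem[OF g], of "(\<lambda>h. g \<circ> h) ` S"] by simp
qed

lemma repr_translate: "g \<in> H \<Longrightarrow> repr ((\<lambda>h. g \<circ> h) ` S) = repr S"
  by (simp add: repr_def translates_translate)

lemma funpow_mem: "g \<in> H \<Longrightarrow> g ^^ n \<in> H"
  by (induction n) (auto intro: id_mem comp_mem)

lemma pow_eq_funpow: "g [^]\<^bsub>isometry_group\<lparr>carrier := H\<rparr>\<^esub> (n::nat) = g ^^ n"
proof (induction n)
  case 0
  show ?case by (simp add: isometry_group_def)
next
  case (Suc n)
  have "g [^]\<^bsub>isometry_group\<lparr>carrier := H\<rparr>\<^esub> Suc n = (g [^]\<^bsub>isometry_group\<lparr>carrier := H\<rparr>\<^esub> n) \<circ> g"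
    by (simp add: isometry_group_def)
  then show ?case by (simp add: Suc funpow_Suc_right del: funpow.simps)
qed

text \<open>The elements \<open>(g ^^ n) \<circ> f\<close> with \<open>f\<close> in \<open>S\<close>
  stay in a finite set, so two of them coincide and a positive power of \<open>g\<close> is the
  identity.\<close>

lemma translate_fixed:
  assumes tf: "torsion_free (isometry_group\<lparr>carrier := H\<rparr>)" and g: "g \<in> H"
    and S: "finite S" "S \<noteq> {}" and fixS: "(\<lambda>h. g \<circ> h) ` S = S" and SH: "S \<subseteq> H"
  shows "g = id"
proof -
  obtain f where f: "f \<in> S" using S by blast
  have pow: "(g ^^ n) \<circ> f \<in> S" for n
  proof (induction n)
    case (Suc n)
    have "(g ^^ Suc n) \<circ> f = g \<circ> ((g ^^ n) \<circ> f)" by (simp add: comp_assoc)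
    then show ?case using fixS Suc by blast
  qed (use f in simp)
  have "\<not> inj_on (\<lambda>n. (g ^^ n) \<circ> f) (UNIV :: nat set)"
    using finite_imageD[of "\<lambda>n. (g ^^ n) \<circ> f" UNIV] finite_subset[OF _ S(1), of "range (\<lambda>n. (g ^^ n) \<circ> f)"] pow
    by auto
  then obtain i j where ij: "i < j" "(g ^^ i) \<circ> f = (g ^^ j) \<circ> f"
    unfolding inj_on_def by (metis linorder_neqE_nat)
  have surj: "surj f" using bij_is_surj[OF bij] f SH by blast
  have "(g ^^ i) x = (g ^^ j) x" for x
    using fun_cong[OF ij(2)] surj by (metis comp_apply surjD)
  moreover have "(g ^^ j) x = (g ^^ i) ((g ^^ (j - i)) x)" for x
    using ij(1) by (metis add_diff_inverse_nat comp_apply funpow_add less_imp_le not_less)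
  ultimately have "(g ^^ (j - i)) x = x" for x
    using inv_apply(1)[OF funpow_mem[OF g]] by metis
  then have "g ^^ (j - i) = id" by auto
  moreover have one: "\<one>\<^bsub>isometry_group\<lparr>carrier := H\<rparr>\<^esub> = id" by (simp add: isometry_group_def)
  ultimately have pow1: "g [^]\<^bsub>isometry_group\<lparr>carrier := H\<rparr>\<^esub> (j - i) = \<one>\<^bsub>isometry_group\<lparr>carrier := H\<rparr>\<^esub>"
    by (simp only: pow_eq_funpow)
  show ?thesis
  proof (rule ccontr)
    assume "g \<noteq> id"
    then have "g \<noteq> \<one>\<^bsub>isometry_group\<lparr>carrier := H\<rparr>\<^esub> \<and> 0 < j - i" using one ij(1) by simp
    moreover have "g \<in> carrier (isometry_group\<lparr>carrier := H\<rparr>)" using g by simp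
    ultimately show False using tf pow1 unfolding torsion_free_def by blast
  qed
qed

definition fundamental_domain :: "'b set" where
  "fundamental_domain = {\<xi> \<in> core. repr (minima \<xi>) = minima \<xi>}"

text \<open>Although \<open>repr\<close> is an arbitrary choice, \<open>core\<close> splits into
  countably many Borel sets according to the finite set \<open>minima \<xi>\<close>, and the domain
  is a union of some of them.\<close>

lemma sets_fundamental_domain: "fundamental_domain \<in> sets borel"
proof -
  let ?I = "{S. S \<noteq> {} \<and> repr S = S \<and> finite S \<and> S \<subseteq> H}"
  have "fundamental_domain = (\<Union>S\<in>?I. {\<xi> \<in> core. minima \<xi> = S})"
    using minima_core by (auto simp: fundamental_domain_def)
  moreover have "countable ?I"
    by (rule countable_subset[OF _ countable_Collect_finite_subset[OF countable_G]]) auto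
  moreover have "{\<xi> \<in> core. minima \<xi> = S} \<in> sets borel" if "S \<in> ?I" for S
    using that by (intro sets_minima) auto
  ultimately show ?thesis by (metis (no_types, lifting) sets.countable_UN'')
qed

text \<open>The sets \<open>minima\<close> of two points of one orbit are translates of each other
  with the same representative; if both equal it, then \<open>g\<close> fixes a finite nonempty
  set.\<close>

lemma fundamental_domain_disjoint:
  assumes tf: "torsion_free (isometry_group\<lparr>carrier := H\<rparr>)" and g: "g \<in> H" "g \<noteq> id"
  shows "act g ` fundamental_domain \<inter> fundamental_domain = {}"
proof (rule ccontr)
  assume "\<not> ?thesis"
  then obtain \<xi> where \<xi>: "\<xi> \<in> fundamental_domain" "act g \<xi> \<in> fundamental_domain" by blast
  then have core: "\<xi> \<in> core" and r: "repr (minima \<xi>) = minima \<xi>" "repr (minima (act g \<xi>)) = minima (act g \<xi>)"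
    by (auto simp: fundamental_domain_def)
  have "(\<lambda>h. g \<circ> h) ` minima \<xi> = minima \<xi>"
    using r unfolding minima_act[OF g(1)] repr_translate[OF g(1)] by simp
  then have "g = id"
    using minima_core[OF core] by (intro translate_fixed[OF tf g(1)]) auto
  then show False using g by simp
qed

lemma fundamental_domain_cover: "(\<Union>h\<in>H. act h ` fundamental_domain) = core"
proof (intro equalityI subsetI)
  fix \<xi> assume \<xi>: "\<xi> \<in> core"
  obtain g where g: "g \<in> H" "repr (minima \<xi>) = (\<lambda>h. g \<circ> h) ` minima \<xi>"
    using repr_translates[of "minima \<xi>"] by (auto simp: translates_def)
  have "act g \<xi> \<in> fundamental_domain"
    using core_act[OF g(1) \<xi>] g by (simp add: fundamental_domain_def minima_act repr_translate)
  then have "act (inverse_map g) (act g \<xi>) \<in> act (inverse_map g) ` fundamental_domain" by (rule imageI)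
  then have "\<xi> \<in> act (inverse_map g) ` fundamental_domain" by (simp add: act_inv[OF g(1)])
  then show "\<xi> \<in> (\<Union>h\<in>H. act h ` fundamental_domain)" using inv_mem[OF g(1)] by blast
qed (auto simp: fundamental_domain_def intro: core_act)

lemma sets_core: "core \<in> sets borel"
proof -
  let ?I = "{S. S \<noteq> {} \<and> finite S \<and> S \<subseteq> H}"
  have "core = (\<Union>S\<in>?I. {\<xi> \<in> core. minima \<xi> = S})"
    using minima_core by auto
  moreover have "countable ?I"
    by (rule countable_subset[OF _ countable_Collect_finite_subset[OF countable_G]]) auto
  moreover have "{\<xi> \<in> core. minima \<xi> = S} \<in> sets borel" if "S \<in> ?I" for S
    using that by (intro sets_minima) auto
  ultimately show ?thesis by (metis (no_types, lifting) sets.countable_UN'')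
qed

lemma refl_R: "\<xi> \<in> bdry \<iota> \<Longrightarrow> (\<xi>, \<xi>) \<in> R"
  using partition by (meson equiv_def refl_onD)

text \<open>The values \<open>B \<xi> (h p) p\<close> not exceeding the value at \<open>id\<close>
  belong to finitely many \<open>h\<close>, because such \<open>h\<close> satisfy the region
  condition for one fixed bound. So a minimum over \<open>H\<close> exists, and its minimizer lies
  in some \<open>near_min n \<xi>\<close>.\<close>

lemma core_of_finite:
  assumes bus: "busemann_family \<iota> R Chor B" and \<xi>: "\<xi> \<in> Chor"
    and fin: "\<And>n::nat. finite {h \<in> H. \<xi> \<in> horo_region \<iota> (h p) p (real n)}"
  shows "\<xi> \<in> core"
proof -
  have bd: "\<xi> \<in> bdry \<iota>" using bus \<xi> by (auto simp: busemann_family_def nonpinched_def)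
  note refl = refl_R[OF bd]
  obtain \<epsilon> :: real where \<epsilon>: "\<And>x y. class_limsup \<iota> R \<xi> (\<lambda>z. \<bar>B \<xi> x y - (dist x z - dist y z)\<bar>) \<le> ereal \<epsilon>"
    using bus \<xi> refl unfolding busemann_family_def by blast
  have near: "\<exists>U. open U \<and> \<xi> \<in> U \<and> (\<forall>z. \<iota> z \<in> U \<longrightarrow> \<bar>B \<xi> x y - (dist x z - dist y z)\<bar> < \<epsilon> + 1)" for x y
    by (rule class_limsup_less[OF \<epsilon> _ refl]) simp
  define \<beta> where "\<beta> h = B \<xi> (h p) p" for h
  define L where "L = nat \<lceil>\<beta> id + \<epsilon> + 1\<rceil>"
  define F where "F = {h \<in> H. \<beta> h \<le> \<beta> id}"
  have "F \<subseteq> {h \<in> H. \<xi> \<in> horo_region \<iota> (h p) p (real L)}"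
  proof
    fix h assume h: "h \<in> F"
    obtain U where U: "open U" "\<xi> \<in> U" "\<And>z. \<iota> z \<in> U \<Longrightarrow> \<bar>\<beta> h - (dist (h p) z - dist p z)\<bar> < \<epsilon> + 1"
      using near[of "h p" p] unfolding \<beta>_def by blast
    have "\<beta> id + \<epsilon> + 1 \<le> real L" unfolding L_def by (rule real_nat_ceiling_ge)
    then have "\<xi> \<in> horo_region \<iota> (h p) p (real L)"
      using U h by (intro horo_regionI[OF U(1,2)]) (fastforce simp: F_def)
    then show "h \<in> {h \<in> H. \<xi> \<in> horo_region \<iota> (h p) p (real L)}" using h by (simp add: F_def)
  qed
  then have "finite F" using fin by (rule finite_subset)
  moreover have "id \<in> F" using id_mem by (simp add: F_def)
  ultimately obtain h where h: "h \<in> F" "\<And>k. k \<in> F \<Longrightarrow> \<beta> h \<le> \<beta> k"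
    using arg_min_if_finite[of F \<beta>] by (metis empty_iff not_le)
  have min: "\<beta> h \<le> \<beta> k" if "k \<in> H" for k
    using h that by (cases "k \<in> F") (auto simp: F_def)
  \<comment> \<open>Comparing \<open>h\<close> with \<open>k\<close> costs the quasi-cocycle error,
    below \<open>\<epsilon> + 1\<close>, twice.\<close>
  define n where "n = nat \<lceil>2 * \<epsilon> + 2\<rceil>"
  have "\<xi> \<in> horo_region \<iota> (h p) (k p) (real n)" if k: "k \<in> H" for k
  proof -
    obtain U where U: "open U" "\<xi> \<in> U" "\<And>z. \<iota> z \<in> U \<Longrightarrow> \<bar>\<beta> h - (dist (h p) z - dist p z)\<bar> < \<epsilon> + 1"
      using near[of "h p" p] unfolding \<beta>_def by blast
    obtain U' where U': "open U'" "\<xi> \<in> U'" "\<And>z. \<iota> z \<in> U' \<Longrightarrow> \<bar>\<beta> k - (dist (k p) z - dist p z)\<bar> < \<epsilon> + 1"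
      using near[of "k p" p] unfolding \<beta>_def by blast
    show ?thesis
    proof (rule horo_regionI)
      show "open (U \<inter> U')" "\<xi> \<in> U \<inter> U'" using U U' by auto
      fix z assume "\<iota> z \<in> U \<inter> U'"
      then have "\<bar>\<beta> h - (dist (h p) z - dist p z)\<bar> < \<epsilon> + 1" "\<bar>\<beta> k - (dist (k p) z - dist p z)\<bar> < \<epsilon> + 1"
        using U(3) U'(3) by auto
      moreover have "2 * \<epsilon> + 2 \<le> real n" unfolding n_def by (rule real_nat_ceiling_ge)
      ultimately show "dist (h p) z - dist (k p) z < real n" using min[OF k] by linarith
    qed
  qed
  then have "h \<in> near_min n \<xi>" using h by (simp add: near_min_def F_def)
  then have "\<exists>n. near_min n \<xi> \<noteq> {}" by blast
  moreover have "near_min n \<xi> \<subseteq> {h \<in> H. \<xi> \<in> horo_region \<iota> (h p) p (real n)}" for n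
    using id_mem by (force simp: near_min_def)
  then have "finite (near_min n \<xi>)" for n using fin by (rule finite_subset)
  ultimately show ?thesis using bd by (simp add: core_def minima_def)
qed

end

text \<open>The identity keeps every count positive; this makes the exponents
  \<open>\<sigma>\<close> and \<omega> of the theorem nonnegative.\<close>

lemma (in proper_isometric_action) growth_rate_nonneg: "0 \<le> growth_rate p G"
  unfolding growth_rate_def
proof (rule le_Limsup)
  show "\<forall>\<^sub>F n in sequentially. 0 \<le> log_card (orbit_of p {g \<in> G. len g \<le> real n}) / ereal (real n)"
  proof (rule always_eventually, rule allI)
    fix n
    let ?O = "orbit_of p {g \<in> G. len g \<le> real n}"
    have fin: "finite ?O" by (rule finite_orbit_iff) simp
    moreover have "p \<in> ?O" using id_mem by (intro image_eqI[where x = id]) auto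
    ultimately have "0 < card ?O" by (auto simp only: card_gt_0_iff)
    then have "1 \<le> real (card ?O)" by linarith
    then have "0 \<le> ln (real (card ?O))" by simp
    moreover have "log_card ?O = ereal (ln (real (card ?O)))"
      using fin \<open>p \<in> ?O\<close> unfolding log_card_def by auto
    ultimately show "0 \<le> log_card ?O / ereal (real n)" by (cases "n = 0") auto
  qed
qed simp

theorem theorem1p10:
  fixes p :: "'x::metric_space"
    and \<iota> :: "'x \<Rightarrow> 'b::metric_space"
    and act :: "('x \<Rightarrow> 'x) \<Rightarrow> 'b \<Rightarrow> 'b"
    and R :: "('b \<times> 'b) set"
    and \<Gamma> H :: "('x \<Rightarrow> 'x) set"
    and Chor :: "'b set"
    and B :: "'b \<Rightarrow> 'x \<Rightarrow> 'x \<Rightarrow> real"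
    and \<mu> :: "'x \<Rightarrow> 'b measure"
  assumes proper: "\<And>(x::'x) r. compact (cball x r)"
    and geodesic: "\<And>x y::'x. \<exists>S. geodesic_segment x y S"
    and boundary: "convergence_boundary \<Gamma> \<iota> act R"
    and busemann: "busemann_family \<iota> R Chor B"
    and \<Gamma>_subgroup: "subgroup \<Gamma> isometry_group"
    and \<Gamma>_nonelementary: "\<not> elementary_group (isometry_group\<lparr>carrier := \<Gamma>\<rparr>)"
    and \<Gamma>_discrete: "discrete \<Gamma>"
    and \<Gamma>_proper: "acts_properly \<Gamma>"
    and \<Gamma>_contracting: "\<exists>g\<in>\<Gamma>. contracting_isometry p g"
    and \<Gamma>_SCC: "statistically_convex_cocompact p \<Gamma>"
    and PS: "patterson_sullivan_measures p \<iota> \<Gamma> \<mu>"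
    and density:
      "quasi_conformal_density p \<iota> act R Chor B \<Gamma> (real_of_ereal (growth_rate p \<Gamma>)) \<mu>"
    and H_subgroup: "subgroup H isometry_group"
    and H_proper: "acts_properly H"
    and H_contracting: "\<exists>h\<in>H. contracting_isometry p h"
    and H_growth: "growth_rate p H < growth_rate p \<Gamma> / 2"
  shows "big_horospheric_limit_set p \<iota> R Chor H \<in> null_sets (completion (\<mu> p))
    \<and> (torsion_free (isometry_group\<lparr>carrier := H\<rparr>) \<and> preserves_measure_class act H (\<mu> p)
         \<longrightarrow> completely_dissipative \<iota> act H (\<mu> p))
    \<and> (H \<subseteq> \<Gamma> \<longrightarrow> preserves_measure_class act H (\<mu> p))"
proof -
  interpret convergence_boundary \<Gamma> \<iota> act R by (rule boundary)
  have act\<Gamma>: "proper_isometric_action \<Gamma> p"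
    by (rule subgroup_proper_isometric_action[OF \<Gamma>_subgroup \<Gamma>_proper proper])
  have actH: "proper_isometric_action H p"
    by (rule subgroup_proper_isometric_action[OF H_subgroup H_proper proper])
  interpret H: boundary_action \<Gamma> \<iota> act R H p
    by (intro boundary_action.intro boundary actH)
  obtain g where g: "g \<in> \<Gamma>" "contracting_isometry p g" using \<Gamma>_contracting by blast
  obtain pw idx K where axis: "group_axis \<Gamma> p pw idx K"
    using group_axis_exists[OF act\<Gamma> \<Gamma>_subgroup proper geodesic g] by blast
  obtain M1 M2 where M: "0 < M1" "M1 \<le> M2"
    and gap: "growth_rate p (barrier_free p \<Gamma> M1 M2) < growth_rate p \<Gamma>"
    and \<Gamma>_fin: "growth_rate p \<Gamma> < \<infinity>"
    using \<Gamma>_SCC unfolding statistically_convex_cocompact_def by blast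
  \<comment> \<open>The least integer above the threshold of \<open>no_backtracking\<close>.\<close>
  define m where "m = 5 * K + 3 * (K * K) + 1"
  interpret scc_axis \<Gamma> p pw idx K M1 M2 m
    by (intro scc_axis.intro axis scc_axis_axioms.intro M)
  have "growth_rate p \<Gamma> \<noteq> - \<infinity>" using growth_rate_nonneg by auto
  then obtain \<omega> where \<omega>: "growth_rate p \<Gamma> = ereal \<omega>" using \<Gamma>_fin by (cases "growth_rate p \<Gamma>") auto
  have "growth_rate p H < ereal (\<omega> / 2)" using H_growth by (simp add: \<omega>)
  then obtain \<sigma> where \<sigma>: "growth_rate p H < ereal \<sigma>" "\<sigma> < \<omega> / 2"
    using ereal_dense2 by (metis less_ereal.simps(1))
  have "0 < ereal \<sigma>" using H.growth_rate_nonneg \<sigma>(1) by (rule le_less_trans)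
  then have \<sigma>0: "0 \<le> \<sigma>" "2 * \<sigma> < \<omega>" using \<sigma>(2) by auto
  have PH: "poincare_series p H \<sigma> < \<infinity>"
    by (rule H.poincare_series_finite[OF order_refl \<sigma>(1) \<sigma>0(1)])
  obtain s0' where s0': "growth_rate p BF < ereal s0'" "s0' < \<omega>"
    using gap ereal_dense2 unfolding \<omega> by (metis less_ereal.simps(1))
  \<comment> \<open>The comparisons of weights need a nonnegative exponent; 0 is admissible because
    \<open>0 < \<omega>\<close>.\<close>
  define s0 where "s0 = max 0 s0'"
  have "ereal s0' \<le> ereal s0" by (simp add: s0_def)
  then have "growth_rate p BF < ereal s0" using s0'(1) by (rule less_le_trans[rotated])
  then have PBF: "poincare_series p BF s0 < \<infinity>"
    by (rule poincare_series_finite[OF BF_sub]) (simp add: s0_def)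
  have s0: "0 \<le> s0" "s0 < \<omega>" using s0'(2) \<sigma>0 by (auto simp: s0_def)
  have fin: "poincare_series p \<Gamma> s < \<infinity>" if "\<omega> < s" for s
    using that s0 by (intro poincare_series_finite) (auto simp: \<omega>)
  have sets\<mu>: "sets (\<mu> x) = sets borel" "finite_measure (\<mu> x)" for x
    using PS by (auto simp: patterson_sullivan_measures_def)
  obtain s where s: "\<And>i. growth_rate p \<Gamma> < ereal (s i)" "(\<lambda>i. ereal (s i)) \<longlonglongrightarrow> growth_rate p \<Gamma>"
    "\<And>x. weak_limit (\<lambda>i. orbit_measure p \<iota> \<Gamma> (s i) x) (\<mu> x)"
    using PS unfolding patterson_sullivan_measures_def by blast
  have si: "\<omega> < s i" "s \<longlonglongrightarrow> \<omega>" for i using s(1)[of i] s(2) by (auto simp: \<omega>)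
  have m: "5 * K + 3 * (K * K) < m" by (simp add: m_def)
  define inf_set where "inf_set L = {\<xi>. infinite {h \<in> H. \<xi> \<in> horo_region \<iota> (h p) p L}}" for L
  have "\<exists>Z\<in>null_sets (\<mu> p). inf_set L \<subseteq> Z" for L
    unfolding inf_set_def
    by (rule horospheric_null[OF actH \<sigma>0 PH s0 PBF _ m sets\<mu> si s(3)]) (rule fin)
  then have "\<forall>L. \<exists>Z. Z \<in> null_sets (\<mu> p) \<and> inf_set L \<subseteq> Z" by blast
  from choice[OF this] obtain Z where "\<forall>L. Z L \<in> null_sets (\<mu> p) \<and> inf_set L \<subseteq> Z L" ..
  then have Z: "\<And>L. Z L \<in> null_sets (\<mu> p)" "\<And>L. inf_set L \<subseteq> Z L" by simp_all
  \<comment> \<open>Regions grow with \<open>L\<close>, so natural values suffice and the union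
    stays null.\<close>
  define N where "N = (\<Union>n::nat. Z (real n))"
  have N: "N \<in> null_sets (\<mu> p)" unfolding N_def by (rule null_sets_UN) (rule Z(1))
  have finite_outside: "finite {h \<in> H. \<xi> \<in> horo_region \<iota> (h p) p (real n)}" if "\<xi> \<notin> N" for \<xi> and n :: nat
  proof -
    have "\<xi> \<notin> Z (real n)" using that unfolding N_def by (meson UN_I UNIV_I)
    then have "\<xi> \<notin> inf_set (real n)" using Z(2)[of "real n"] by (meson subsetD)
    then show ?thesis by (simp add: inf_set_def)
  qed
  have big: "big_horospheric_limit_set p \<iota> R Chor H \<subseteq> N"
  proof
    fix \<xi> assume \<xi>: "\<xi> \<in> big_horospheric_limit_set p \<iota> R Chor H"
    then obtain L h where h: "\<And>n::nat. h n \<in> H" "\<And>n. h n p \<in> horoball p \<iota> R \<xi> L" "inj (\<lambda>n. h n p)"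
      unfolding big_horospheric_limit_set_def by blast
    have "\<xi> \<in> bdry \<iota>"
      using \<xi> busemann unfolding big_horospheric_limit_set_def busemann_family_def nonpinched_def by blast
    then have refl: "(\<xi>, \<xi>) \<in> R" by (rule H.refl_R)
    obtain n :: nat where "L + 1 \<le> real n" using real_arch_simple by blast
    then have "h i \<in> {h \<in> H. \<xi> \<in> horo_region \<iota> (h p) p (real n)}" for i
      using horo_region_mono[OF horoball_horo_region[OF h(2) refl]] h(1) by simp
    then have "range h \<subseteq> {h \<in> H. \<xi> \<in> horo_region \<iota> (h p) p (real n)}" by blast
    moreover have "infinite (range h)"
    proof
      assume "finite (range h)"
      then have "finite ((\<lambda>f. f p) ` range h)" by (rule finite_imageI)
      moreover have "(\<lambda>f. f p) ` range h = range (\<lambda>n. h n p)" by auto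
      ultimately show False using range_inj_infinite[OF h(3)] by simp
    qed
    ultimately have "infinite {h \<in> H. \<xi> \<in> horo_region \<iota> (h p) p (real n)}"
      by (rule infinite_super)
    then show "\<xi> \<in> N" using finite_outside[of \<xi> n] by (rule contrapos_np)
  qed
  have AC: "absolutely_continuous (\<mu> y) (\<mu> x)" for x y
    using density unfolding quasi_conformal_density_def by blast
  show ?thesis
  proof (intro conjI impI)
    \<comment> \<open>The limit set is only shown to lie inside the null set \<open>N\<close>; the
      completion takes care of its measurability.\<close>
    show "big_horospheric_limit_set p \<iota> R Chor H \<in> null_sets (completion (\<mu> p))"
      by (rule null_sets_completion_subset[OF big null_sets_completionI[OF N]])
  next
    assume "torsion_free (isometry_group\<lparr>carrier := H\<rparr>) \<and> preserves_measure_class act H (\<mu> p)"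
    then have tf: "torsion_free (isometry_group\<lparr>carrier := H\<rparr>)" ..
    have "\<forall>y. AE \<xi> in \<mu> y. \<xi> \<in> Chor"
      using density unfolding quasi_conformal_density_def AE_conj_iff by blast
    then have "AE \<xi> in \<mu> p. \<xi> \<in> Chor" ..
    moreover have "AE \<xi> in \<mu> p. \<xi> \<notin> N" by (rule AE_not_in[OF N])
    ultimately have "AE \<xi> in \<mu> p. \<xi> \<notin> bdry \<iota> - H.core"
    proof eventually_elim
      case (elim \<xi>)
      then have "\<xi> \<in> H.core" by (intro H.core_of_finite[OF busemann] finite_outside)
      then show ?case by simp
    qed
    moreover have "bdry \<iota> - H.core \<in> sets (\<mu> p)"
      unfolding sets\<mu> by (rule sets.Diff[OF H.sets_bdry H.sets_core])
    ultimately have "bdry \<iota> - H.core \<in> null_sets (\<mu> p)" by (simp add: AE_iff_null_sets)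
    then show "completely_dissipative \<iota> act H (\<mu> p)"
      unfolding completely_dissipative_def
      using H.sets_fundamental_domain H.fundamental_domain_disjoint[OF tf] H.fundamental_domain_cover
      by (intro bexI[of _ H.fundamental_domain]) (auto simp: H.fundamental_domain_def H.core_def)
  next
    assume "H \<subseteq> \<Gamma>"
    \<comment> \<open>Equivariance turns invariance of the measure class into mutual absolute
      continuity within the density.\<close>
    then have "distr (\<mu> p) borel (act h) = \<mu> (h p)" if "h \<in> H" for h
      using density that unfolding quasi_conformal_density_def by blast
    then show "preserves_measure_class act H (\<mu> p)"
      unfolding preserves_measure_class_def using AC by simp
  qed
qed

end
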